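(* Let $\alpha\in[1,2)$. For any $T>0$ and $|\phi_+-\phi_-|\le 2\pi$, there is a $\gamma\in\Gamma_T(\bar x)$ with $\bar A_T(\gamma)=\bar c_T(\bar x)$, and: (1) if $\alpha\in(1,2)$, then $\gamma\in\Gamma_T^*(\bar x)$ and $\bar A_T(\gamma)<\bar A_T(\bar x)$; (2) if $\alpha=1$ and $|\phi_+-\phi_-|<2\pi$, then $\gamma\in\Gamma_T^*(\bar x)$ and $\bar A_T(\gamma)<\bar A_T(\bar x)$. Furthermore, $\gamma$ is a solution of the Kepler-type problem $\ddot x=-\frac{m_1x}{|x|^{\alpha+2}}$ if $\phi_+\ne\phi_-$.
   Context: Planar Kepler-type problem: $m_1>0$, $\bar V(x)=\frac{m_1}{\alpha|x|^\alpha}$ for $x\in\mathbb{C}$ ($=+\infty$ at $0$), equation of motion $\ddot x=\nabla\bar V(x)=-\frac{m_1x}{|x|^{\alpha+2}}$, Lagrangian $\bar L(x,\dot x)=\frac12|\dot x|^2+\bar V(x)$, and $\bar A_T(x)=\int_{-T}^T\bar L(x(t),\dot x(t))\,dt$. For angles $\phi_-,\phi_+\in\mathbb{R}$, the parabolic collision-ejection solution is $\bar x(t)=(\mu|t|)^{\frac{2}{\alpha+2}}e^{i\phi_+}$ for $t\ge0$ and $\bar x(t)=(\mu|t|)^{\frac{2}{\alpha+2}}e^{i\phi_-}$ for $t\le 0$, where $\mu=(\alpha+2)\left(\frac{m_1}{2\alpha}\right)^{1/2}$. $\Gamma_T^*(\bar x)$ is the set of $x\in H^1([-T,T],\mathbb{C}\setminus\{0\})$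 with $x(\pm T)=\bar x(\pm T)$ and $\mathrm{Arg}(x(\pm T))=\phi_\pm$; here the arguments are understood along a continuous determination of the argument on the path, i.e. there is a continuous $\theta:[-T,T]\to\mathbb{R}$ with $x(t)=|x(t)|e^{i\theta(t)}$, $\theta(-T)=\phi_-$ and $\theta(T)=\phi_+$. $\Gamma_T(\bar x)$ is the weak closure of $\Gamma_T^*(\bar x)$ in $H^1([-T,T],\mathbb{C})$, and $\bar c_T(\bar x)=\inf\{\bar A_T(x):x\in\Gamma_T(\bar x)\}$. *)

theory Defs
  imports "HOL-Analysis.Analysis"
begin

text \<open>
  A path on the interval from \<open>-T\<close> to \<open>T\<close> is a total function \<open>real \<Rightarrow> complex\<close>; its values outside the
  interval are irrelevant to every notion below. The plane is \<open>complex\<close> as a real inner product space.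
\<close>

text \<open>
  In dimension one, the elements of $H^1$ are the absolutely continuous functions with square
  integrable derivative, that is, the primitives of $L^2$ functions (which are integrable on a
  bounded interval). We use this continuous representative.
\<close>

definition has_H1_derivative :: "real \<Rightarrow> (real \<Rightarrow> complex) \<Rightarrow> (real \<Rightarrow> complex) \<Rightarrow> bool" where
  "has_H1_derivative T x v \<longleftrightarrow>
     v \<in> borel_measurable (lebesgue_on {-T..T}) \<and>
     integrable (lebesgue_on {-T..T}) (\<lambda>t. (norm (v t))\<^sup>2) \<and>
     (\<forall>t\<in>{-T..T}. x t = x (-T) + (LINT s|lebesgue_on {-T..t}. v s))"

definition H1 :: "real \<Rightarrow> (real \<Rightarrow> complex) set" where
  "H1 T = {x. \<exists>v. has_H1_derivative T x v}"

text \<open>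
  The choice is harmless: two derivatives of the same path agree almost everywhere, and
  \<open>H1_deriv\<close> is only used under integrals.
\<close>

definition H1_deriv :: "real \<Rightarrow> (real \<Rightarrow> complex) \<Rightarrow> real \<Rightarrow> complex" where
  "H1_deriv T x = (SOME v. has_H1_derivative T x v)"

definition H1_inner :: "real \<Rightarrow> (real \<Rightarrow> complex) \<Rightarrow> (real \<Rightarrow> complex) \<Rightarrow> real" where
  "H1_inner T x y =
     (LINT t|lebesgue_on {-T..T}. x t \<bullet> y t + H1_deriv T x t \<bullet> H1_deriv T y t)"

definition H1_weakly_converges :: "real \<Rightarrow> (nat \<Rightarrow> real \<Rightarrow> complex) \<Rightarrow> (real \<Rightarrow> complex) \<Rightarrow> bool" where
  "H1_weakly_converges T X x \<longleftrightarrow>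
     (\<forall>n. X n \<in> H1 T) \<and> x \<in> H1 T \<and>
     (\<forall>y\<in>H1 T. (\<lambda>n. H1_inner T (X n) y) \<longlonglongrightarrow> H1_inner T x y)"

text \<open>
  Weak closure in the sense of the direct method: all limits of weakly convergent sequences.
  The closure in the weak topology (limits of nets) would be a different set: a loop around the
  origin run through in a very short time is small against any prescribed finite set of functionals
  (centre it at a common Lebesgue point of their derivatives), so that closure of a class of paths
  with prescribed total angle contains the paths of all other winding numbers as well.
\<close>

definition H1_weak_closure :: "real \<Rightarrow> (real \<Rightarrow> complex) set \<Rightarrow> (real \<Rightarrow> complex) set" where
  "H1_weak_closure T S = {x. \<exists>X. (\<forall>n. X n \<in> S) \<and> H1_weakly_converges T X x}"

definition Vbar :: "real \<Rightarrow> real \<Rightarrow> complex \<Rightarrow> ennreal" where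
  "Vbar \<alpha> m\<^sub>1 z = (if z = 0 then \<infinity> else ennreal (m\<^sub>1 / (\<alpha> * norm z powr \<alpha>)))"

definition Lbar :: "real \<Rightarrow> real \<Rightarrow> complex \<Rightarrow> complex \<Rightarrow> ennreal" where
  "Lbar \<alpha> m\<^sub>1 z v = ennreal ((norm v)\<^sup>2 / 2) + Vbar \<alpha> m\<^sub>1 z"

text \<open>The Lagrangian is nonnegative, so the action is a value in \<open>[0, \<infinity>]\<close>.\<close>

definition action :: "real \<Rightarrow> real \<Rightarrow> real \<Rightarrow> (real \<Rightarrow> complex) \<Rightarrow> ennreal" where
  "action \<alpha> m\<^sub>1 T x = (\<integral>\<^sup>+t. Lbar \<alpha> m\<^sub>1 (x t) (H1_deriv T x t) \<partial>lebesgue_on {-T..T})"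

definition parabolic_mu :: "real \<Rightarrow> real \<Rightarrow> real" where
  "parabolic_mu \<alpha> m\<^sub>1 = (\<alpha> + 2) * sqrt (m\<^sub>1 / (2 * \<alpha>))"

definition xbar :: "real \<Rightarrow> real \<Rightarrow> real \<Rightarrow> real \<Rightarrow> real \<Rightarrow> complex" where
  "xbar \<alpha> m\<^sub>1 \<phi>m \<phi>p t =
     of_real ((parabolic_mu \<alpha> m\<^sub>1 * \<bar>t\<bar>) powr (2 / (\<alpha> + 2))) * cis (if t \<ge> 0 then \<phi>p else \<phi>m)"

definition Gamma_star :: "real \<Rightarrow> real \<Rightarrow> real \<Rightarrow> real \<Rightarrow> real \<Rightarrow> (real \<Rightarrow> complex) set" where
  "Gamma_star \<alpha> m\<^sub>1 \<phi>m \<phi>p T =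
     {x \<in> H1 T. (\<forall>t\<in>{-T..T}. x t \<noteq> 0) \<and>
        x (-T) = xbar \<alpha> m\<^sub>1 \<phi>m \<phi>p (-T) \<and> x T = xbar \<alpha> m\<^sub>1 \<phi>m \<phi>p T \<and>
        (\<exists>\<theta>::real \<Rightarrow> real. continuous_on {-T..T} \<theta> \<and>
           (\<forall>t\<in>{-T..T}. x t = of_real (norm (x t)) * cis (\<theta> t)) \<and>
           \<theta> (-T) = \<phi>m \<and> \<theta> T = \<phi>p)}"

definition Gamma :: "real \<Rightarrow> real \<Rightarrow> real \<Rightarrow> real \<Rightarrow> real \<Rightarrow> (real \<Rightarrow> complex) set" where
  "Gamma \<alpha> m\<^sub>1 \<phi>m \<phi>p T = H1_weak_closure T (Gamma_star \<alpha> m\<^sub>1 \<phi>m \<phi>p T)"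

definition cbar :: "real \<Rightarrow> real \<Rightarrow> real \<Rightarrow> real \<Rightarrow> real \<Rightarrow> ennreal" where
  "cbar \<alpha> m\<^sub>1 \<phi>m \<phi>p T = (INF x\<in>Gamma \<alpha> m\<^sub>1 \<phi>m \<phi>p T. action \<alpha> m\<^sub>1 T x)"

text \<open>
  Solutions may have collisions, as \<open>xbar\<close> has at time 0: the collision times form a null set, and
  the equation, which is meaningless at the origin, holds at every other time of the closed
  interval (one-sided derivatives at the end points). A solution without zeros is a classical
  one on the whole interval.
\<close>

definition kepler_solution :: "real \<Rightarrow> real \<Rightarrow> real \<Rightarrow> (real \<Rightarrow> complex) \<Rightarrow> bool" where
  "kepler_solution \<alpha> m\<^sub>1 T x \<longleftrightarrow>
     continuous_on {-T..T} x \<and>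
     negligible {t\<in>{-T..T}. x t = 0} \<and>
     (\<exists>v::real \<Rightarrow> complex. \<forall>t\<in>{-T..T}. x t \<noteq> 0 \<longrightarrow>
        (x has_vector_derivative v t) (at t within {-T..T}) \<and>
        (v has_vector_derivative - ((m\<^sub>1 / norm (x t) powr (\<alpha> + 2)) *\<^sub>R x t)) (at t within {-T..T}))"

end

theory Submission
  imports Defs "HOL-Complex_Analysis.Great_Picard"
begin

text \<open>
  The action is compared with a length. Since \<open>|v|\<^sup>2 / 2 + V \<ge> \<surd>(2 V) |v|\<close>, it is at least the length of the path
  in the Jacobi metric \<open>\<surd>(2 V) |dx|\<close> of energy zero, with equality for motions of energy zero such as \<open>xbar\<close>.
  In the coordinate \<open>x^(1/\<beta>)\<close> with \<open>\<beta> = 2 / (2 - \<alpha>)\<close> this metric is flat: the plane becomes a cone, \<open>xbar\<close>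
  becomes the broken line through its apex, and the angle between the two legs is \<open>\<bar>\<phi>p - \<phi>m\<bar> / \<beta>\<close>. There are
  three consequences.

  A path that meets the origin has at least the action of \<open>xbar\<close>, and a path that comes close to the
  origin has an action that is at most a little smaller (\<open>action_ge_collision\<close>, \<open>action_ge_near_collision\<close>).

  If the angle is less than \<open>pi\<close>, then the broken line can be shortened by cutting the corner. The time must
  remain \<open>2 T\<close>, but this is an effect of second order because the motion of energy zero is the optimal
  parametrization (\<open>bent_path_beats_collision\<close>). The case covers \<open>\<alpha> > 1\<close>, where \<open>\<beta> > 2\<close>, and \<open>\<alpha> = 1\<close> with
  \<open>\<bar>\<phi>p - \<phi>m\<bar> < 2 * pi\<close>.

  If \<open>\<alpha> = 1\<close> and \<open>\<bar>\<phi>p - \<phi>m\<bar> = 2 * pi\<close>, then the angle is \<open>pi\<close>, the two legs form a segment, and no path of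
  the class is shorter (\<open>action_ge_full_turn\<close>). Here \<open>xbar\<close> is a minimizer; it belongs to \<open>Gamma\<close> because the
  collision can be rounded off by short arcs (\<open>xbar_in_Gamma\<close>).

  When the corner can be cut, paths of nearly minimal action keep a fixed distance from the origin. Their
  potential energy is then continuous under uniform convergence, and the parallelogram identity for the
  kinetic energy forces the derivatives of a minimizing sequence to converge in \<open>L\<^sup>2\<close>; thus the minimum over
  \<open>Gamma_star\<close> is attained (\<open>minimizer_exists\<close>), and the vanishing of the first variation in one suitable
  direction yields the equation of motion (\<open>minimizer_solves_kepler\<close>).

  In this case the minimum over \<open>Gamma_star\<close> is also the minimum over \<open>Gamma\<close>: a weakly convergent sequence is bounded,
  hence uniformly convergent, so that a limit without zeros has the same total angle (\<open>Gamma_cases\<close>), while a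
  limit with zeros has at least the action of \<open>xbar\<close>.
\<close>

section \<open>Square integrable functions\<close>

definition sq_integrable :: "'a measure \<Rightarrow> ('a \<Rightarrow> 'b::euclidean_space) \<Rightarrow> bool" where
  "sq_integrable M f \<longleftrightarrow> f \<in> borel_measurable M \<and> integrable M (\<lambda>t. (norm (f t))\<^sup>2)"

definition L2_norm :: "'a measure \<Rightarrow> ('a \<Rightarrow> 'b::euclidean_space) \<Rightarrow> real" where
  "L2_norm M f = sqrt (LINT t|M. (norm (f t))\<^sup>2)"

lemma sq_integrable_measurable [measurable_dest]:
  "sq_integrable M f \<Longrightarrow> f \<in> borel_measurable M"
  by (simp add: sq_integrable_def)

lemma L2_norm_nonneg [simp]: "0 \<le> L2_norm M f"
  by (simp add: L2_norm_def)

lemma L2_norm_square: "(L2_norm M f)\<^sup>2 = (LINT t|M. (norm (f t))\<^sup>2)"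
  by (simp add: L2_norm_def)

lemma sq_integrable_scaleR:
  assumes "sq_integrable M f"
  shows "sq_integrable M (\<lambda>t. c *\<^sub>R f t)"
  using assms unfolding sq_integrable_def by (auto simp: power_mult_distrib)

lemma L2_norm_scaleR: "L2_norm M (\<lambda>t. c *\<^sub>R f t) = \<bar>c\<bar> * L2_norm M f"
  by (simp add: L2_norm_def power_mult_distrib real_sqrt_mult)

lemma integrable_norm_prod:
  assumes "sq_integrable M f" "sq_integrable M g"
  shows "integrable M (\<lambda>t. norm (f t) * norm (g t))"
proof (rule Bochner_Integration.integrable_bound)
  show "integrable M (\<lambda>t. (norm (f t))\<^sup>2 + (norm (g t))\<^sup>2)"
    using assms by (auto simp: sq_integrable_def)
  have "norm (f t) * norm (g t) \<le> (norm (f t))\<^sup>2 + (norm (g t))\<^sup>2" for t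
    using sum_squares_bound[of "norm (f t)" "norm (g t)"] mult_nonneg_nonneg[OF norm_ge_zero[of "f t"] norm_ge_zero[of "g t"]]
    by linarith
  then show "AE t in M. norm (norm (f t) * norm (g t)) \<le> norm ((norm (f t))\<^sup>2 + (norm (g t))\<^sup>2)"
    by simp
  show "(\<lambda>t. norm (f t) * norm (g t)) \<in> borel_measurable M"
    using assms[THEN sq_integrable_measurable] by measurable
qed

lemma integrable_inner_prod:
  assumes "sq_integrable M f" "sq_integrable M g"
  shows "integrable M (\<lambda>t. f t \<bullet> g t)"
proof (rule Bochner_Integration.integrable_bound[OF integrable_norm_prod[OF assms]])
  show "AE t in M. norm (f t \<bullet> g t) \<le> norm (norm (f t) * norm (g t))"
    by (auto intro!: Cauchy_Schwarz_ineq2)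
  show "(\<lambda>t. f t \<bullet> g t) \<in> borel_measurable M"
    using assms[THEN sq_integrable_measurable] by measurable
qed

lemma sq_integrable_add:
  assumes "sq_integrable M f" "sq_integrable M g"
  shows "sq_integrable M (\<lambda>t. f t + g t)"
proof -
  have [measurable]: "f \<in> borel_measurable M" "g \<in> borel_measurable M"
    using assms by (auto simp: sq_integrable_def)
  have "(norm (f t + g t))\<^sup>2 = (norm (f t))\<^sup>2 + 2 * (f t \<bullet> g t) + (norm (g t))\<^sup>2" for t
    by (simp add: power2_norm_eq_inner inner_add_left inner_add_right inner_commute)
  then show ?thesis
    using assms integrable_inner_prod[OF assms] by (auto simp: sq_integrable_def)
qed

lemma sq_integrable_diff:
  assumes "sq_integrable M f" "sq_integrable M g"
  shows "sq_integrable M (\<lambda>t. f t - g t)"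
  using sq_integrable_add[OF assms(1) sq_integrable_scaleR[OF assms(2), of "-1"]] by simp

lemma sq_integrable_zero [simp]: "sq_integrable M (\<lambda>t. 0)"
  by (simp add: sq_integrable_def)

lemma sq_integrable_sum:
  assumes "\<And>i. i \<in> I \<Longrightarrow> sq_integrable M (f i)"
  shows "sq_integrable M (\<lambda>t. \<Sum>i\<in>I. f i t)"
  using assms by (induction I rule: infinite_finite_induct) (simp_all add: sq_integrable_add)

text \<open>
  The optimal weight would be \<open>a / b\<close>; adding a small \<open>d\<close> to numerator and denominator also covers
  the cases \<open>a = 0\<close> and \<open>b = 0\<close>.
\<close>

lemma le_prod_of_young:
  fixes a b I :: real
  assumes "0 \<le> a" "0 \<le> b" and young: "\<And>e. e > 0 \<Longrightarrow> 2 * I \<le> a\<^sup>2 / e + e * b\<^sup>2"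
  shows "I \<le> a * b"
proof -
  have "2 * I \<le> a * (b + d) + (a + d) * b" if "d > 0" for d
  proof -
    have pos: "a + d > 0" "b + d > 0" using that assms by auto
    have "2 * I \<le> a\<^sup>2 / ((a + d) / (b + d)) + (a + d) / (b + d) * b\<^sup>2"
      using pos by (intro young) auto
    also have "a\<^sup>2 / ((a + d) / (b + d)) = a * (b + d) * (a / (a + d))"
      using pos by (simp add: power2_eq_square)
    also have "\<dots> \<le> a * (b + d) * 1"
      using pos assms that by (intro mult_left_mono) auto
    also have "(a + d) / (b + d) * b\<^sup>2 = (a + d) * b * (b / (b + d))"
      by (simp add: power2_eq_square)
    also have "\<dots> \<le> (a + d) * b * 1"
      using pos assms that by (intro mult_left_mono) auto
    finally show ?thesis by simp
  qed
  then have ev: "\<forall>\<^sub>F d in at_right 0. 2 * I \<le> a * (b + d) + (a + d) * b"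
    by (intro eventually_mono[OF eventually_at_right_less[of "0::real"]]) auto
  have "((\<lambda>d. a * (b + d) + (a + d) * b) \<longlongrightarrow> a * (b + 0) + (a + 0) * b) (at_right 0)"
    by (intro tendsto_intros)
  then have "2 * I \<le> a * (b + 0) + (a + 0) * b"
    by (rule tendsto_lowerbound[OF _ ev]) simp
  then show ?thesis by simp
qed

lemma L2_norm_prod:
  assumes "sq_integrable M f" "sq_integrable M g"
  shows "(LINT t|M. norm (f t) * norm (g t)) \<le> L2_norm M f * L2_norm M g"
proof -
  let ?A = "L2_norm M f" and ?B = "L2_norm M g"
  define I where "I = (LINT t|M. norm (f t) * norm (g t))"
  have young: "2 * I \<le> ?A\<^sup>2 / e + e * ?B\<^sup>2" if "e > 0" for e
  proof -
    have "2 * (norm (f t) * norm (g t)) \<le> (norm (f t))\<^sup>2 / e + e * (norm (g t))\<^sup>2" for t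
    proof -
      have "2 * (norm (f t) / sqrt e) * (sqrt e * norm (g t)) \<le> (norm (f t) / sqrt e)\<^sup>2 + (sqrt e * norm (g t))\<^sup>2"
        by (rule sum_squares_bound)
      then show ?thesis using that by (simp add: power_divide power_mult_distrib)
    qed
    then have "(LINT t|M. 2 * (norm (f t) * norm (g t)))
        \<le> (LINT t|M. (norm (f t))\<^sup>2 / e + e * (norm (g t))\<^sup>2)"
      using assms integrable_norm_prod[OF assms]
      by (intro integral_mono) (auto simp: sq_integrable_def)
    also have "\<dots> = ?A\<^sup>2 / e + e * ?B\<^sup>2"
      using assms by (subst Bochner_Integration.integral_add) (auto simp: sq_integrable_def L2_norm_square)
    finally show ?thesis by (simp add: I_def)
  qed
  from le_prod_of_young[OF _ _ young] show ?thesis by (simp add: I_def)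
qed

lemma L2_inner_bound:
  assumes "sq_integrable M f" "sq_integrable M g"
  shows "\<bar>LINT t|M. f t \<bullet> g t\<bar> \<le> L2_norm M f * L2_norm M g"
proof -
  have "\<bar>LINT t|M. f t \<bullet> g t\<bar> \<le> (LINT t|M. \<bar>f t \<bullet> g t\<bar>)"
    by (rule integral_abs_bound)
  also have "\<dots> \<le> (LINT t|M. norm (f t) * norm (g t))"
    using integrable_inner_prod[OF assms] integrable_norm_prod[OF assms]
    by (intro integral_mono) (auto intro: Cauchy_Schwarz_ineq2)
  finally show ?thesis using L2_norm_prod[OF assms] by simp
qed

lemma L2_norm_add_square:
  assumes "sq_integrable M f" "sq_integrable M g"
  shows "(L2_norm M (\<lambda>t. f t + g t))\<^sup>2 =
    (L2_norm M f)\<^sup>2 + 2 * (LINT t|M. f t \<bullet> g t) + (L2_norm M g)\<^sup>2"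
proof -
  have "(norm (f t + g t))\<^sup>2 = (norm (f t))\<^sup>2 + 2 * (f t \<bullet> g t) + (norm (g t))\<^sup>2" for t
    by (simp add: power2_norm_eq_inner inner_add_left inner_add_right inner_commute)
  then show ?thesis
    using assms integrable_inner_prod[OF assms] by (simp add: L2_norm_square sq_integrable_def)
qed

lemma L2_norm_triangle:
  assumes "sq_integrable M f" "sq_integrable M g"
  shows "L2_norm M (\<lambda>t. f t + g t) \<le> L2_norm M f + L2_norm M g"
proof (rule power2_le_imp_le)
  show "(L2_norm M (\<lambda>t. f t + g t))\<^sup>2 \<le> (L2_norm M f + L2_norm M g)\<^sup>2"
    using L2_norm_add_square[OF assms] L2_inner_bound[OF assms] by (simp add: power2_sum)
qed simp

lemma L2_norm_sum:
  assumes "\<And>i. i \<in> I \<Longrightarrow> sq_integrable M (f i)"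
  shows "L2_norm M (\<lambda>t. \<Sum>i\<in>I. f i t) \<le> (\<Sum>i\<in>I. L2_norm M (f i))"
  using assms
proof (induction I rule: infinite_finite_induct)
  case (insert i I)
  have "L2_norm M (\<lambda>t. \<Sum>j\<in>insert i I. f j t) \<le> L2_norm M (f i) + L2_norm M (\<lambda>t. \<Sum>j\<in>I. f j t)"
    using insert by (simp add: L2_norm_triangle sq_integrable_sum)
  also have "\<dots> \<le> L2_norm M (f i) + (\<Sum>j\<in>I. L2_norm M (f j))"
    using insert by simp
  finally show ?case using insert by simp
qed (simp_all add: L2_norm_def)

lemma geometric_tail_bound:
  "(\<Sum>k=n..<m. (1/4)^k) \<le> (4/3) * (1/4 :: real)^n"
proof (cases "n \<le> m")
  case True
  then have "(\<Sum>k=n..<m. (1/4 :: real)^k) = (4/3) * ((1/4)^n - (1/4)^m)"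
    by (induction rule: dec_induct) (simp_all add: algebra_simps)
  then show ?thesis by simp
qed simp

text \<open>
  Completeness of \<open>L\<^sup>2\<close>, for series that converge geometrically. The series converges almost everywhere,
  and Fatou's lemma with the triangle inequality for finite sums bounds the tails. With the ratio
  \<open>1/4\<close> the tail after a term is at most a third of the bound for that term, so that a single term can
  dominate all later ones; the gliding hump argument below relies on this.
\<close>

lemma L2_series:
  fixes u :: "nat \<Rightarrow> 'a \<Rightarrow> 'b::euclidean_space"
  assumes u: "\<And>k. sq_integrable M (u k)" and bound: "\<And>k. L2_norm M (u k) \<le> c * (1/4)^k" and "0 \<le> c"
  obtains w where "sq_integrable M w"
    "\<And>n. L2_norm M (\<lambda>t. w t - (\<Sum>k<n. u k t)) \<le> c * (4/3) * (1/4)^n"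
proof -
  have [measurable]: "u k \<in> borel_measurable M" for k
    using u by (auto simp: sq_integrable_def)
  let ?N = "\<lambda>f. \<integral>\<^sup>+t. ennreal ((norm (f t))\<^sup>2) \<partial>M"
  have N_eq: "?N f = ennreal ((L2_norm M f)\<^sup>2)" if "sq_integrable M f" for f :: "'a \<Rightarrow> 'b"
    using that by (simp add: L2_norm_square sq_integrable_def nn_integral_eq_integral)
  define w where "w t = (\<Sum>k. u k t)" for t
  have [measurable]: "w \<in> borel_measurable M" unfolding w_def by measurable
  have "AE t in M. summable (\<lambda>k. norm (u k t))"
  proof -
    \<comment> \<open>The weights \<open>4^k\<close> leave a convergent series \<open>c\<^sup>2 * (1/4)^k\<close> of integrals, and a bound on
      \<open>4^k * (norm (u k t))\<^sup>2\<close> still makes \<open>norm (u k t)\<close> summable over \<open>k\<close>.\<close>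
    have "(\<integral>\<^sup>+t. (\<Sum>k. ennreal (4^k * (norm (u k t))\<^sup>2)) \<partial>M) = (\<Sum>k. \<integral>\<^sup>+t. ennreal (4^k * (norm (u k t))\<^sup>2) \<partial>M)"
      by (rule nn_integral_suminf) measurable
    also have "\<dots> \<le> (\<Sum>k. ennreal (c\<^sup>2 * (1/4)^k))"
    proof (intro suminf_le summableI)
      fix k
      have "(\<integral>\<^sup>+t. ennreal (4^k * (norm (u k t))\<^sup>2) \<partial>M) = ennreal (4^k) * ?N (u k)"
        by (simp add: ennreal_mult nn_integral_cmult)
      also have "\<dots> = ennreal (4^k * (L2_norm M (u k))\<^sup>2)"
        using N_eq[OF u] by (simp add: ennreal_mult)
      also have "\<dots> \<le> ennreal (4^k * (c * (1/4)^k)\<^sup>2)"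
        using bound by (intro ennreal_leI mult_left_mono power_mono) auto
      also have "4^k * (c * (1/4)^k)\<^sup>2 = c\<^sup>2 * (1/4 :: real)^k"
        by (simp add: power_mult_distrib power2_eq_square field_simps)
      finally show "(\<integral>\<^sup>+t. ennreal (4^k * (norm (u k t))\<^sup>2) \<partial>M) \<le> ennreal (c\<^sup>2 * (1/4)^k)" .
    qed
    also have "\<dots> = ennreal (\<Sum>k. c\<^sup>2 * (1/4)^k)"
      by (rule suminf_ennreal2) (auto intro!: summable_mult summable_geometric)
    also have "\<dots> < \<infinity>" by simp
    finally have "(\<integral>\<^sup>+t. (\<Sum>k. ennreal (4^k * (norm (u k t))\<^sup>2)) \<partial>M) \<noteq> \<infinity>" by simp
    then have "AE t in M. (\<Sum>k. ennreal (4^k * (norm (u k t))\<^sup>2)) \<noteq> \<infinity>"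
      by (intro nn_integral_PInf_AE) measurable
    then show ?thesis
    proof eventually_elim
      case (elim t)
      then have s: "summable (\<lambda>k. 4^k * (norm (u k t))\<^sup>2)"
        by (intro summable_suminf_not_top) auto
      show ?case
      proof (rule summable_comparison_test')
        show "summable (\<lambda>k. 4^k * (norm (u k t))\<^sup>2 + (1/4::real)^k)"
          by (intro summable_add s summable_geometric) auto
        fix k
        have "2 * (2^k * norm (u k t)) * (1/2)^k \<le> (2^k * norm (u k t))\<^sup>2 + ((1/2)^k)\<^sup>2"
          by (rule sum_squares_bound)
        moreover have "(2^k * norm (u k t))\<^sup>2 = 4^k * (norm (u k t))\<^sup>2" "((1/2)^k)\<^sup>2 = (1/4::real)^k"
          by (simp_all add: power2_eq_square flip: power_mult_distrib)
        moreover have "2 * (2^k * norm (u k t)) * (1/2)^k = 2 * norm (u k t)"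
          by (simp add: power_divide)
        ultimately show "norm (norm (u k t)) \<le> 4^k * (norm (u k t))\<^sup>2 + (1/4)^k"
          using norm_ge_zero[of "u k t"] by (simp only: real_norm_def abs_norm_cancel)
      qed
    qed
  qed
  then have sums: "AE t in M. (\<lambda>k. u k t) sums w t"
    by eventually_elim (simp add: w_def summable_norm_cancel summable_sums)
  have tail: "?N (\<lambda>t. w t - (\<Sum>k<n. u k t)) \<le> ennreal ((c * (4/3) * (1/4)^n)\<^sup>2)" for n
  proof -
    have "?N (\<lambda>t. w t - (\<Sum>k<n. u k t)) =
        (\<integral>\<^sup>+t. liminf (\<lambda>m. ennreal ((norm ((\<Sum>k<m. u k t) - (\<Sum>k<n. u k t)))\<^sup>2)) \<partial>M)"
    proof (rule nn_integral_cong_AE, use sums in eventually_elim)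
      case (elim t)
      then have "(\<lambda>m. ennreal ((norm ((\<Sum>k<m. u k t) - (\<Sum>k<n. u k t)))\<^sup>2))
          \<longlonglongrightarrow> ennreal ((norm (w t - (\<Sum>k<n. u k t)))\<^sup>2)"
        unfolding sums_def by (intro tendsto_intros)
      then show ?case by (rule lim_imp_Liminf[symmetric, rotated]) simp
    qed
    also have "\<dots> \<le> liminf (\<lambda>m. ?N (\<lambda>t. (\<Sum>k<m. u k t) - (\<Sum>k<n. u k t)))"
      by (rule nn_integral_liminf) measurable
    also have "\<dots> \<le> ennreal ((c * (4/3) * (1/4)^n)\<^sup>2)"
    proof (rule Liminf_le)
      show "\<forall>\<^sub>F m in sequentially. ?N (\<lambda>t. (\<Sum>k<m. u k t) - (\<Sum>k<n. u k t)) \<le> ennreal ((c * (4/3) * (1/4)^n)\<^sup>2)"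
        using eventually_ge_at_top[of n]
      proof eventually_elim
        case (elim m)
        have eq: "(\<Sum>k<m. u k t) - (\<Sum>k<n. u k t) = (\<Sum>k=n..<m. u k t)" for t
          using elim by (simp add: sum_diff_nat_ivl lessThan_atLeast0)
        have "L2_norm M (\<lambda>t. \<Sum>k=n..<m. u k t) \<le> (\<Sum>k=n..<m. L2_norm M (u k))"
          using u by (intro L2_norm_sum)
        also have "\<dots> \<le> (\<Sum>k=n..<m. c * (1/4)^k)"
          using bound by (intro sum_mono)
        also have "\<dots> \<le> c * ((4/3) * (1/4)^n)"
          using mult_left_mono[OF geometric_tail_bound[of n m] \<open>0 \<le> c\<close>] by (simp only: sum_distrib_left)
        finally show ?case
          unfolding eq using u by (subst N_eq) (auto intro!: sq_integrable_sum ennreal_leI power_mono)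
      qed
    qed simp
    finally show ?thesis .
  qed
  have tail_sq: "sq_integrable M (\<lambda>t. w t - (\<Sum>k<n. u k t))" for n
    unfolding sq_integrable_def
  proof
    show "integrable M (\<lambda>t. (norm (w t - (\<Sum>k<n. u k t)))\<^sup>2)"
      using tail[of n] by (intro integrableI_bounded) (auto simp: order_le_less_trans)
  qed measurable
  show thesis
  proof
    show "sq_integrable M w" using tail_sq[of 0] by simp
    show "L2_norm M (\<lambda>t. w t - (\<Sum>k<n. u k t)) \<le> c * (4/3) * (1/4)^n" for n
    proof (rule power2_le_imp_le)
      show "(L2_norm M (\<lambda>t. w t - (\<Sum>k<n. u k t)))\<^sup>2 \<le> (c * (4/3) * (1/4)^n)\<^sup>2"
        using tail[of n] N_eq[OF tail_sq[of n]] by simp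
    qed (use \<open>0 \<le> c\<close> in simp)
  qed
qed

section \<open>Absolutely continuous paths\<close>

text \<open>
  In dimension one the primitives of integrable functions are the absolutely continuous functions. The
  derivative is carried along because it is determined only almost everywhere.
\<close>

definition primitive_on :: "real \<Rightarrow> real \<Rightarrow> (real \<Rightarrow> 'b::euclidean_space) \<Rightarrow> (real \<Rightarrow> 'b) \<Rightarrow> bool" where
  "primitive_on a b x v \<longleftrightarrow> integrable (lebesgue_on {a..b}) v \<and>
     (\<forall>t\<in>{a..b}. x t - x a = (LINT s|lebesgue_on {a..t}. v s))"

lemma integrable_Icc_mono:
  fixes f :: "real \<Rightarrow> 'b::euclidean_space"
  assumes "integrable (lebesgue_on {a..b}) f" "a \<le> c" "d \<le> b"
  shows "integrable (lebesgue_on {c..d}) f"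
  using assms by (intro integrable_subinterval[OF assms(1)]) auto

lemma primitive_on_integrable: "primitive_on a b x v \<Longrightarrow> integrable (lebesgue_on {a..b}) v"
  by (simp add: primitive_on_def)

lemma primitive_on_increment:
  assumes "primitive_on a b x v" "a \<le> s" "s \<le> t" "t \<le> b"
  shows "x t - x s = (LINT u|lebesgue_on {s..t}. v u)"
proof -
  have "integrable (lebesgue_on {a..t}) v"
    using assms integrable_Icc_mono[of a b v a t] by (simp add: primitive_on_def)
  from integral_combine[OF this, of s]
  have "(x t - x a) - (x s - x a) = (LINT u|lebesgue_on {s..t}. v u)"
    using assms by (simp add: primitive_on_def)
  then show ?thesis by simp
qed

lemma primitive_onI:
  assumes "integrable (lebesgue_on {a..b}) v"
    and "\<And>t. a \<le> t \<Longrightarrow> t \<le> b \<Longrightarrow> x t - x a = (LINT u|lebesgue_on {a..t}. v u)"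
  shows "primitive_on a b x v"
  using assms by (auto simp: primitive_on_def)

lemma primitive_on_subinterval:
  assumes "primitive_on a b x v" "a \<le> c" "c \<le> d" "d \<le> b"
  shows "primitive_on c d x v"
  using assms
  by (intro primitive_onI) (auto intro: primitive_on_increment integrable_Icc_mono[OF primitive_on_integrable])

lemma primitive_on_continuous:
  assumes "primitive_on a b x v"
  shows "continuous_on {a..b} x"
proof -
  have "continuous_on {a..b} (\<lambda>t. x a + (LINT s|lebesgue_on {a..t}. v s))"
    using assms by (intro continuous_intros indefinite_integral_continuous_real) (simp add: primitive_on_def)
  moreover have "x t = x a + (LINT s|lebesgue_on {a..t}. v s)" if "t \<in> {a..b}" for t
    using assms that unfolding primitive_on_def by (metis add_diff_cancel_left' add_diff_eq)
  ultimately show ?thesis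
    using continuous_on_cong by (metis (no_types, lifting))
qed

lemma primitive_on_norm_increment:
  assumes "primitive_on a b x v" "a \<le> s" "s \<le> t" "t \<le> b"
  shows "norm (x t - x s) \<le> (LINT u|lebesgue_on {s..t}. norm (v u))"
  using primitive_on_increment[OF assms] integral_norm_bound[of "lebesgue_on {s..t}" v] by simp

lemma primitive_on_indefinite:
  assumes "integrable (lebesgue_on {a..b}) v"
  shows "primitive_on a b (\<lambda>t. LINT s|lebesgue_on {a..t}. v s) v"
proof -
  have "(LINT s|lebesgue_on {a..a}. v s) = 0"
    using has_bochner_integral_null[of "{a..a}" v] by (auto simp: has_bochner_integral_iff)
  then show ?thesis
    using assms by (simp add: primitive_on_def)
qed

lemma primitive_on_FTC:
  fixes x :: "real \<Rightarrow> 'b::euclidean_space"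
  assumes "a \<le> b" "continuous_on {a..b} x"
    and "\<And>t. a < t \<Longrightarrow> t < b \<Longrightarrow> (x has_vector_derivative v t) (at t)"
    and int: "integrable (lebesgue_on {a..b}) v"
  shows "primitive_on a b x v"
proof (rule primitive_onI[OF int])
  fix t assume t: "a \<le> t" "t \<le> b"
  have "(v has_integral (x t - x a)) {a..t}"
    using assms t by (intro fundamental_theorem_of_calculus_interior) (auto intro: continuous_on_subset)
  moreover have "integrable (lebesgue_on {a..t}) v"
    using int t by (intro integrable_Icc_mono[OF int]) auto
  ultimately show "x t - x a = (LINT u|lebesgue_on {a..t}. v u)"
    by (simp add: lebesgue_integral_eq_integral integral_unique)
qed

lemma primitive_on_combine:
  assumes "primitive_on a c x v" "primitive_on c b x v" "a \<le> c" "c \<le> b"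
  shows "primitive_on a b x v"
proof (rule primitive_onI)
  show int: "integrable (lebesgue_on {a..b}) v"
    using assms by (auto simp: primitive_on_def intro: integrable_combine)
  fix t assume t: "a \<le> t" "t \<le> b"
  show "x t - x a = (LINT u|lebesgue_on {a..t}. v u)"
  proof (cases "t \<le> c")
    case False
    have "integrable (lebesgue_on {a..t}) v"
      using int t by (intro integrable_Icc_mono[OF int]) auto
    from integral_combine[OF this, of c]
    have "(x t - x c) + (x c - x a) = (LINT u|lebesgue_on {a..t}. v u)"
      using primitive_on_increment[OF assms(1), of a c] primitive_on_increment[OF assms(2), of c t] False assms t
      by simp
    then show ?thesis by simp
  qed (use primitive_on_increment[OF assms(1), of a t] t in auto)
qed

lemma primitive_on_linear:
  assumes "bounded_linear L" "primitive_on a b x v"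
  shows "primitive_on a b (\<lambda>t. L (x t)) (\<lambda>t. L (v t))"
proof (rule primitive_onI)
  interpret bounded_linear L by fact
  show "integrable (lebesgue_on {a..b}) (\<lambda>t. L (v t))"
    using assms by (auto intro: integrable_bounded_linear simp: primitive_on_def)
  fix t assume t: "a \<le> t" "t \<le> b"
  have "integrable (lebesgue_on {a..t}) v"
    using assms t integrable_Icc_mono[of a b v a t] by (simp add: primitive_on_def)
  then show "L (x t) - L (x a) = (LINT u|lebesgue_on {a..t}. L (v u))"
    using primitive_on_increment[OF assms(2), of a t] t
    by (simp add: integral_bounded_linear[OF assms(1)] flip: diff)
qed

lemma primitive_on_add:
  assumes "primitive_on a b x v" "primitive_on a b y w"
  shows "primitive_on a b (\<lambda>t. x t + y t) (\<lambda>t. v t + w t)"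
proof (rule primitive_onI)
  show "integrable (lebesgue_on {a..b}) (\<lambda>t. v t + w t)"
    using assms by (auto simp: primitive_on_def)
  fix t assume t: "a \<le> t" "t \<le> b"
  have "integrable (lebesgue_on {a..t}) v" "integrable (lebesgue_on {a..t}) w"
    using assms[THEN primitive_on_integrable] t by (auto intro: integrable_Icc_mono[where a=a and b=b])
  then show "x t + y t - (x a + y a) = (LINT u|lebesgue_on {a..t}. v u + w u)"
    using primitive_on_increment[OF assms(1), of a t] primitive_on_increment[OF assms(2), of a t] t
    by (simp add: add_diff_add)
qed

lemma primitive_on_scaleR:
  "primitive_on a b x v \<Longrightarrow> primitive_on a b (\<lambda>t. c *\<^sub>R x t) (\<lambda>t. c *\<^sub>R v t)"
  by (rule primitive_on_linear[OF bounded_linear_scaleR_right])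

text \<open>
  Takes the place of differentiation almost everywhere: an inequality between increments has to be
  checked on short intervals only, on which continuous coefficients are nearly constant. The product rule
  and the calibration bound both follow from it by letting the oscillation of the coefficients tend to 0.
\<close>

lemma local_increment_bound_imp_global:
  fixes F :: "real \<Rightarrow> 'b::real_normed_vector" and H :: "real \<Rightarrow> real"
  assumes "0 < \<eta>"
    and local: "\<And>s t. a \<le> s \<Longrightarrow> s \<le> t \<Longrightarrow> t \<le> b \<Longrightarrow> t - s < \<eta> \<Longrightarrow> norm (F t - F s) \<le> H t - H s"
    and "a \<le> b"
  shows "norm (F b - F a) \<le> H b - H a"
proof -
  have "norm (F t - F a) \<le> H t - H a" if "a \<le> t" "t \<le> b" "t - a \<le> real n * (\<eta> / 2)" for n t
    using that
  proof (induction n arbitrary: t)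
    case 0
    then show ?case using local[of a a] by auto
  next
    case (Suc n)
    show ?case
    proof (cases "t - a < \<eta>")
      case False
      let ?s = "t - \<eta> / 2"
      have "norm (F t - F a) \<le> norm (F t - F ?s) + norm (F ?s - F a)"
        using norm_triangle_ineq[of "F t - F ?s" "F ?s - F a"] by simp
      also have "\<dots> \<le> (H t - H ?s) + (H ?s - H a)"
        using Suc False \<open>0 < \<eta>\<close> by (intro add_mono local Suc.IH) (auto simp: algebra_simps add_divide_distrib)
      finally show ?thesis by simp
    qed (use local Suc in auto)
  qed
  moreover obtain n where "b - a \<le> real n * (\<eta> / 2)"
    using reals_Archimedean3[of "\<eta> / 2"] \<open>0 < \<eta>\<close> by (meson half_gt_zero less_imp_le)
  ultimately show ?thesis using \<open>a \<le> b\<close> by auto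
qed

lemma continuous_on_Icc_uniform:
  fixes f :: "real \<Rightarrow> 'b::real_normed_vector"
  assumes "continuous_on {a..b} f" "0 < \<delta>"
  obtains \<eta> where "0 < \<eta>"
    "\<And>s t. s \<in> {a..b} \<Longrightarrow> t \<in> {a..b} \<Longrightarrow> \<bar>t - s\<bar> < \<eta> \<Longrightarrow> norm (f t - f s) < \<delta>"
proof -
  have "uniformly_continuous_on {a..b} f"
    using assms by (intro compact_uniformly_continuous) auto
  then obtain \<eta> where "\<eta> > 0" "\<And>s t. s \<in> {a..b} \<Longrightarrow> t \<in> {a..b} \<Longrightarrow> dist t s < \<eta> \<Longrightarrow> dist (f t) (f s) < \<delta>"
    using \<open>0 < \<delta>\<close> unfolding uniformly_continuous_on_def by metis
  then show thesis by (intro that[of \<eta>]) (auto simp: dist_norm)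
qed

lemma integrable_continuous_product:
  fixes a b :: real and h :: "'b::euclidean_space \<Rightarrow> 'c::euclidean_space \<Rightarrow> 'd::euclidean_space"
  assumes h: "bounded_bilinear h" and f: "continuous_on {a..b} f" and g: "integrable (lebesgue_on {a..b}) g"
  shows "integrable (lebesgue_on {a..b}) (\<lambda>t. h (f t) (g t))"
proof -
  have "g absolutely_integrable_on {a..b}"
    unfolding set_integrable_def using g by (simp add: integrable_restrict_space)
  moreover have "bounded (f ` {a..b})"
    using f by (intro compact_imp_bounded compact_continuous_image) auto
  moreover have "f \<in> borel_measurable (lebesgue_on {a..b})"
    using f by (intro continuous_imp_measurable_on_sets_lebesgue) auto
  ultimately have "(\<lambda>t. h (f t) (g t)) absolutely_integrable_on {a..b}"
    using h absolutely_integrable_bounded_measurable_product[of h f "{a..b}" g]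
    by (simp add: bilinear_conv_bounded_bilinear)
  then show ?thesis
    unfolding set_integrable_def by (simp add: integrable_restrict_space)
qed

lemma le_of_le_plus_mult_eps:
  fixes x y c :: real
  assumes "\<And>\<delta>. \<delta> > 0 \<Longrightarrow> x \<le> y + \<delta> * c"
  shows "x \<le> y"
proof -
  have "((\<lambda>\<delta>. y + \<delta> * c) \<longlongrightarrow> y + 0 * c) (at_right 0)"
    by (intro tendsto_intros)
  moreover have "\<forall>\<^sub>F \<delta> in at_right 0. x \<le> y + \<delta> * c"
    using assms by (intro eventually_mono[OF eventually_at_right_less[of "0::real"]]) auto
  ultimately have "x \<le> y + 0 * c"
    by (rule tendsto_lowerbound) simp
  then show ?thesis by simp
qed

text \<open>
  On intervals on which \<open>f\<close> and \<open>g\<close> oscillate by less than \<open>\<delta>\<close>, freezing them changes the integral of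
  \<open>F * g + f * G\<close> by at most a multiple of \<open>\<delta>\<close> times the integral of \<open>norm F + norm G\<close>.
\<close>

lemma primitive_on_product:
  fixes f :: "real \<Rightarrow> 'b::euclidean_space" and g :: "real \<Rightarrow> 'c::euclidean_space"
    and h :: "'b \<Rightarrow> 'c \<Rightarrow> 'd::euclidean_space"
  assumes h: "bounded_bilinear h" and f: "primitive_on a b f F" and g: "primitive_on a b g G"
  shows "primitive_on a b (\<lambda>t. h (f t) (g t)) (\<lambda>t. h (F t) (g t) + h (f t) (G t))"
proof (rule primitive_onI)
  interpret bounded_bilinear h by fact
  let ?I = "\<lambda>t. h (F t) (g t) + h (f t) (G t)"
  note cf = primitive_on_continuous[OF f] and cg = primitive_on_continuous[OF g]
  note intF = primitive_on_integrable[OF f] and intG = primitive_on_integrable[OF g]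
  have I1: "integrable (lebesgue_on {a..b}) (\<lambda>t. h (F t) (g t))"
    by (rule integrable_continuous_product[OF bounded_bilinear.flip[OF h] cg intF])
  have I2: "integrable (lebesgue_on {a..b}) (\<lambda>t. h (f t) (G t))"
    by (rule integrable_continuous_product[OF h cf intG])
  from I1 I2 show int: "integrable (lebesgue_on {a..b}) ?I" by simp
  fix c assume c: "a \<le> c" "c \<le> b"
  obtain K where K: "K > 0" "\<And>y z. norm (h y z) \<le> norm y * norm z * K"
    using pos_bounded by auto
  define D where "D t = h (f t) (g t) - (LINT u|lebesgue_on {a..t}. ?I u)" for t
  define N where "N t = (LINT u|lebesgue_on {a..t}. norm (F u) + norm (G u))" for t
  have intN: "integrable (lebesgue_on {a..b}) (\<lambda>u. norm (F u) + norm (G u))"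
    using intF intG by simp
  have small: "norm (D c - D a) \<le> \<delta> * (K * (N c - N a))" if d0: "\<delta> > 0" for \<delta>
  proof -
    obtain \<eta>1 where \<eta>1: "0 < \<eta>1"
      "\<And>s t. s \<in> {a..b} \<Longrightarrow> t \<in> {a..b} \<Longrightarrow> \<bar>t - s\<bar> < \<eta>1 \<Longrightarrow> norm (f t - f s) < \<delta>"
      using continuous_on_Icc_uniform[OF cf d0] by metis
    obtain \<eta>2 where \<eta>2: "0 < \<eta>2"
      "\<And>s t. s \<in> {a..b} \<Longrightarrow> t \<in> {a..b} \<Longrightarrow> \<bar>t - s\<bar> < \<eta>2 \<Longrightarrow> norm (g t - g s) < \<delta>"
      using continuous_on_Icc_uniform[OF cg d0] by metis
    have "norm (D c - D a) \<le> \<delta> * K * N c - \<delta> * K * N a"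
    proof (rule local_increment_bound_imp_global[of "min \<eta>1 \<eta>2"])
      fix s t assume st: "a \<le> s" "s \<le> t" "t \<le> c" "t - s < min \<eta>1 \<eta>2"
      let ?M = "lebesgue_on {s..t}"
      have sub: "integrable ?M k" if "integrable (lebesgue_on {a..b}) k" for k :: "real \<Rightarrow> 'z::euclidean_space"
        using that by (rule integrable_subinterval) (use st c in auto)
      have Iinc: "(LINT u|lebesgue_on {a..t}. ?I u) - (LINT u|lebesgue_on {a..s}. ?I u) = (LINT u|?M. ?I u)"
        using primitive_on_increment[OF primitive_on_indefinite[OF int], of s t] st c by simp
      have Ninc: "N t - N s = (LINT u|?M. norm (F u) + norm (G u))"
        using primitive_on_increment[OF primitive_on_indefinite[OF intN], of s t] st c by (simp add: N_def)
      have "h (f t) (g t) - h (f s) (g s) = h (f t - f s) (g t) + h (f s) (g t - g s)"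
        by (simp add: diff_left diff_right)
      also have "f t - f s = (LINT u|?M. F u)"
        using primitive_on_increment[OF f] st c by simp
      also have "g t - g s = (LINT u|?M. G u)"
        using primitive_on_increment[OF g] st c by simp
      also have "h (LINT u|?M. F u) (g t) = (LINT u|?M. h (F u) (g t))"
        using integral_bounded_linear[OF bounded_linear_left sub[OF intF]] by simp
      also have "h (f s) (LINT u|?M. G u) = (LINT u|?M. h (f s) (G u))"
        using integral_bounded_linear[OF bounded_linear_right sub[OF intG]] by simp
      finally have "D t - D s = (LINT u|?M. h (F u) (g t)) + (LINT u|?M. h (f s) (G u)) - (LINT u|?M. ?I u)"
        using Iinc by (simp add: D_def algebra_simps)
      also have "\<dots> = (LINT u|?M. h (F u) (g t - g u) + h (f s - f u) (G u))"
      proof -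
        have i1: "integrable ?M (\<lambda>u. h (F u) (g t))"
          by (rule integrable_bounded_linear[OF bounded_linear_left sub[OF intF]])
        have i2: "integrable ?M (\<lambda>u. h (f s) (G u))"
          by (rule integrable_bounded_linear[OF bounded_linear_right sub[OF intG]])
        show ?thesis
          using i1 i2 sub[OF I1] sub[OF I2]
          by (simp add: diff_left diff_right flip: Bochner_Integration.integral_add Bochner_Integration.integral_diff)
             (simp add: algebra_simps)
      qed
      finally have "norm (D t - D s) \<le> (LINT u|?M. norm (h (F u) (g t - g u) + h (f s - f u) (G u)))"
        using integral_norm_bound by metis
      also have "\<dots> \<le> (LINT u|?M. \<delta> * K * (norm (F u) + norm (G u)))"
      proof (rule integral_mono')
        show "integrable ?M (\<lambda>u. \<delta> * K * (norm (F u) + norm (G u)))"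
          using sub[OF intN] by simp
        fix u assume "u \<in> space ?M"
        then have u: "u \<in> {s..t}" by simp
        have "norm (h (F u) (g t - g u)) \<le> norm (F u) * norm (g t - g u) * K"
          by (rule K)
        also have "\<dots> \<le> norm (F u) * \<delta> * K"
          using \<eta>2(2)[of u t] u st c K(1) by (intro mult_right_mono mult_left_mono) auto
        finally have 1: "norm (h (F u) (g t - g u)) \<le> norm (F u) * \<delta> * K" .
        have "norm (h (f s - f u) (G u)) \<le> norm (f s - f u) * norm (G u) * K"
          by (rule K)
        also have "\<dots> \<le> \<delta> * norm (G u) * K"
          using \<eta>1(2)[of u s] u st c K(1) by (intro mult_right_mono) auto
        finally have 2: "norm (h (f s - f u) (G u)) \<le> \<delta> * norm (G u) * K" .
        show "norm (h (F u) (g t - g u) + h (f s - f u) (G u)) \<le> \<delta> * K * (norm (F u) + norm (G u))"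
          using norm_triangle_le[OF add_mono[OF 1 2]] by (simp add: algebra_simps)
      qed (use \<open>\<delta> > 0\<close> K in auto)
      also have "\<dots> = \<delta> * K * (N t - N s)"
        unfolding Ninc by simp
      also have "\<dots> = \<delta> * K * N t - \<delta> * K * N s"
        by (simp add: algebra_simps)
      finally show "norm (D t - D s) \<le> \<delta> * K * N t - \<delta> * K * N s" .
    qed (use \<eta>1 \<eta>2 c in auto)
    then show ?thesis by (simp add: algebra_simps)
  qed
  have "norm (D c - D a) \<le> 0"
    using small by (intro le_of_le_plus_mult_eps[of _ 0 "K * (N c - N a)"]) simp
  moreover have "(LINT u|lebesgue_on {a..a}. ?I u) = 0"
    using has_bochner_integral_null[of "{a..a}" ?I] by (auto simp: has_bochner_integral_iff)
  ultimately show "h (f c) (g c) - h (f a) (g a) = (LINT u|lebesgue_on {a..c}. ?I u)"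
    by (simp add: D_def diff_eq_eq add.commute)
qed

text \<open>
  The calibration argument: if \<open>F\<close> is a function of the position whose gradient has norm at most \<open>k\<close>,
  then its increment is at most the length of the path in the metric \<open>k |dx|\<close>. Only differences of \<open>F\<close> along
  the path enter, so that \<open>F\<close> may also be a branch of a multivalued function that is followed along the
  path.
\<close>

lemma calibration_bound:
  fixes x :: "real \<Rightarrow> 'b::euclidean_space" and F :: "real \<Rightarrow> 'c::real_normed_vector"
  assumes x: "primitive_on a b x v" and k: "continuous_on {a..b} k" and "a \<le> b"
    and F: "\<And>\<delta>. \<delta> > 0 \<Longrightarrow> \<exists>\<eta>>0. \<forall>s\<in>{a..b}. \<forall>t\<in>{a..b}. s \<le> t \<and> t - s < \<eta> \<longrightarrow>
      norm (F t - F s) \<le> (k s + \<delta>) * norm (x t - x s)"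
    and k0: "\<And>t. t \<in> {a..b} \<Longrightarrow> 0 \<le> k t"
  shows "norm (F b - F a) \<le> (LINT t|lebesgue_on {a..b}. k t * norm (v t))"
proof -
  have intv: "integrable (lebesgue_on {a..b}) (\<lambda>t. norm (v t))"
    using x by (simp add: primitive_on_def)
  have intkv: "integrable (lebesgue_on {a..b}) (\<lambda>t. k t * norm (v t))"
    using integrable_continuous_product[OF bounded_bilinear_mult k intv] .
  let ?V = "LINT t|lebesgue_on {a..b}. norm (v t)"
  have small: "norm (F b - F a) \<le> (LINT t|lebesgue_on {a..b}. k t * norm (v t)) + \<delta> * (2 * ?V)" if d0: "\<delta> > 0" for \<delta>
  proof -
    obtain \<eta>1 where \<eta>1: "0 < \<eta>1" "\<And>s t. s \<in> {a..b} \<Longrightarrow> t \<in> {a..b} \<Longrightarrow> \<bar>t - s\<bar> < \<eta>1 \<Longrightarrow> norm (k t - k s) < \<delta>"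
      using continuous_on_Icc_uniform[OF k d0] by metis
    obtain \<eta>2 where \<eta>2: "0 < \<eta>2" "\<And>s t. s \<in> {a..b} \<Longrightarrow> t \<in> {a..b} \<Longrightarrow> s \<le> t \<Longrightarrow> t - s < \<eta>2 \<Longrightarrow>
        norm (F t - F s) \<le> (k s + \<delta>) * norm (x t - x s)"
      using F[OF d0] by metis
    define H where "H t = (LINT u|lebesgue_on {a..t}. (k u + 2 * \<delta>) * norm (v u))" for t
    have intH: "integrable (lebesgue_on {a..b}) (\<lambda>u. (k u + 2 * \<delta>) * norm (v u))"
      using intkv intv by (simp add: distrib_right)
    note Hprim = primitive_on_indefinite[OF intH]
    have "norm (F b - F a) \<le> H b - H a"
    proof (rule local_increment_bound_imp_global[of "min \<eta>1 \<eta>2"])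
      fix s t assume st: "a \<le> s" "s \<le> t" "t \<le> b" "t - s < min \<eta>1 \<eta>2"
      let ?M = "lebesgue_on {s..t}"
      have "norm (F t - F s) \<le> (k s + \<delta>) * norm (x t - x s)"
        using \<eta>2(2) st by auto
      also have "\<dots> \<le> (k s + \<delta>) * (LINT u|?M. norm (v u))"
        using primitive_on_norm_increment[OF x] st k0[of s] d0 by (intro mult_left_mono) auto
      also have "\<dots> = (LINT u|?M. (k s + \<delta>) * norm (v u))" by simp
      also have "\<dots> \<le> (LINT u|?M. (k u + 2 * \<delta>) * norm (v u))"
      proof (rule integral_mono)
        show "integrable ?M (\<lambda>u. (k s + \<delta>) * norm (v u))"
          using integrable_subinterval[OF intv, of s t] st by simp
        show "integrable ?M (\<lambda>u. (k u + 2 * \<delta>) * norm (v u))"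
          using integrable_subinterval[OF intH, of s t] st by simp
        fix u assume "u \<in> space ?M"
        then have "\<bar>k u - k s\<bar> < \<delta>" using \<eta>1(2)[of s u] st by auto
        then show "(k s + \<delta>) * norm (v u) \<le> (k u + 2 * \<delta>) * norm (v u)"
          by (intro mult_right_mono) auto
      qed
      also have "\<dots> = H t - H s"
        using primitive_on_increment[OF Hprim, of s t] st by (simp add: H_def)
      finally show "norm (F t - F s) \<le> H t - H s" .
    qed (use \<eta>1 \<eta>2 \<open>a \<le> b\<close> in auto)
    also have "H b - H a = (LINT u|lebesgue_on {a..b}. (k u + 2 * \<delta>) * norm (v u))"
      using primitive_on_increment[OF Hprim, of a b] \<open>a \<le> b\<close> by (simp add: H_def)
    also have "\<dots> = (LINT t|lebesgue_on {a..b}. k t * norm (v t)) + \<delta> * (2 * ?V)"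
      using intkv intv by (simp add: distrib_right)
    finally show ?thesis .
  qed
  from le_of_le_plus_mult_eps[OF this] show ?thesis .
qed

text \<open>
  The difference of two derivatives has integral 0 over every half line. Half lines are stable under
  intersection and generate the Borel sets, so that it has integral 0 over every measurable set.
\<close>

lemma primitive_on_unique:
  fixes v w :: "real \<Rightarrow> 'b::euclidean_space"
  assumes v: "primitive_on a b x v" and w: "primitive_on a b x w"
  shows "AE t in lebesgue_on {a..b}. v t = w t"
proof -
  define D where "D t = v t - w t" for t
  have intD: "integrable (lebesgue_on {a..b}) D"
    using v w unfolding D_def by (simp add: primitive_on_def)
  have D0: "(LINT u|lebesgue_on {a..t}. D u) = 0" if "a \<le> t" "t \<le> b" for t
  proof -
    have "integrable (lebesgue_on {a..t}) v" "integrable (lebesgue_on {a..t}) w"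
      using v w that integrable_Icc_mono[of a b v a t] integrable_Icc_mono[of a b w a t]
      by (simp_all add: primitive_on_def)
    then show ?thesis
      using primitive_on_increment[OF v, of a t] primitive_on_increment[OF w, of a t] that
      by (simp add: D_def)
  qed
  define g where "g = (\<lambda>t. indicator {a..b} t *\<^sub>R D t)"
  have intg: "integrable lebesgue g"
    using intD by (simp add: g_def integrable_restrict_space)
  have half: "set_lebesgue_integral lebesgue {..c} g = 0" for c
  proof -
    have "set_lebesgue_integral lebesgue {..c} g = (LINT u|lebesgue. indicator {a..min b c} u *\<^sub>R D u)"
      unfolding set_lebesgue_integral_def g_def by (intro Bochner_Integration.integral_cong) (auto split: split_indicator)
    also have "\<dots> = (LINT u|lebesgue_on {a..min b c}. D u)"
      by (simp add: integral_restrict_space)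
    also have "\<dots> = 0"
    proof (cases "a \<le> min b c")
      case True
      then show ?thesis using D0[of "min b c"] by simp
    qed simp
    finally show ?thesis .
  qed
  have setint: "set_integrable lebesgue A g" if "A \<in> sets lebesgue" for A
    using integrable_mult_indicator[OF that intg] by (simp add: set_integrable_def)
  have total: "integral\<^sup>L lebesgue g = 0"
  proof -
    have "indicator {..b} t *\<^sub>R g t = g t" for t
      by (auto simp: g_def split: split_indicator)
    then show ?thesis using half[of b] by (simp add: set_lebesgue_integral_def)
  qed
  have borel: "set_lebesgue_integral lebesgue A g = 0" if "A \<in> sets borel" for A
  proof -
    have A: "A \<in> sigma_sets UNIV (range (\<lambda>c::real. {..c}))"
      using that by (simp add: borel_eq_atMost)
    have "Int_stable (range (\<lambda>c::real. {..c}))"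
      by (auto simp: Int_stable_def)
    moreover have "range (\<lambda>c::real. {..c}) \<subseteq> Pow UNIV" by simp
    ultimately show ?thesis using A
    proof (induction rule: sigma_sets_induct_disjoint)
      case (basic A) then show ?case using half by auto
    next
      case empty show ?case by (simp add: set_lebesgue_integral_def)
    next
      case (compl A)
      then have A: "A \<in> sets lebesgue"
      proof -
        have "A \<in> sets borel" using compl(1) by (simp add: borel_eq_atMost)
        then show ?thesis using sets_completionI_sets[of A lborel] by simp
      qed
      have "set_lebesgue_integral lebesgue (UNIV - A) g = integral\<^sup>L lebesgue g - set_lebesgue_integral lebesgue A g"
      proof -
        have "(LINT t|lebesgue. indicator (UNIV - A) t *\<^sub>R g t) = (LINT t|lebesgue. g t - indicator A t *\<^sub>R g t)"
          by (intro Bochner_Integration.integral_cong) (auto split: split_indicator)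
        then show ?thesis
          using intg setint[OF A] by (simp add: set_lebesgue_integral_def set_integrable_def)
      qed
      then show ?case using compl total by simp
    next
      case (union A)
      have A: "A i \<in> sets lebesgue" for i
      proof -
        have "A i \<in> sets borel" using union(2) by (auto simp: borel_eq_atMost)
        then show ?thesis using sets_completionI_sets[of "A i" lborel] by simp
      qed
      then have "(\<Union>i. A i) \<in> sets lebesgue" by blast
      then have "set_lebesgue_integral lebesgue (\<Union>i. A i) g = (\<Sum>i. set_lebesgue_integral lebesgue (A i) g)"
        using A union setint by (intro lebesgue_integral_countable_add) (auto simp: disjoint_family_on_def)
      then show ?case using union by simp
    qed
  qed
  have lebesgue: "set_lebesgue_integral lebesgue A g = 0" if leb: "A \<in> sets lebesgue" for A
  proof -
    obtain S N N' where A: "A = S \<union> N" "N \<subseteq> N'" "N' \<in> null_sets lborel" "S \<in> sets lborel"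
      using sets_completionE[OF leb] by blast
    then have N: "N \<in> null_sets lebesgue"
      using null_sets_completion_subset null_sets_completionI by blast
    have "set_lebesgue_integral lebesgue A g = set_lebesgue_integral lebesgue S g"
      unfolding set_lebesgue_integral_def
    proof (rule integral_cong_AE)
      show "AE t in lebesgue. indicator A t *\<^sub>R g t = indicator S t *\<^sub>R g t"
        using AE_not_in[OF N] by eventually_elim (auto simp: A(1) split: split_indicator)
      show "(\<lambda>t. indicator A t *\<^sub>R g t) \<in> borel_measurable lebesgue"
        using setint[OF leb] by (auto simp: set_integrable_def)
      show "(\<lambda>t. indicator S t *\<^sub>R g t) \<in> borel_measurable lebesgue"
        using setint[of S] A(4) by (auto simp: set_integrable_def)
    qed
    then show ?thesis using borel A(4) by simp
  qed
  interpret finite_measure "lebesgue_on {a..b}"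
    by (rule finite_measure_lebesgue_on) simp
  have "AE t in lebesgue_on {a..b}. D t = 0"
  proof (rule density_zero[OF intD])
    fix A assume "A \<in> sets (lebesgue_on {a..b})"
    then have A: "A \<in> sets lebesgue" "A \<subseteq> {a..b}"
      by (auto simp: sets_restrict_space)
    have "set_lebesgue_integral (lebesgue_on {a..b}) A D = set_lebesgue_integral lebesgue A g"
      unfolding set_lebesgue_integral_def g_def
      by (subst integral_restrict_space) (auto intro!: Bochner_Integration.integral_cong split: split_indicator)
    then show "set_lebesgue_integral (lebesgue_on {a..b}) A D = 0"
      using lebesgue A by simp
  qed
  then show ?thesis by (auto simp: D_def)
qed

section \<open>Lower bounds for the action by lengths\<close>

lemma has_H1_derivative_iff:
  "has_H1_derivative T x v \<longleftrightarrow> sq_integrable (lebesgue_on {-T..T}) v \<and> primitive_on (-T) T x v"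
proof
  assume H: "has_H1_derivative T x v"
  then have sq: "sq_integrable (lebesgue_on {-T..T}) v"
    by (simp add: has_H1_derivative_def sq_integrable_def)
  have "integrable (lebesgue_on {-T..T}) v"
  proof (rule Bochner_Integration.integrable_bound)
    show "integrable (lebesgue_on {-T..T}) (\<lambda>t. 1 + (norm (v t))\<^sup>2)"
      using sq by (simp add: sq_integrable_def finite_measure.integrable_const finite_measure_lebesgue_on)
    have "norm (v t) \<le> 1 + (norm (v t))\<^sup>2" for t
    proof -
      have "2 * norm (v t) \<le> 1 + (norm (v t))\<^sup>2"
        using sum_squares_bound[of 1 "norm (v t)"] by simp
      then show ?thesis using norm_ge_zero[of "v t"] by linarith
    qed
    then show "AE t in lebesgue_on {-T..T}. norm (v t) \<le> norm (1 + (norm (v t))\<^sup>2)"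
      by simp
  qed (use sq in \<open>simp add: sq_integrable_def\<close>)
  then show "sq_integrable (lebesgue_on {-T..T}) v \<and> primitive_on (-T) T x v"
    using H sq unfolding has_H1_derivative_def primitive_on_def by (metis add_diff_cancel_left')
next
  assume "sq_integrable (lebesgue_on {-T..T}) v \<and> primitive_on (-T) T x v"
  then show "has_H1_derivative T x v"
    unfolding has_H1_derivative_def primitive_on_def sq_integrable_def
    by (metis add_diff_cancel_left' diff_add_cancel add.commute)
qed

lemma has_H1_derivative_H1_deriv: "x \<in> H1 T \<Longrightarrow> has_H1_derivative T x (H1_deriv T x)"
  using someI_ex[of "has_H1_derivative T x"] by (simp add: H1_def H1_deriv_def)

lemma H1I: "has_H1_derivative T x v \<Longrightarrow> x \<in> H1 T"
  by (auto simp: H1_def)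

lemma H1_deriv_AE:
  assumes "has_H1_derivative T x v"
  shows "AE t in lebesgue_on {-T..T}. H1_deriv T x t = v t"
  using assms has_H1_derivative_H1_deriv[OF H1I[OF assms]] primitive_on_unique
  by (auto simp: has_H1_derivative_iff)

lemma H1_continuous: "has_H1_derivative T x v \<Longrightarrow> continuous_on {-T..T} x"
  by (auto simp: has_H1_derivative_iff intro: primitive_on_continuous)

lemma action_eq:
  assumes "has_H1_derivative T x v"
  shows "action \<alpha> m T x = (\<integral>\<^sup>+t. Lbar \<alpha> m (x t) (v t) \<partial>lebesgue_on {-T..T})"
  unfolding action_def using H1_deriv_AE[OF assms] by (intro nn_integral_cong_AE) auto

lemma H1_inner_eq:
  assumes "has_H1_derivative T x v" "has_H1_derivative T y w"
  shows "H1_inner T x y = (LINT t|lebesgue_on {-T..T}. x t \<bullet> y t + v t \<bullet> w t)"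
proof -
  have [measurable]: "x \<in> borel_measurable (lebesgue_on {-T..T})" "y \<in> borel_measurable (lebesgue_on {-T..T})"
    using assms[THEN H1_continuous] by (auto intro: continuous_imp_measurable_on_sets_lebesgue)
  have M: "H1_deriv T z \<in> borel_measurable (lebesgue_on {-T..T})" if "has_H1_derivative T z u" for z u
    using has_H1_derivative_H1_deriv[OF H1I[OF that]] by (simp add: has_H1_derivative_def)
  have [measurable]: "v \<in> borel_measurable (lebesgue_on {-T..T})" "w \<in> borel_measurable (lebesgue_on {-T..T})"
    using assms by (auto simp: has_H1_derivative_def)
  note [measurable] = M[OF assms(1)] M[OF assms(2)]
  show ?thesis
    unfolding H1_inner_def
  proof (rule integral_cong_AE)
    show "AE t in lebesgue_on {-T..T}. x t \<bullet> y t + H1_deriv T x t \<bullet> H1_deriv T y t = x t \<bullet> y t + v t \<bullet> w t"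
      using H1_deriv_AE[OF assms(1)] H1_deriv_AE[OF assms(2)] by eventually_elim simp
  qed (use assms in measurable)
qed

text \<open>
  Since \<open>k |v| \<le> |v|\<^sup>2 / 2 + k\<^sup>2 / 2\<close>, the action dominates the length in every metric \<open>k |dx|\<close> that lies
  below the Jacobi metric of energy zero, \<open>k = \<surd>(2 V)\<close>.
\<close>

lemma action_ge_weighted_length:
  assumes x: "has_H1_derivative T x v" and k: "continuous_on {-T..T} k"
    and k0: "\<And>t. t \<in> {-T..T} \<Longrightarrow> 0 \<le> k t"
    and kV: "\<And>t. t \<in> {-T..T} \<Longrightarrow> x t \<noteq> 0 \<Longrightarrow> (k t)\<^sup>2 \<le> 2 * (m / (\<alpha> * norm (x t) powr \<alpha>))"
  shows "ennreal (LINT t|lebesgue_on {-T..T}. k t * norm (v t)) \<le> action \<alpha> m T x"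
proof -
  have "integrable (lebesgue_on {-T..T}) (\<lambda>t. norm (v t))"
    using x by (simp add: has_H1_derivative_iff primitive_on_def)
  then have "integrable (lebesgue_on {-T..T}) (\<lambda>t. k t * norm (v t))"
    by (rule integrable_continuous_product[OF bounded_bilinear_mult k])
  then have "ennreal (LINT t|lebesgue_on {-T..T}. k t * norm (v t)) = (\<integral>\<^sup>+t. ennreal (k t * norm (v t)) \<partial>lebesgue_on {-T..T})"
    using k0 by (intro nn_integral_eq_integral[symmetric]) auto
  also have "\<dots> \<le> (\<integral>\<^sup>+t. Lbar \<alpha> m (x t) (v t) \<partial>lebesgue_on {-T..T})"
  proof (rule nn_integral_mono)
    fix t assume "t \<in> space (lebesgue_on {-T..T})"
    then have t: "t \<in> {-T..T}" by simp
    show "ennreal (k t * norm (v t)) \<le> Lbar \<alpha> m (x t) (v t)"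
    proof (cases "x t = 0")
      case False
      have "k t * norm (v t) \<le> ((norm (v t))\<^sup>2 + (k t)\<^sup>2) / 2"
        using sum_squares_bound[of "k t" "norm (v t)"] by simp
      also have "\<dots> \<le> (norm (v t))\<^sup>2 / 2 + m / (\<alpha> * norm (x t) powr \<alpha>)"
      proof -
        have "(a + b) / 2 \<le> a / 2 + c" if "b \<le> 2 * c" for a b c :: real using that by simp
        then show ?thesis using kV[OF t False] by blast
      qed
      finally have "ennreal (k t * norm (v t)) \<le> ennreal ((norm (v t))\<^sup>2 / 2 + m / (\<alpha> * norm (x t) powr \<alpha>))"
        by (rule ennreal_leI)
      moreover have "0 \<le> m / (\<alpha> * norm (x t) powr \<alpha>)"
        using kV[OF t False] zero_le_power2[of "k t"] by linarith
      ultimately show ?thesis using False by (simp add: Lbar_def Vbar_def)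
    qed (simp add: Lbar_def Vbar_def)
  qed
  also have "\<dots> = action \<alpha> m T x" using action_eq[OF x] by simp
  finally show ?thesis .
qed

text \<open>
  The integral of \<open>\<surd>(2 V)\<close> over the radii from 0 to \<open>r\<close>, that is, the distance from the origin to the
  circle of radius \<open>r\<close> in the Jacobi metric of energy zero.
\<close>

definition radial_cost :: "real \<Rightarrow> real \<Rightarrow> real \<Rightarrow> real" where
  "radial_cost \<alpha> m r = sqrt (2 * m / \<alpha>) / (1 - \<alpha> / 2) * r powr (1 - \<alpha> / 2)"

lemma radial_cost_mono:
  assumes "m > 0" "0 < \<alpha>" "\<alpha> < 2" "0 \<le> r" "r \<le> s"
  shows "radial_cost \<alpha> m r \<le> radial_cost \<alpha> m s"
  unfolding radial_cost_def using assms by (intro mult_left_mono powr_mono2) auto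

lemma radial_cost_lipschitz:
  assumes "m > 0" "0 < \<alpha>" "\<alpha> < 2" "0 < p" "0 < q"
  shows "\<bar>radial_cost \<alpha> m p - radial_cost \<alpha> m q\<bar> \<le> sqrt (2 * m / \<alpha>) * min p q powr (- \<alpha> / 2) * \<bar>p - q\<bar>"
proof -
  have *: "\<bar>radial_cost \<alpha> m p - radial_cost \<alpha> m q\<bar> \<le> sqrt (2 * m / \<alpha>) * q powr (- \<alpha> / 2) * \<bar>p - q\<bar>"
    if pq: "0 < q" "q < p" for p q
  proof -
    have der: "(radial_cost \<alpha> m has_real_derivative sqrt (2 * m / \<alpha>) * r powr (- \<alpha> / 2)) (at r)" if "r > 0" for r
    proof -
      have "(radial_cost \<alpha> m has_real_derivative
          sqrt (2 * m / \<alpha>) / (1 - \<alpha> / 2) * ((1 - \<alpha> / 2) * r powr (1 - \<alpha> / 2 - 1))) (at r)"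
        unfolding radial_cost_def[abs_def] using that by (intro DERIV_cmult has_real_derivative_powr)
      then show ?thesis using assms by simp
    qed
    obtain z where z: "q < z" "z < p"
      "radial_cost \<alpha> m p - radial_cost \<alpha> m q = (p - q) * (sqrt (2 * m / \<alpha>) * z powr (- \<alpha> / 2))"
      using MVT2[of q p "radial_cost \<alpha> m" "\<lambda>r. sqrt (2 * m / \<alpha>) * r powr (- \<alpha> / 2)"] pq der by auto
    have "z powr (- \<alpha> / 2) \<le> q powr (- \<alpha> / 2)"
      using z that assms by (intro powr_mono2') auto
    then have "(p - q) * (sqrt (2 * m / \<alpha>) * z powr (- \<alpha> / 2)) \<le> (p - q) * (sqrt (2 * m / \<alpha>) * q powr (- \<alpha> / 2))"
      using that assms by (intro mult_left_mono) auto
    moreover have "0 \<le> (p - q) * (sqrt (2 * m / \<alpha>) * z powr (- \<alpha> / 2))"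
      using that assms by auto
    ultimately show ?thesis using z that by (simp add: mult_ac)
  qed
  consider "p = q" | "q < p" | "p < q" by linarith
  then show ?thesis
  proof cases
    case 2 then show ?thesis using *[of q p] assms by (simp add: min_def)
  next
    case 3 then show ?thesis using *[of p q] assms by (simp add: min_def abs_minus_commute)
  qed simp
qed

text \<open>
  The path goes from one end point to the circle of radius \<open>e\<close> and from there to the other end point. The
  calibration is the radial distance; truncated at radius \<open>e\<close> it is Lipschitz, also along paths through the
  origin, where \<open>\<surd>(2 V)\<close> is infinite.
\<close>

lemma action_ge_near_collision:
  assumes "m > 0" "0 < \<alpha>" "\<alpha> < 2" and x: "has_H1_derivative T x v"
    and s: "s \<in> {-T..T}" and e: "norm (x s) \<le> e" "0 < e"
  shows "ennreal (radial_cost \<alpha> m (norm (x (-T))) + radial_cost \<alpha> m (norm (x T)) - 2 * radial_cost \<alpha> m e)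
    \<le> action \<alpha> m T x"
proof -
  define r where "r t = max e (norm (x t))" for t
  define k where "k t = sqrt (2 * m / \<alpha>) * r t powr (- \<alpha> / 2)" for t
  define F where "F t = radial_cost \<alpha> m (r t)" for t
  note prim = x[unfolded has_H1_derivative_iff, THEN conjunct2]
  note cx = H1_continuous[OF x]
  have r_ge: "r t \<ge> e" "r t \<ge> norm (x t)" for t by (auto simp: r_def)
  have r_pos: "r t > 0" for t using r_ge(1)[of t] e by linarith
  have cr: "continuous_on {-T..T} r" unfolding r_def by (intro continuous_intros cx)
  have ck: "continuous_on {-T..T} k" unfolding k_def
    using r_pos by (intro continuous_intros cr) (auto simp: less_imp_neq[THEN not_sym])
  have k0: "0 \<le> k t" for t using assms by (simp add: k_def)
  have cal: "norm (F b - F a) \<le> (LINT t|lebesgue_on {a..b}. k t * norm (v t))"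
    if ab: "-T \<le> a" "a \<le> b" "b \<le> T" for a b
  proof (rule calibration_bound)
    show "primitive_on a b x v" using primitive_on_subinterval[OF prim] ab by simp
    show ckab: "continuous_on {a..b} k" using ck ab by (auto intro: continuous_on_subset)
    fix \<delta> :: real assume "\<delta> > 0"
    obtain \<eta> where \<eta>: "0 < \<eta>"
      "\<And>s t. s \<in> {a..b} \<Longrightarrow> t \<in> {a..b} \<Longrightarrow> \<bar>t - s\<bar> < \<eta> \<Longrightarrow> norm (k t - k s) < \<delta>"
      using continuous_on_Icc_uniform[OF ckab \<open>\<delta> > 0\<close>] by metis
    have "norm (F t - F s) \<le> (k s + \<delta>) * norm (x t - x s)" if "s \<in> {a..b}" "t \<in> {a..b}" "s \<le> t" "t - s < \<eta>" for s t
    proof -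
      have kt: "k t \<le> k s + \<delta>" using \<eta>(2)[of s t] that by auto
      have "norm (F t - F s) \<le> sqrt (2 * m / \<alpha>) * min (r t) (r s) powr (- \<alpha> / 2) * \<bar>r t - r s\<bar>"
        unfolding F_def real_norm_def using assms r_pos by (intro radial_cost_lipschitz) auto
      also have "\<dots> \<le> (k s + \<delta>) * norm (x t - x s)"
      proof (rule mult_mono)
        show "sqrt (2 * m / \<alpha>) * min (r t) (r s) powr (- \<alpha> / 2) \<le> k s + \<delta>"
          using kt \<open>\<delta> > 0\<close> by (auto simp: k_def min_def)
        show "\<bar>r t - r s\<bar> \<le> norm (x t - x s)"
          using norm_triangle_ineq3[of "x t" "x s"] by (auto simp: r_def max_def)
        show "0 \<le> k s + \<delta>" using k0[of s] \<open>\<delta> > 0\<close> by simp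
      qed simp
      finally show ?thesis .
    qed
    then show "\<exists>\<eta>>0. \<forall>s\<in>{a..b}. \<forall>t\<in>{a..b}. s \<le> t \<and> t - s < \<eta> \<longrightarrow>
      norm (F t - F s) \<le> (k s + \<delta>) * norm (x t - x s)"
      using \<eta>(1) by blast
  qed (use k0 ab in auto)
  have int: "integrable (lebesgue_on {-T..T}) (\<lambda>t. k t * norm (v t))"
    using integrable_continuous_product[OF bounded_bilinear_mult ck] prim by (simp add: primitive_on_def)
  have Fs: "F s = radial_cost \<alpha> m e" using e by (simp add: F_def r_def max_def)
  have "radial_cost \<alpha> m (norm (x (-T))) + radial_cost \<alpha> m (norm (x T)) - 2 * radial_cost \<alpha> m e \<le> (F (-T) - F s) + (F T - F s)"
    using radial_cost_mono[of m \<alpha> "norm (x (-T))" "r (-T)"] radial_cost_mono[of m \<alpha> "norm (x T)" "r T"] r_ge assms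
    by (simp add: Fs) (simp add: F_def)
  also have "\<dots> \<le> norm (F s - F (-T)) + norm (F T - F s)" by simp
  also have "\<dots> \<le> (LINT t|lebesgue_on {-T..s}. k t * norm (v t)) + (LINT t|lebesgue_on {s..T}. k t * norm (v t))"
    using s by (intro add_mono cal) auto
  also have "\<dots> = (LINT t|lebesgue_on {-T..T}. k t * norm (v t))"
    using integral_combine[OF int, of s] s by simp
  finally have "ennreal (radial_cost \<alpha> m (norm (x (-T))) + radial_cost \<alpha> m (norm (x T)) - 2 * radial_cost \<alpha> m e)
      \<le> ennreal (LINT t|lebesgue_on {-T..T}. k t * norm (v t))"
    by (rule ennreal_leI)
  also have "\<dots> \<le> action \<alpha> m T x"
  proof (rule action_ge_weighted_length[OF x ck k0])
    fix t assume "t \<in> {-T..T}" "x t \<noteq> 0"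
    have "(k t)\<^sup>2 = 2 * m / \<alpha> * r t powr (- \<alpha>)"
      using assms by (simp add: k_def power_mult_distrib) (simp add: power2_eq_square flip: powr_add)
    also have "\<dots> \<le> 2 * m / \<alpha> * norm (x t) powr (- \<alpha>)"
      using assms \<open>x t \<noteq> 0\<close> r_ge by (intro mult_left_mono powr_mono2') auto
    finally show "(k t)\<^sup>2 \<le> 2 * (m / (\<alpha> * norm (x t) powr \<alpha>))"
      by (simp add: powr_minus field_simps)
  qed
  finally show ?thesis .
qed

lemma radial_cost_tendsto_0:
  assumes "m > 0" "0 < \<alpha>" "\<alpha> < 2"
  shows "((\<lambda>e. radial_cost \<alpha> m e) \<longlongrightarrow> 0) (at_right 0)"
proof -
  have "((\<lambda>e. sqrt (2 * m / \<alpha>) / (1 - \<alpha> / 2) * e powr (1 - \<alpha> / 2)) \<longlongrightarrow>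
      sqrt (2 * m / \<alpha>) / (1 - \<alpha> / 2) * 0 powr (1 - \<alpha> / 2)) (at_right 0)"
    using assms by (intro tendsto_intros tendsto_powr') (auto simp: eventually_at_filter)
  then show ?thesis by (simp add: radial_cost_def[abs_def])
qed

lemma action_ge_collision:
  assumes "m > 0" "0 < \<alpha>" "\<alpha> < 2" and x: "has_H1_derivative T x v"
    and s: "s \<in> {-T..T}" "x s = 0"
  shows "ennreal (radial_cost \<alpha> m (norm (x (-T))) + radial_cost \<alpha> m (norm (x T))) \<le> action \<alpha> m T x"
proof (rule tendsto_upperbound)
  let ?a = "radial_cost \<alpha> m (norm (x (-T))) + radial_cost \<alpha> m (norm (x T))"
  have "((\<lambda>e. ?a - 2 * radial_cost \<alpha> m e) \<longlongrightarrow> ?a - 2 * 0) (at_right 0)"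
    by (intro tendsto_intros radial_cost_tendsto_0 assms)
  then show "((\<lambda>e. ennreal (?a - 2 * radial_cost \<alpha> m e)) \<longlongrightarrow> ennreal ?a) (at_right 0)"
    by (intro tendsto_ennrealI) simp
  show "\<forall>\<^sub>F e in at_right 0. ennreal (?a - 2 * radial_cost \<alpha> m e) \<le> action \<alpha> m T x"
    using action_ge_near_collision[OF assms(1-5)] s(2)
    by (intro eventually_mono[OF eventually_at_right_less[of "0::real"]]) simp
qed simp

text \<open>
  For \<open>\<alpha> = 1\<close> a square root \<open>f\<close> of \<open>x\<close> flattens the Jacobi metric: \<open>\<surd>(2 V) |dx| = 2 \<surd>(2 m) |df|\<close>. A full turn of
  \<open>x\<close> is a half turn of \<open>f\<close>, so that the ends of the path \<open>f\<close> are opposite points. The chord between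
  them passes through the origin, and its length is twice the radial distance.
\<close>

lemma action_ge_full_turn:
  assumes "m > 0" "T > 0" and x: "has_H1_derivative T x v"
    and nz: "\<And>t. t \<in> {-T..T} \<Longrightarrow> x t \<noteq> 0"
    and \<theta>: "continuous_on {-T..T} \<theta>" "\<And>t. t \<in> {-T..T} \<Longrightarrow> x t = of_real (norm (x t)) * cis (\<theta> t)"
    and turn: "\<bar>\<theta> T - \<theta> (-T)\<bar> = 2 * pi" and R: "norm (x (-T)) = R" "norm (x T) = R"
  shows "ennreal (2 * radial_cost 1 m R) \<le> action 1 m T x"
proof -
  define f where "f t = of_real (sqrt (norm (x t))) * cis (\<theta> t / 2)" for t
  define k where "k t = sqrt (2 * m) / norm (f t)" for t
  note prim = x[unfolded has_H1_derivative_iff, THEN conjunct2]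
  note cx = H1_continuous[OF x]
  have norm_f: "norm (f t) = sqrt (norm (x t))" for t by (simp add: f_def norm_mult)
  have cf: "continuous_on {-T..T} f"
    unfolding f_def by (intro continuous_intros cx \<theta>(1)) auto
  have f_sq: "f t * f t = x t" if "t \<in> {-T..T}" for t
  proof -
    have "f t * f t = of_real ((sqrt (norm (x t)))\<^sup>2) * (cis (\<theta> t / 2) * cis (\<theta> t / 2))"
      by (simp add: f_def power2_eq_square del: real_sqrt_pow2 real_sqrt_mult_self)
    also have "\<dots> = of_real (norm (x t)) * cis (\<theta> t)"
      by (simp add: cis_mult)
    finally show ?thesis using \<theta>(2)[OF that] by simp
  qed
  have f_nz: "f t \<noteq> 0" if "t \<in> {-T..T}" for t using f_sq[OF that] nz[OF that] by auto
  have "\<exists>t0\<in>{-T..T}. \<forall>t\<in>{-T..T}. norm (f t0) \<le> norm (f t)"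
    using \<open>T > 0\<close> by (intro continuous_attains_inf continuous_intros cf) auto
  then obtain c where c: "c > 0" "\<And>t. t \<in> {-T..T} \<Longrightarrow> c \<le> norm (f t)"
    using f_nz by (metis zero_less_norm_iff)
  have scale: "norm (c *\<^sub>R y - c *\<^sub>R z) = c * norm (y - z)" if "0 \<le> c" for c and y z :: complex
    using that norm_scaleR[of c "y - z"] by (simp only: scaleR_right_diff_distrib abs_of_nonneg)
  have ck: "continuous_on {-T..T} k" unfolding k_def using f_nz by (intro continuous_intros cf) auto
  have "norm ((2 * sqrt (2 * m)) *\<^sub>R f T - (2 * sqrt (2 * m)) *\<^sub>R f (-T)) \<le> (LINT t|lebesgue_on {-T..T}. k t * norm (v t))"
  proof (rule calibration_bound[OF prim ck])
    fix \<delta> :: real assume "\<delta> > 0"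
    define d where "d = min c (\<delta> * c\<^sup>2 / sqrt (2 * m))"
    have "d > 0" using c \<open>\<delta> > 0\<close> \<open>m > 0\<close> by (simp add: d_def)
    obtain \<eta> where \<eta>: "0 < \<eta>"
      "\<And>s t. s \<in> {-T..T} \<Longrightarrow> t \<in> {-T..T} \<Longrightarrow> \<bar>t - s\<bar> < \<eta> \<Longrightarrow> norm (f t - f s) < d"
      using continuous_on_Icc_uniform[OF cf \<open>d > 0\<close>] by metis
    have "norm ((2 * sqrt (2 * m)) *\<^sub>R f t - (2 * sqrt (2 * m)) *\<^sub>R f s) \<le> (k s + \<delta>) * norm (x t - x s)"
      if st: "s \<in> {-T..T}" "t \<in> {-T..T}" "s \<le> t" "t - s < \<eta>" for s t
    proof -
      define n where "n = norm (f s)"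
      have n: "n \<ge> c" "n > 0" using c(1) c(2)[OF st(1)] by (auto simp: n_def)
      have "norm (f t - f s) < d" using \<eta>(2)[of s t] st by auto
      moreover have "2 * n \<le> norm (f t + f s) + norm (f t - f s)"
        using norm_triangle_ineq4[of "f t + f s" "f t - f s"] by (simp add: n_def norm_mult flip: mult_2)
      ultimately have sum: "2 * n - d \<le> norm (f t + f s)" by simp
      have dn: "d \<le> n" "d \<le> c" using n by (auto simp: d_def)
      \<comment> \<open>By the choice of \<open>d\<close>, replacing the factor \<open>f t + f s\<close> of \<open>x t - x s\<close> by \<open>2 * f s\<close> costs
        no more than the term with \<open>\<delta>\<close>.\<close>
      have key: "2 * sqrt (2 * m) \<le> (k s + \<delta>) * (2 * n - d)"
      proof -
        have "d * sqrt (2 * m) \<le> \<delta> * c\<^sup>2"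
          using \<open>m > 0\<close> unfolding d_def by (auto simp: field_simps min_def)
        also have "\<dots> \<le> \<delta> * (n * (2 * n - d))"
          using n dn c \<open>\<delta> > 0\<close> unfolding power2_eq_square by (intro mult_left_mono mult_mono) auto
        finally have "d * sqrt (2 * m) \<le> n * (\<delta> * (2 * n - d))" by (simp add: mult_ac)
        then have "d * sqrt (2 * m) / n \<le> \<delta> * (2 * n - d)"
          using n by (simp add: divide_le_eq mult.commute)
        moreover have "k s * (2 * n - d) = 2 * sqrt (2 * m) - d * sqrt (2 * m) / n"
          using n by (simp add: k_def field_simps flip: n_def)
        ultimately show ?thesis by (simp add: distrib_right)
      qed
      have "norm ((2 * sqrt (2 * m)) *\<^sub>R f t - (2 * sqrt (2 * m)) *\<^sub>R f s) = 2 * sqrt (2 * m) * norm (f t - f s)"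
        using \<open>m > 0\<close> by (intro scale) simp
      also have "\<dots> \<le> (k s + \<delta>) * (2 * n - d) * norm (f t - f s)"
        using key by (rule mult_right_mono) simp
      also have "\<dots> \<le> (k s + \<delta>) * norm (f t + f s) * norm (f t - f s)"
        using sum \<open>\<delta> > 0\<close> \<open>m > 0\<close> by (intro mult_right_mono mult_left_mono) (auto simp: k_def intro!: add_nonneg_nonneg)
      also have "norm (f t + f s) * norm (f t - f s) = norm (x t - x s)"
        using f_sq st by (simp flip: norm_mult f_sq add: algebra_simps)
      then have "(k s + \<delta>) * norm (f t + f s) * norm (f t - f s) = (k s + \<delta>) * norm (x t - x s)"
        by (simp add: mult.assoc)
      finally show ?thesis .
    qed
    then show "\<exists>\<eta>>0. \<forall>s\<in>{-T..T}. \<forall>t\<in>{-T..T}. s \<le> t \<and> t - s < \<eta> \<longrightarrow>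
      norm ((2 * sqrt (2 * m)) *\<^sub>R f t - (2 * sqrt (2 * m)) *\<^sub>R f s) \<le> (k s + \<delta>) * norm (x t - x s)"
      using \<eta>(1) by blast
  qed (use \<open>m > 0\<close> \<open>T > 0\<close> in \<open>auto simp: k_def\<close>)
  moreover have "norm ((2 * sqrt (2 * m)) *\<^sub>R f T - (2 * sqrt (2 * m)) *\<^sub>R f (-T)) = 2 * radial_cost 1 m R"
  proof -
    have "\<theta> T / 2 = \<theta> (-T) / 2 + pi \<or> \<theta> T / 2 = \<theta> (-T) / 2 - pi"
      using turn by (auto simp: abs_if split: if_splits)
    moreover have "cis (a + pi) = - cis a" "cis (a - pi) = - cis a" for a
      by (simp_all add: complex_eq_iff)
    ultimately have "cis (\<theta> T / 2) = - cis (\<theta> (-T) / 2)" by metis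
    then have "f (-T) = - f T" using R by (simp add: f_def)
    then have "norm (f T - f (-T)) = norm (2 * f T)" by (simp only: minus_minus diff_minus_eq_add mult_2)
    then have "norm (f T - f (-T)) = 2 * norm (f T)" by (simp add: norm_mult)
    then have "norm ((2 * sqrt (2 * m)) *\<^sub>R f T - (2 * sqrt (2 * m)) *\<^sub>R f (-T)) = 4 * sqrt (2 * m) * norm (f T)"
      using \<open>m > 0\<close> by (subst scale) auto
    then show ?thesis
      using R norm_ge_zero[of "x T"] by (simp add: norm_f radial_cost_def powr_half_sqrt)
  qed
  ultimately have "ennreal (2 * radial_cost 1 m R) \<le> ennreal (LINT t|lebesgue_on {-T..T}. k t * norm (v t))"
    by (simp add: ennreal_leI)
  also have "\<dots> \<le> action 1 m T x"
  proof (rule action_ge_weighted_length[OF x ck])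
    fix t assume t: "t \<in> {-T..T}" "x t \<noteq> 0"
    show "(k t)\<^sup>2 \<le> 2 * (m / (1 * norm (x t) powr 1))"
      using t \<open>m > 0\<close> by (simp add: k_def norm_f power_divide)
  qed (use \<open>m > 0\<close> in \<open>auto simp: k_def\<close>)
  finally show ?thesis .
qed

section \<open>Weak limits of paths without collision\<close>

text \<open>
  The uniform boundedness principle in \<open>L\<^sup>2\<close>, by a gliding hump. If the norms were unbounded, some
  members \<open>V k\<close> would have norms above \<open>5^k\<close>. Their normalized versions with weights \<open>(1/4)^k\<close>, added up with
  signs that exclude cancellation against the previous terms, form a series whose sum has a scalar product
  of size at least \<open>2/3 * (5/4)^k\<close> with \<open>V k\<close>.
\<close>

lemma L2_weakly_bounded_imp_bounded:
  fixes v :: "nat \<Rightarrow> 'a \<Rightarrow> 'b::euclidean_space"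
  assumes v: "\<And>n. sq_integrable M (v n)"
    and weak: "\<And>w. sq_integrable M w \<Longrightarrow> \<exists>B. \<forall>n. \<bar>LINT t|M. v n t \<bullet> w t\<bar> \<le> B"
  shows "\<exists>C. \<forall>n. L2_norm M (v n) \<le> C"
proof (rule ccontr)
  assume "\<nexists>C. \<forall>n. L2_norm M (v n) \<le> C"
  then have "\<exists>n. 5 ^ k < L2_norm M (v n)" for k :: nat
    by (meson not_le)
  then obtain n where n: "\<And>k. 5 ^ k < L2_norm M (v (n k))" by metis
  define V where "V k = v (n k)" for k
  define N where "N k = L2_norm M (V k)" for k
  have N: "5 ^ k < N k" "0 < N k" for k
    using n[of k] by (auto simp: N_def V_def intro: less_trans[of _ "5 ^ k"])
  have V: "sq_integrable M (V k)" for k using v by (simp add: V_def)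
  define sg :: "real \<Rightarrow> real" where "sg x = (if 0 \<le> x then 1 else -1)" for x
  define step where "step k w = (sg (LINT t|M. V k t \<bullet> w t) * ((1/4) ^ k / N k))" for k and w :: "'a \<Rightarrow> 'b"
  define w where "w = rec_nat (\<lambda>t. 0) (\<lambda>k w t. w t + step k w *\<^sub>R V k t)"
  have w0: "w 0 = (\<lambda>t. 0)" and wS: "w (Suc k) = (\<lambda>t. w k t + step k (w k) *\<^sub>R V k t)" for k
    by (simp_all add: w_def)
  define u where "u k t = step k (w k) *\<^sub>R V k t" for k t
  have w_sum: "w k = (\<lambda>t. \<Sum>j<k. u j t)" for k
    by (induction k) (simp_all add: w0 wS u_def)
  have u: "sq_integrable M (u k)" for k
    unfolding u_def by (rule sq_integrable_scaleR[OF V])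
  have w: "sq_integrable M (w k)" for k
    unfolding w_sum by (rule sq_integrable_sum[OF u])
  have u_norm: "L2_norm M (u k) = (1/4) ^ k" for k
    using N(2)[of k] unfolding u_def by (simp add: L2_norm_scaleR step_def sg_def abs_mult N_def[symmetric])
  have "\<exists>W. sq_integrable M W \<and> (\<forall>k. L2_norm M (\<lambda>t. W t - (\<Sum>j<k. u j t)) \<le> 1 * (4/3) * (1/4) ^ k)"
    by (rule L2_series[of M u 1, OF u]) (auto simp: u_norm)
  then obtain W where W: "sq_integrable M W" "\<And>k. L2_norm M (\<lambda>t. W t - (\<Sum>j<k. u j t)) \<le> 1 * (4/3) * (1/4) ^ k"
    by blast
  obtain B where B: "\<And>n. \<bar>LINT t|M. v n t \<bullet> W t\<bar> \<le> B"
    using weak[OF W(1)] by blast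
  have big: "2/3 * (5/4) ^ k \<le> B" for k
  proof -
    let ?I = "\<lambda>f. LINT t|M. V k t \<bullet> f t"
    have "?I (w (Suc k)) = ?I (w k) + step k (w k) * (N k)\<^sup>2"
      using integrable_inner_prod[OF V w] integrable_inner_prod[OF V V]
      by (simp add: wS inner_add_right N_def L2_norm_square power2_norm_eq_inner)
    also have "step k (w k) * (N k)\<^sup>2 = sg (?I (w k)) * ((1/4) ^ k * N k)"
      using N(2)[of k] by (simp add: step_def power2_eq_square)
    finally have "?I (w (Suc k)) = ?I (w k) + sg (?I (w k)) * ((1/4) ^ k * N k)" .
    moreover have "\<bar>x + sg x * c\<bar> = \<bar>x\<bar> + c" if "0 < c" for x c
      using that by (simp add: sg_def)
    ultimately have "\<bar>?I (w (Suc k))\<bar> = \<bar>?I (w k)\<bar> + (1/4) ^ k * N k"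
      using N(2)[of k] by simp
    then have 1: "(1/4) ^ k * N k \<le> \<bar>?I (w (Suc k))\<bar>" by simp
    have "?I (\<lambda>t. W t - w (Suc k) t) = ?I W - ?I (w (Suc k))"
      using integrable_inner_prod[OF V w] integrable_inner_prod[OF V W(1)] by (simp add: inner_diff_right)
    moreover have "\<bar>?I (\<lambda>t. W t - w (Suc k) t)\<bar> \<le> N k * L2_norm M (\<lambda>t. W t - w (Suc k) t)"
      unfolding N_def by (intro L2_inner_bound V sq_integrable_diff W w)
    moreover have "N k * L2_norm M (\<lambda>t. W t - w (Suc k) t) \<le> N k * ((4/3) * (1/4) ^ Suc k)"
      using W(2)[of "Suc k"] N(2)[of k] unfolding w_sum by (intro mult_left_mono) auto
    ultimately have "\<bar>?I (w (Suc k))\<bar> - N k * ((4/3) * (1/4) ^ Suc k) \<le> \<bar>?I W\<bar>"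
      by linarith
    with 1 have "2/3 * ((1/4) ^ k * N k) \<le> \<bar>?I W\<bar>" by (simp add: field_simps)
    also have "\<dots> \<le> B" using B[of "n k"] by (simp add: V_def)
    finally have "2/3 * ((1/4) ^ k * N k) \<le> B" .
    moreover have "(5/4) ^ k = (1/4) ^ k * (5::real) ^ k" by (simp add: power_divide)
    moreover have "(1/4) ^ k * (5::real) ^ k \<le> (1/4) ^ k * N k"
      using N(1)[of k] by (intro mult_left_mono) auto
    ultimately show ?thesis by linarith
  qed
  obtain k where "3/2 * B < (5/4) ^ k"
    using real_arch_pow[of "5/4" "3/2 * B"] by auto
  then show False using big[of k] by simp
qed

text \<open>
  If \<open>g' = y\<close> and \<open>y' = w + g\<close>, then \<open>X \<bullet> y + V \<bullet> g\<close> is the derivative of \<open>X \<bullet> g\<close>. Such test functions \<open>y\<close>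
  reduce the scalar product of \<open>H\<^sup>1\<close> to the scalar product of \<open>V\<close> with \<open>w\<close> and boundary terms.
\<close>

lemma H1_inner_test_function:
  assumes X: "has_H1_derivative T X V" and y: "has_H1_derivative T y (\<lambda>t. w t + g t)"
    and g: "primitive_on (-T) T g y" and w: "sq_integrable (lebesgue_on {-T..T}) w" and "T > 0"
  shows "H1_inner T X y = (LINT t|lebesgue_on {-T..T}. V t \<bullet> w t) + X T \<bullet> g T - X (-T) \<bullet> g (-T)"
proof -
  let ?M = "lebesgue_on {-T..T}"
  note X' = X[unfolded has_H1_derivative_iff]
  have prod: "primitive_on (-T) T (\<lambda>t. X t \<bullet> g t) (\<lambda>t. V t \<bullet> g t + X t \<bullet> y t)"
    using primitive_on_product[OF bounded_bilinear_inner X'[THEN conjunct2] g] .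
  have "H1_inner T X y = (LINT t|?M. X t \<bullet> y t + V t \<bullet> (w t + g t))"
    by (rule H1_inner_eq[OF X y])
  also have "\<dots> = (LINT t|?M. V t \<bullet> w t + (V t \<bullet> g t + X t \<bullet> y t))"
    by (simp add: inner_add_right algebra_simps)
  also have "\<dots> = (LINT t|?M. V t \<bullet> w t) + (LINT t|?M. V t \<bullet> g t + X t \<bullet> y t)"
    using X' w primitive_on_integrable[OF prod] by (intro Bochner_Integration.integral_add integrable_inner_prod) auto
  also have "(LINT t|?M. V t \<bullet> g t + X t \<bullet> y t) = X T \<bullet> g T - X (-T) \<bullet> g (-T)"
    using primitive_on_increment[OF prod, of "-T" T] \<open>T > 0\<close> by simp
  finally show ?thesis by simp
qed

lemma sq_integrable_continuous:
  fixes f :: "real \<Rightarrow> 'b::euclidean_space"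
  assumes "continuous_on {a..b} f"
  shows "sq_integrable (lebesgue_on {a..b}) f"
proof -
  have "(\<lambda>t. (norm (f t))\<^sup>2) absolutely_integrable_on {a..b}"
    by (intro absolutely_integrable_continuous_real continuous_intros assms)
  then have "integrable (lebesgue_on {a..b}) (\<lambda>t. (norm (f t))\<^sup>2)"
    by (rule absolutely_integrable_imp_integrable) simp
  then show ?thesis
    using assms by (auto simp: sq_integrable_def intro!: continuous_imp_measurable_on_sets_lebesgue)
qed

lemma primitive_on_exp:
  assumes "a \<le> b" shows "primitive_on a b (\<lambda>t. exp (c * t)) (\<lambda>t. c * exp (c * t :: real))"
proof (rule primitive_on_FTC[OF assms])
  show "integrable (lebesgue_on {a..b}) (\<lambda>t. c * exp (c * t))"
    by (intro absolutely_integrable_imp_integrable absolutely_integrable_continuous_real continuous_intros) auto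
  show "((\<lambda>t. exp (c * t)) has_vector_derivative c * exp (c * t)) (at t)" for t
    unfolding has_real_derivative_iff_has_vector_derivative[symmetric] by (auto intro!: derivative_eq_intros)
qed (intro continuous_intros)

text \<open>
  Variation of constants for \<open>p' = c * p + w\<close>.
\<close>

lemma primitive_on_exp_convolution:
  fixes w :: "real \<Rightarrow> 'b::euclidean_space"
  assumes "a \<le> b" "integrable (lebesgue_on {a..b}) w"
  obtains p where "primitive_on a b p (\<lambda>t. c *\<^sub>R p t + w t)" "p a = 0"
proof
  let ?A = "\<lambda>t. LINT s|lebesgue_on {a..t}. exp (- c * s) *\<^sub>R w s"
  have "integrable (lebesgue_on {a..b}) (\<lambda>s. exp (- c * s) *\<^sub>R w s)"
    by (rule integrable_continuous_product[OF bounded_bilinear_scaleR _ assms(2)]) (intro continuous_intros)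
  note A = primitive_on_indefinite[OF this]
  have "exp (c * t) *\<^sub>R exp (- c * t) *\<^sub>R w t = w t" for t
    by (simp flip: exp_add)
  then show "primitive_on a b (\<lambda>t. exp (c * t) *\<^sub>R ?A t) (\<lambda>t. c *\<^sub>R (exp (c * t) *\<^sub>R ?A t) + w t)"
    using primitive_on_product[OF bounded_bilinear_scaleR primitive_on_exp[OF assms(1), of c] A]
    by simp
  have "(LINT s|lebesgue_on {a..a}. exp (- c * s) *\<^sub>R w s) = 0"
    using has_bochner_integral_null[of "{a..a}" "\<lambda>s. exp (- c * s) *\<^sub>R w s"] by (auto simp: has_bochner_integral_iff)
  then show "exp (c * a) *\<^sub>R ?A a = 0" by simp
qed

lemma sq_integrable_imp_integrable_Icc:
  fixes w :: "real \<Rightarrow> 'b::euclidean_space"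
  assumes "sq_integrable (lebesgue_on {a..b}) w"
  shows "integrable (lebesgue_on {a..b}) w"
proof (rule Bochner_Integration.integrable_bound)
  show "integrable (lebesgue_on {a..b}) (\<lambda>t. norm (1::real) * norm (w t))"
    by (rule integrable_norm_prod[OF sq_integrable_continuous assms]) (intro continuous_intros)
qed (use assms in \<open>auto simp: sq_integrable_def\<close>)

text \<open>
  The system \<open>g' = y\<close>, \<open>y' = w + g\<close> decouples for \<open>p = y + g\<close> and \<open>q = y - g\<close> into \<open>p' = p + w\<close> and
  \<open>q' = - q + w\<close>.
\<close>

lemma H1_test_function_exists:
  assumes "T > 0" and w: "sq_integrable (lebesgue_on {-T..T}) w"
  obtains y g where "has_H1_derivative T y (\<lambda>t. w t + g t)" "primitive_on (-T) T g y" "g (-T) = 0"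
proof -
  note iw = sq_integrable_imp_integrable_Icc[OF w]
  obtain p where p: "primitive_on (-T) T p (\<lambda>t. 1 *\<^sub>R p t + w t)" "p (-T) = 0"
    using primitive_on_exp_convolution[OF _ iw, of 1] \<open>T > 0\<close> by auto
  obtain q where q: "primitive_on (-T) T q (\<lambda>t. (-1) *\<^sub>R q t + w t)" "q (-T) = 0"
    using primitive_on_exp_convolution[OF _ iw, of "-1"] \<open>T > 0\<close> by auto
  define y where "y t = (1/2) *\<^sub>R (p t + q t)" for t
  define g where "g t = (1/2) *\<^sub>R (p t + (-1) *\<^sub>R q t)" for t
  have y: "primitive_on (-T) T y (\<lambda>t. (1/2) *\<^sub>R ((1 *\<^sub>R p t + w t) + ((-1) *\<^sub>R q t + w t)))"
    unfolding y_def by (intro primitive_on_scaleR primitive_on_add p q)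
  have g: "primitive_on (-T) T g (\<lambda>t. (1/2) *\<^sub>R ((1 *\<^sub>R p t + w t) + (-1) *\<^sub>R ((-1) *\<^sub>R q t + w t)))"
    unfolding g_def by (intro primitive_on_scaleR primitive_on_add p q)
  have g': "primitive_on (-T) T g y"
    using g by (simp add: y_def[abs_def])
  have eq: "(1/2) *\<^sub>R ((1 *\<^sub>R p t + w t) + ((-1) *\<^sub>R q t + w t)) = w t + g t" for t
    by (simp add: g_def complex_eq_iff)
  have "sq_integrable (lebesgue_on {-T..T}) (\<lambda>t. w t + g t)"
    by (intro sq_integrable_add w sq_integrable_continuous primitive_on_continuous[OF g])
  with y eq have "has_H1_derivative T y (\<lambda>t. w t + g t)"
    by (simp add: has_H1_derivative_iff)
  then show thesis using g' p(2) q(2) by (intro that[of y g]) (auto simp: g_def)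
qed

lemma H1_holder:
  assumes "has_H1_derivative T x v" "-T \<le> s" "s \<le> t" "t \<le> T"
  shows "norm (x t - x s) \<le> L2_norm (lebesgue_on {-T..T}) v * sqrt (t - s)"
proof -
  let ?M = "lebesgue_on {-T..T}"
  note x = assms(1)[unfolded has_H1_derivative_iff]
  define i :: "real \<Rightarrow> real" where "i = indicator {s..t}"
  have i_sq: "(norm (i u))\<^sup>2 = indicator {s..t} u" for u by (simp add: i_def split: split_indicator)
  have int_i: "(LINT u|?M. indicat_real {s..t} u) = t - s"
  proof -
    have "emeasure ?M {s..t} = ennreal (t - s)"
      using assms by (subst emeasure_restrict_space) auto
    then show ?thesis
      using assms by (simp add: measure_def Int_absorb2)
  qed
  have "integrable ?M (indicat_real {s..t})"
    using assms by (intro integrable_real_indicator) (auto simp: sets_restrict_space emeasure_restrict_space)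
  then have i: "sq_integrable ?M i"
    unfolding sq_integrable_def i_sq by (auto simp: i_def)
  have "norm (x t - x s) \<le> (LINT u|lebesgue_on {s..t}. norm (v u))"
    using primitive_on_norm_increment x assms by blast
  also have "\<dots> = (LINT u|?M. norm (v u) * norm (i u))"
    using assms by (simp add: integral_restrict_space i_def)
      (intro Bochner_Integration.integral_cong refl, auto split: split_indicator)
  also have "\<dots> \<le> L2_norm ?M v * L2_norm ?M i"
    using x i by (intro L2_norm_prod) auto
  also have "L2_norm ?M i = sqrt (t - s)"
    unfolding L2_norm_def i_sq int_i ..
  finally show ?thesis .
qed

lemma pointwise_equicontinuous_imp_uniform:
  fixes X :: "nat \<Rightarrow> 'a::metric_space \<Rightarrow> 'b::real_normed_vector"
  assumes S: "compact S" and lim: "\<And>t. t \<in> S \<Longrightarrow> (\<lambda>n. X n t) \<longlonglongrightarrow> x t"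
    and equi: "\<And>e. e > 0 \<Longrightarrow> \<exists>d>0. \<forall>n. \<forall>s\<in>S. \<forall>t\<in>S. dist s t < d \<longrightarrow> norm (X n s - X n t) \<le> e"
    and "e > 0"
  shows "\<forall>\<^sub>F n in sequentially. \<forall>t\<in>S. norm (X n t - x t) < e"
proof -
  obtain d where d: "d > 0" "\<And>n s t. s \<in> S \<Longrightarrow> t \<in> S \<Longrightarrow> dist s t < d \<Longrightarrow> norm (X n s - X n t) \<le> e / 4"
    using equi[of "e / 4"] \<open>e > 0\<close> by auto
  have dx: "norm (x s - x t) \<le> e / 4" if "s \<in> S" "t \<in> S" "dist s t < d" for s t
  proof (rule tendsto_upperbound)
    show "(\<lambda>n. norm (X n s - X n t)) \<longlonglongrightarrow> norm (x s - x t)"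
      using that by (intro tendsto_intros lim)
  qed (use d(2) that in auto)
  obtain K where K: "finite K" "K \<subseteq> S" "S \<subseteq> (\<Union>p\<in>K. ball p d)"
    using compact_imp_seq_compact[OF S] seq_compact_imp_totally_bounded d(1) by metis
  have "\<forall>\<^sub>F n in sequentially. \<forall>p\<in>K. norm (X n p - x p) < e / 4"
  proof (intro eventually_ball_finite K(1) ballI)
    fix p assume "p \<in> K"
    then have "(\<lambda>n. X n p) \<longlonglongrightarrow> x p" using K lim by blast
    then show "\<forall>\<^sub>F n in sequentially. norm (X n p - x p) < e / 4"
      using tendstoD[of "\<lambda>n. X n p" "x p" sequentially "e / 4"] \<open>e > 0\<close> by (simp add: dist_norm)
  qed
  then show ?thesis
  proof eventually_elim
    case (elim n)
    show ?case
    proof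
      fix t assume t: "t \<in> S"
      then obtain p where p: "p \<in> K" "dist p t < d" using K(3) by auto
      have "norm (X n t - x t) \<le> norm (X n p - X n t) + norm (X n p - x p) + norm (x p - x t)"
        using norm_triangle_ineq4[of "X n p - x t" "X n p - X n t"] norm_triangle_ineq[of "X n p - x p" "x p - x t"]
        by simp
      also have "\<dots> < e / 4 + e / 4 + e / 4 + e / 4"
        using d(2)[of p t n] dx[of p t] elim p t K(2) \<open>e > 0\<close> by fastforce
      finally show "norm (X n t - x t) < e" by simp
    qed
  qed
qed

text \<open>
  If \<open>y\<close> is always closer to \<open>X\<close> than the origin is, then \<open>y / X\<close> stays in the right half plane. Its principal
  argument is continuous there and turns a determination of the angle of \<open>X\<close> into one of \<open>y\<close>.
\<close>

lemma Gamma_star_perturb: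
  assumes X: "X \<in> Gamma_star \<alpha> m \<phi>m \<phi>p T" and y: "y \<in> H1 T" and ends: "y (-T) = X (-T)" "y T = X T"
    and close: "\<And>t. t \<in> {-T..T} \<Longrightarrow> norm (y t - X t) < norm (X t)" and "T > 0"
  shows "y \<in> Gamma_star \<alpha> m \<phi>m \<phi>p T"
proof -
  from X obtain \<theta> where \<theta>: "continuous_on {-T..T} \<theta>" "\<And>t. t \<in> {-T..T} \<Longrightarrow> X t = of_real (norm (X t)) * cis (\<theta> t)"
    "\<theta> (-T) = \<phi>m" "\<theta> T = \<phi>p" and XH: "X \<in> H1 T" and X0: "\<And>t. t \<in> {-T..T} \<Longrightarrow> X t \<noteq> 0"
    by (auto simp: Gamma_star_def)
  have y0: "y t \<noteq> 0" if "t \<in> {-T..T}" for t using close[OF that] by auto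
  define q where "q t = y t / X t" for t
  have q_close: "norm (q t - 1) < 1" if "t \<in> {-T..T}" for t
  proof -
    have "q t - 1 = (y t - X t) / X t" using X0[OF that] by (simp add: q_def diff_divide_distrib)
    then show ?thesis using close[OF that] X0[OF that] by (simp add: norm_divide)
  qed
  have q_Re: "Re (q t) > 0" if "t \<in> {-T..T}" for t
    using q_close[OF that] abs_Re_le_cmod[of "q t - 1"] by simp
  have cont: "continuous_on {-T..T} y" "continuous_on {-T..T} X"
    using y XH by (auto simp: H1_def intro: H1_continuous)
  have cq: "continuous_on {-T..T} q" unfolding q_def using X0 cont by (intro continuous_intros) auto
  define \<psi> where "\<psi> t = \<theta> t + Arg (q t)" for t
  have "continuous_on {-T..T} (\<lambda>t. Arg (q t))"
  proof (rule continuous_on_compose2[of "{z. Re z > 0}" Arg])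
    show "continuous_on {z. 0 < Re z} Arg"
      by (auto intro!: continuous_at_imp_continuous_on continuous_at_Arg simp: complex_nonpos_Reals_iff)
  qed (use cq q_Re in auto)
  then have "continuous_on {-T..T} \<psi>" unfolding \<psi>_def by (intro continuous_on_add \<theta>(1))
  moreover have "y t = of_real (norm (y t)) * cis (\<psi> t)" if "t \<in> {-T..T}" for t
  proof -
    have "q t \<noteq> 0" using q_Re[OF that] by auto
    have "y t = q t * X t" using X0[OF that] by (simp add: q_def)
    also have "\<dots> = (of_real (norm (q t)) * cis (Arg (q t))) * (of_real (norm (X t)) * cis (\<theta> t))"
      using \<theta>(2)[OF that] cis_Arg[OF \<open>q t \<noteq> 0\<close>] \<open>q t \<noteq> 0\<close> by (simp add: sgn_eq)
    also have "\<dots> = of_real (norm (q t) * norm (X t)) * (cis (Arg (q t)) * cis (\<theta> t))" by simp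
    also have "\<dots> = of_real (norm (y t)) * cis (\<psi> t)"
      using X0[OF that] by (simp add: q_def norm_divide cis_mult \<psi>_def add.commute)
    finally show ?thesis .
  qed
  moreover have "\<psi> (-T) = \<phi>m" "\<psi> T = \<phi>p"
    using \<theta> X0[of T] X0[of "-T"] \<open>T > 0\<close> by (auto simp: \<psi>_def q_def ends)
  ultimately show ?thesis
    using X y y0 ends by (auto simp: Gamma_star_def)
qed

text \<open>
  For fixed end points, weak convergence in \<open>H\<^sup>1\<close> amounts to weak convergence of the derivatives in \<open>L\<^sup>2\<close>.
  By uniform boundedness the derivatives are bounded, so that the paths are equicontinuous; pointwise
  convergence, which comes from testing with indicator functions, is therefore uniform.
\<close>

lemma H1_weak_limit:
  assumes "T > 0" and weak: "H1_weakly_converges T X x"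
    and ends: "\<And>n. X n (-T) = a" "\<And>n. X n T = b"
  shows "x (-T) = a" "x T = b"
    "\<And>e. e > 0 \<Longrightarrow> \<forall>\<^sub>F n in sequentially. \<forall>t\<in>{-T..T}. norm (X n t - x t) < e"
proof -
  let ?M = "lebesgue_on {-T..T}"
  define V where "V n = H1_deriv T (X n)" for n
  define v where "v = H1_deriv T x"
  have X: "has_H1_derivative T (X n) (V n)" for n
    using weak by (auto simp: H1_weakly_converges_def V_def intro: has_H1_derivative_H1_deriv)
  have x: "has_H1_derivative T x v"
    using weak by (auto simp: H1_weakly_converges_def v_def intro: has_H1_derivative_H1_deriv)
  have conv: "(\<lambda>n. H1_inner T (X n) y) \<longlonglongrightarrow> H1_inner T x y" if "has_H1_derivative T y u" for y u
    using weak H1I[OF that] by (auto simp: H1_weakly_converges_def)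
  \<comment> \<open>The test functions \<open>exp t\<close> and \<open>exp (- t)\<close> solve \<open>y'' = y\<close>, so that only boundary terms remain.
    They give two independent linear equations for the boundary values of \<open>x\<close>.\<close>
  have expo: "b \<bullet> (c * exp (c * T)) *\<^sub>R e - a \<bullet> (c * exp (- c * T)) *\<^sub>R e =
      x T \<bullet> (c * exp (c * T)) *\<^sub>R e - x (-T) \<bullet> (c * exp (- c * T)) *\<^sub>R e" if c: "c = 1 \<or> c = -1" for c :: real and e :: complex
  proof -
    let ?y = "\<lambda>t. exp (c * t) *\<^sub>R e" and ?g = "\<lambda>t. (c * exp (c * t)) *\<^sub>R e"
    have p: "primitive_on (-T) T ?y ?g"
      using primitive_on_linear[OF bounded_linear_scaleR_left primitive_on_exp[of "-T" T c]] \<open>T > 0\<close> by simp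
    have g: "primitive_on (-T) T ?g ?y"
      using primitive_on_scaleR[OF p, of c] c by auto
    have "has_H1_derivative T ?y (\<lambda>t. 0 + ?g t)"
      using p by (auto simp: has_H1_derivative_iff intro!: sq_integrable_continuous continuous_intros)
    note test = H1_inner_test_function[OF _ this g sq_integrable_zero \<open>T > 0\<close>] and H = this
    have "(\<lambda>n. H1_inner T (X n) ?y) = (\<lambda>n. b \<bullet> ?g T - a \<bullet> ?g (-T))"
      using test[OF X] ends by simp
    with conv[OF H] have "b \<bullet> ?g T - a \<bullet> ?g (-T) = H1_inner T x ?y"
      by (simp add: LIMSEQ_const_iff)
    with test[OF x] show ?thesis by simp
  qed
  have endpts: "(b - x T) \<bullet> e = 0 \<and> (a - x (-T)) \<bullet> e = 0" for e
  proof -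
    let ?p = "(b - x T) \<bullet> e" and ?q = "(a - x (-T)) \<bullet> e"
    have 1: "exp T * ?p = exp (-T) * ?q"
      using expo[of 1 e] by (simp add: inner_diff_left algebra_simps)
    have 2: "exp (-T) * ?p = exp T * ?q"
      using expo[of "-1" e] by (simp add: inner_diff_left algebra_simps)
    have "exp T * exp T * ?p = exp (-T) * exp (-T) * ?p"
      using 1 2 by (metis mult.assoc mult.commute)
    moreover have "exp (-T) * exp (-T) < exp T * exp T"
      using \<open>T > 0\<close> by (simp flip: exp_add)
    ultimately have "?p = 0" by simp
    with 2 show ?thesis by simp
  qed
  show xa: "x (-T) = a" and xb: "x T = b"
    using endpts[of "a - x (-T)"] endpts[of "b - x T"] by auto
  have weakL2: "(\<lambda>n. LINT t|?M. V n t \<bullet> w t) \<longlonglongrightarrow> (LINT t|?M. v t \<bullet> w t)" if w: "sq_integrable ?M w" for w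
  proof -
    obtain y g where y: "has_H1_derivative T y (\<lambda>t. w t + g t)" "primitive_on (-T) T g y" "g (-T) = 0"
      using H1_test_function_exists[OF \<open>T > 0\<close> w] by metis
    have "(LINT t|?M. V n t \<bullet> w t) = H1_inner T (X n) y - b \<bullet> g T" for n
      using H1_inner_test_function[OF X[of n] y(1,2) w \<open>T > 0\<close>] ends y(3) by simp
    moreover have "(LINT t|?M. v t \<bullet> w t) = H1_inner T x y - b \<bullet> g T"
      using H1_inner_test_function[OF x y(1,2) w \<open>T > 0\<close>] xb y(3) by simp
    ultimately show ?thesis
      using conv[OF y(1)] by (simp add: tendsto_diff)
  qed
  have "\<exists>C. \<forall>n. L2_norm ?M (V n) \<le> C"
  proof (rule L2_weakly_bounded_imp_bounded)
    show "sq_integrable ?M (V n)" for n using X[of n] by (simp add: has_H1_derivative_iff)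
    fix w :: "real \<Rightarrow> complex" assume "sq_integrable ?M w"
    from convergent_imp_Bseq[OF convergentI[OF weakL2[OF this]]]
    show "\<exists>B. \<forall>n. \<bar>LINT t|?M. V n t \<bullet> w t\<bar> \<le> B" by (auto simp: Bseq_def)
  qed
  then obtain C0 where "\<And>n. L2_norm ?M (V n) \<le> C0" by blast
  then obtain C where C: "\<And>n. L2_norm ?M (V n) \<le> C" "C > 0"
    by (metis gt_ex less_le_trans max.strict_coboundedI2 max.coboundedI1 order.trans linorder_not_less less_imp_le)
  have ptw: "(\<lambda>n. X n t) \<longlonglongrightarrow> x t" if t: "t \<in> {-T..T}" for t
  proof (subst tendsto_componentwise_iff, intro ballI)
    fix e :: complex assume "e \<in> Basis"
    let ?w = "\<lambda>u. indicat_real {-T..t} u *\<^sub>R e"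
    have w: "sq_integrable ?M ?w"
    proof -
      have "integrable ?M (indicat_real {-T..t})"
        using t by (intro integrable_real_indicator) (auto simp: sets_restrict_space emeasure_restrict_space)
      moreover have "(norm (?w u))\<^sup>2 = indicat_real {-T..t} u * (norm e)\<^sup>2" for u
        by (simp split: split_indicator)
      ultimately show ?thesis unfolding sq_integrable_def by auto
    qed
    have rep: "(LINT u|?M. z' u \<bullet> ?w u) = (z t - z (-T)) \<bullet> e" if "has_H1_derivative T z z'" for z z'
    proof -
      have z: "primitive_on (-T) T z z'" using that by (simp add: has_H1_derivative_iff)
      have iz: "integrable (lebesgue_on {-T..t}) z'"
        using primitive_on_integrable[OF z] t by (auto intro: integrable_Icc_mono)
      have "(LINT u|?M. z' u \<bullet> ?w u) = (LINT u|lebesgue_on {-T..t}. z' u \<bullet> e)"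
        using t by (simp add: integral_restrict_space)
          (intro Bochner_Integration.integral_cong refl, auto split: split_indicator)
      also have "\<dots> = (z t - z (-T)) \<bullet> e"
        using primitive_on_increment[OF z, of "-T" t] t iz by simp
      finally show ?thesis .
    qed
    have "(\<lambda>n. (X n t - a) \<bullet> e) \<longlonglongrightarrow> (x t - a) \<bullet> e"
      using weakL2[OF w] rep[OF X] rep[OF x] ends xa by simp
    from tendsto_add[OF this tendsto_const[of "a \<bullet> e"]]
    show "(\<lambda>n. X n t \<bullet> e) \<longlonglongrightarrow> x t \<bullet> e"
      by (simp only: inner_diff_left diff_add_cancel)
  qed
  fix e :: real assume "e > 0"
  show "\<forall>\<^sub>F n in sequentially. \<forall>t\<in>{-T..T}. norm (X n t - x t) < e"
  proof (rule pointwise_equicontinuous_imp_uniform[OF _ ptw _ \<open>e > 0\<close>])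
    fix e :: real assume "e > 0"
    define d where "d = (e / C)\<^sup>2"
    have bound: "norm (X n t - X n s) \<le> e" if "-T \<le> s" "s \<le> t" "t \<le> T" "t - s < d" for n s t
    proof -
      have "norm (X n t - X n s) \<le> L2_norm ?M (V n) * sqrt (t - s)"
        using H1_holder[OF X] that by simp
      also have "\<dots> \<le> C * (e / C)"
        using that C \<open>e > 0\<close> by (intro mult_mono real_le_lsqrt) (auto simp: d_def)
      finally show ?thesis using C(2) by simp
    qed
    show "\<exists>d>0. \<forall>n. \<forall>s\<in>{-T..T}. \<forall>t\<in>{-T..T}. dist s t < d \<longrightarrow> norm (X n s - X n t) \<le> e"
    proof (intro exI conjI allI ballI impI)
      show "d > 0" using \<open>e > 0\<close> C(2) by (simp add: d_def)
      fix n s t assume "s \<in> {-T..T}" "t \<in> {-T..T}" "dist s t < d"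
      then show "norm (X n s - X n t) \<le> e"
        using bound[of s t n] bound[of t s n] by (cases "s \<le> t") (auto simp: dist_real_def norm_minus_commute)
    qed
  qed simp
qed

text \<open>
  Weakly convergent sequences converge uniformly. If the limit has no zero, then it is a small perturbation
  of some member of the sequence and has the same total angle. Passing to the closure thus adds only paths
  that meet the origin.
\<close>

lemma Gamma_cases:
  assumes "T > 0" and x: "x \<in> Gamma \<alpha> m \<phi>m \<phi>p T"
  shows "x \<in> H1 T" "x (-T) = xbar \<alpha> m \<phi>m \<phi>p (-T)" "x T = xbar \<alpha> m \<phi>m \<phi>p T"
    "x \<in> Gamma_star \<alpha> m \<phi>m \<phi>p T \<or> (\<exists>s\<in>{-T..T}. x s = 0)"
proof -
  obtain X where X: "\<And>n. X n \<in> Gamma_star \<alpha> m \<phi>m \<phi>p T" and weak: "H1_weakly_converges T X x"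
    using x by (auto simp: Gamma_def H1_weak_closure_def)
  have ends: "X n (-T) = xbar \<alpha> m \<phi>m \<phi>p (-T)" "X n T = xbar \<alpha> m \<phi>m \<phi>p T" for n
    using X[of n] by (auto simp: Gamma_star_def)
  note lim = H1_weak_limit[OF \<open>T > 0\<close> weak ends]
  show xH: "x \<in> H1 T" using weak by (simp add: H1_weakly_converges_def)
  show e1: "x (-T) = xbar \<alpha> m \<phi>m \<phi>p (-T)" and e2: "x T = xbar \<alpha> m \<phi>m \<phi>p T"
    using lim by auto
  show "x \<in> Gamma_star \<alpha> m \<phi>m \<phi>p T \<or> (\<exists>s\<in>{-T..T}. x s = 0)"
  proof (rule disjCI)
    assume "\<not> (\<exists>s\<in>{-T..T}. x s = 0)"
    then have x0: "\<And>t. t \<in> {-T..T} \<Longrightarrow> x t \<noteq> 0" by blast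
    have "continuous_on {-T..T} x" using xH by (auto simp: H1_def intro: H1_continuous)
    then have "\<exists>t0\<in>{-T..T}. \<forall>t\<in>{-T..T}. norm (x t0) \<le> norm (x t)"
      using \<open>T > 0\<close> by (intro continuous_attains_inf continuous_intros) auto
    then obtain c where c: "c > 0" "\<And>t. t \<in> {-T..T} \<Longrightarrow> c \<le> norm (x t)"
      using x0 by (metis zero_less_norm_iff)
    obtain n where n: "\<forall>t\<in>{-T..T}. norm (X n t - x t) < c / 2"
      using eventually_happens[OF lim(3)[of "c / 2"]] c(1) by auto
    show "x \<in> Gamma_star \<alpha> m \<phi>m \<phi>p T"
    proof (rule Gamma_star_perturb[OF X[of n] xH _ _ _ \<open>T > 0\<close>])
      fix t assume t: "t \<in> {-T..T}"
      have "norm (x t) \<le> norm (X n t) + norm (X n t - x t)"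
        using norm_triangle_ineq2[of "x t" "X n t"] by (simp add: norm_minus_commute)
      then show "norm (x t - X n t) < norm (X n t)"
        using bspec[OF n t] c(2)[OF t] by (simp add: norm_minus_commute)
    qed (use ends e1 e2 in auto)
  qed
qed

section \<open>Euler-Lagrange equation of minimizers\<close>

definition potential :: "real \<Rightarrow> real \<Rightarrow> complex \<Rightarrow> real" where
  "potential \<alpha> m z = m / (\<alpha> * norm z powr \<alpha>)"

lemma potential_nonneg: "m > 0 \<Longrightarrow> 0 < \<alpha> \<Longrightarrow> 0 \<le> potential \<alpha> m z"
  by (simp add: potential_def)

lemma continuous_on_potential:
  assumes "continuous_on S x" "\<And>t. t \<in> S \<Longrightarrow> x t \<noteq> 0" "0 < \<alpha>"
  shows "continuous_on S (\<lambda>t. potential \<alpha> m (x t))"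
  unfolding potential_def using assms by (intro continuous_intros) auto

lemma integrable_continuous_Icc:
  fixes f :: "real \<Rightarrow> 'b::euclidean_space"
  assumes "continuous_on {a..b} f"
  shows "integrable (lebesgue_on {a..b}) f"
  by (rule sq_integrable_imp_integrable_Icc[OF sq_integrable_continuous[OF assms]])

lemma action_eq_real:
  assumes "m > 0" "0 < \<alpha>" and x: "has_H1_derivative T x v" and nz: "\<And>t. t \<in> {-T..T} \<Longrightarrow> x t \<noteq> 0"
  shows "action \<alpha> m T x =
    ennreal ((L2_norm (lebesgue_on {-T..T}) v)\<^sup>2 / 2 + (LINT t|lebesgue_on {-T..T}. potential \<alpha> m (x t)))"
proof -
  let ?M = "lebesgue_on {-T..T}"
  have i1: "integrable ?M (\<lambda>t. (norm (v t))\<^sup>2 / 2)"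
    using x by (auto simp: has_H1_derivative_iff sq_integrable_def)
  have i2: "integrable ?M (\<lambda>t. potential \<alpha> m (x t))"
    using nz \<open>0 < \<alpha>\<close> by (intro integrable_continuous_Icc continuous_on_potential H1_continuous[OF x]) auto
  have "action \<alpha> m T x = (\<integral>\<^sup>+t. ennreal ((norm (v t))\<^sup>2 / 2 + potential \<alpha> m (x t)) \<partial>?M)"
    unfolding action_eq[OF x]
    using nz potential_nonneg[OF assms(1,2)]
    by (intro nn_integral_cong) (auto simp: Lbar_def Vbar_def potential_def)
  also have "\<dots> = ennreal (LINT t|?M. (norm (v t))\<^sup>2 / 2 + potential \<alpha> m (x t))"
    using i1 i2 potential_nonneg[OF assms(1,2)] by (intro nn_integral_eq_integral) auto
  also have "(LINT t|?M. (norm (v t))\<^sup>2 / 2 + potential \<alpha> m (x t)) =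
      (L2_norm ?M v)\<^sup>2 / 2 + (LINT t|?M. potential \<alpha> m (x t))"
    using i1 i2 by (simp add: L2_norm_square)
  finally show ?thesis .
qed

lemma powr_lipschitz:
  fixes p :: real
  assumes "p \<le> 1" "0 < a" "a \<le> r" "a \<le> s"
  shows "\<bar>r powr p - s powr p\<bar> \<le> \<bar>p\<bar> * a powr (p - 1) * \<bar>r - s\<bar>"
proof -
  have *: "\<bar>r powr p - s powr p\<bar> \<le> \<bar>p\<bar> * a powr (p - 1) * \<bar>r - s\<bar>" if rs: "a \<le> s" "s < r" for r s
  proof -
    obtain z where z: "s < z" "z < r" "r powr p - s powr p = (r - s) * (p * z powr (p - 1))"
      using MVT2[of s r "\<lambda>z. z powr p" "\<lambda>z. p * z powr (p - 1)"] rs \<open>0 < a\<close> has_real_derivative_powr by force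
    have "z powr (p - 1) \<le> a powr (p - 1)"
      using z rs assms by (intro powr_mono2') auto
    then have "\<bar>r - s\<bar> * (\<bar>p\<bar> * z powr (p - 1)) \<le> \<bar>r - s\<bar> * (\<bar>p\<bar> * a powr (p - 1))"
      by (intro mult_left_mono) auto
    then show ?thesis using z by (simp add: abs_mult mult_ac)
  qed
  consider "r = s" | "s < r" | "r < s" by linarith
  then show ?thesis
  proof cases
    case 2 then show ?thesis using * assms by blast
  next
    case 3 then show ?thesis using *[of r s] assms by (simp add: abs_minus_commute)
  qed simp
qed

lemma abs_scaled_diff: "0 \<le> k \<Longrightarrow> \<bar>k * a - k * b\<bar> = k * \<bar>a - b\<bar>" for k a b :: real
  by (simp add: abs_mult flip: right_diff_distrib)

lemma potential_lipschitz:
  assumes "m > 0" "0 < \<alpha>" "0 < e" "e \<le> norm z" "e \<le> norm w"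
  shows "\<bar>potential \<alpha> m z - potential \<alpha> m w\<bar> \<le> m * e powr (- \<alpha> - 1) * norm (z - w)"
proof -
  have eq: "potential \<alpha> m y = m / \<alpha> * norm y powr (- \<alpha>)" for y
    by (simp add: potential_def powr_minus field_simps)
  have "\<bar>potential \<alpha> m z - potential \<alpha> m w\<bar> = m / \<alpha> * \<bar>norm z powr (- \<alpha>) - norm w powr (- \<alpha>)\<bar>"
    unfolding eq using assms by (intro abs_scaled_diff) simp
  also have "\<dots> \<le> m / \<alpha> * (\<bar>- \<alpha>\<bar> * e powr (- \<alpha> - 1) * \<bar>norm z - norm w\<bar>)"
    using assms by (intro mult_left_mono powr_lipschitz) auto
  also have "\<dots> \<le> m / \<alpha> * (\<bar>- \<alpha>\<bar> * e powr (- \<alpha> - 1) * norm (z - w))"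
    using assms by (intro mult_left_mono norm_triangle_ineq3) auto
  finally show ?thesis using assms by simp
qed

text \<open>
  The inequality that a comparison with a minimizer requires: linear terms with a quadratic error. The
  potential is a function of \<open>q = |z|\<^sup>2\<close> with Lipschitz derivative, and its derivative is negative, so that the
  contribution of \<open>|h|\<^sup>2\<close> to the increment of \<open>q\<close> only improves the estimate.
\<close>

lemma potential_upper_expansion:
  assumes "m > 0" "0 < \<alpha>" "0 < c" "2 * c \<le> norm z" "norm z \<le> R" "norm h \<le> c"
  shows "potential \<alpha> m (z + h) \<le> potential \<alpha> m z - (m / norm z powr (\<alpha> + 2)) * (z \<bullet> h)
    + m * (\<alpha> / 2 + 1) / 2 * (c\<^sup>2) powr (- \<alpha> / 2 - 2) * (2 * R + c)\<^sup>2 * (norm h)\<^sup>2"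
proof -
  define f where "f q = m / \<alpha> * q powr (- \<alpha> / 2)" for q
  define f' where "f' q = - (m / 2) * q powr (- \<alpha> / 2 - 1)" for q
  define L where "L = m * (\<alpha> / 2 + 1) / 2 * (c\<^sup>2) powr (- \<alpha> / 2 - 2)"
  have L0: "L \<ge> 0" using assms by (simp add: L_def)
  have der: "(f has_real_derivative f' q) (at q)" if "q > 0" for q
  proof -
    have "(f has_real_derivative m / \<alpha> * (- \<alpha> / 2 * q powr (- \<alpha> / 2 - 1))) (at q)"
      unfolding f_def[abs_def] using that by (intro DERIV_cmult has_real_derivative_powr)
    then show ?thesis using assms by (simp add: f'_def)
  qed
  have f'_lip: "\<bar>f' p - f' q\<bar> \<le> L * \<bar>p - q\<bar>" if "c\<^sup>2 \<le> p" "c\<^sup>2 \<le> q" for p q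
  proof -
    have "\<bar>f' p - f' q\<bar> = m / 2 * \<bar>p powr (- \<alpha> / 2 - 1) - q powr (- \<alpha> / 2 - 1)\<bar>"
    proof -
      have "\<bar>f' p - f' q\<bar> = \<bar>m / 2 * p powr (- \<alpha> / 2 - 1) - m / 2 * q powr (- \<alpha> / 2 - 1)\<bar>"
        by (simp add: f'_def abs_minus_commute)
      then show ?thesis using \<open>m > 0\<close> by (subst (asm) abs_scaled_diff) auto
    qed
    also have "\<dots> \<le> m / 2 * (\<bar>- \<alpha> / 2 - 1\<bar> * (c\<^sup>2) powr (- \<alpha> / 2 - 1 - 1) * \<bar>p - q\<bar>)"
      using assms that by (intro mult_left_mono powr_lipschitz) auto
    also have "\<dots> = L * \<bar>p - q\<bar>"
    proof -
      have "\<bar>- \<alpha> / 2 - 1\<bar> = \<alpha> / 2 + 1" "- \<alpha> / 2 - 1 - 1 = - \<alpha> / 2 - 2"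
        using assms by auto
      then show ?thesis unfolding L_def by (simp only:) simp
    qed
    finally show ?thesis .
  qed
  have taylor: "f q \<le> f p + f' p * (q - p) + L * (q - p)\<^sup>2" if pq: "c\<^sup>2 \<le> p" "c\<^sup>2 \<le> q" for p q
  proof -
    have mvt: "\<exists>z\<ge>c\<^sup>2. \<bar>z - p\<bar> \<le> \<bar>q - p\<bar> \<and> f q - f p = (q - p) * f' z"
    proof -
      have pos: "0 < z" if "c\<^sup>2 \<le> z" for z using that \<open>0 < c\<close> zero_less_power[of c 2] by linarith
      consider "p = q" | "p < q" | "q < p" by linarith
      then show ?thesis
      proof cases
        case 1 then show ?thesis using pq by auto
      next
        case 2
        then obtain z where "p < z" "z < q" "f q - f p = (q - p) * f' z"
          using MVT2[of p q f f'] der pos pq by (metis order_trans)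
        then show ?thesis using pq by (intro exI[of _ z]) auto
      next
        case 3
        then obtain z where "q < z" "z < p" "f p - f q = (p - q) * f' z"
          using MVT2[of q p f f'] der pos pq by (metis order_trans)
        then show ?thesis using pq by (intro exI[of _ z]) (auto simp: algebra_simps)
      qed
    qed
    then obtain z where z: "c\<^sup>2 \<le> z" "\<bar>z - p\<bar> \<le> \<bar>q - p\<bar>" "f q - f p = (q - p) * f' z" by blast
    have "f q - f p - f' p * (q - p) = (f' z - f' p) * (q - p)"
      using z(3) by (simp add: algebra_simps)
    also have "\<dots> \<le> \<bar>f' z - f' p\<bar> * \<bar>q - p\<bar>" by (simp flip: abs_mult)
    also have "\<dots> \<le> L * \<bar>q - p\<bar> * \<bar>q - p\<bar>"
      using f'_lip[OF z(1) pq(1)] mult_left_mono[OF z(2) L0] by (intro mult_right_mono) auto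
    finally show ?thesis by (simp add: power2_eq_square mult.assoc)
  qed
  have pot: "potential \<alpha> m y = f ((norm y)\<^sup>2)" for y
  proof -
    have "((norm y)\<^sup>2) powr (- \<alpha> / 2) = norm y powr (- \<alpha>)"
      by (simp add: powr_half_sqrt powr_powr flip: powr_numeral)
    then show ?thesis by (simp add: potential_def f_def powr_minus field_simps)
  qed
  have nzh: "c \<le> norm (z + h)"
    using norm_triangle_ineq4[of "z + h" h] assms by simp
  have sq: "c\<^sup>2 \<le> (norm z)\<^sup>2" "c\<^sup>2 \<le> (norm (z + h))\<^sup>2"
    using nzh assms by (auto intro!: power_mono)
  have diff: "(norm (z + h))\<^sup>2 - (norm z)\<^sup>2 = 2 * (z \<bullet> h) + (norm h)\<^sup>2"
    by (simp add: power2_norm_eq_inner inner_add_left inner_add_right inner_commute)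
  have "potential \<alpha> m (z + h) \<le> potential \<alpha> m z + f' ((norm z)\<^sup>2) * (2 * (z \<bullet> h) + (norm h)\<^sup>2)
      + L * (2 * (z \<bullet> h) + (norm h)\<^sup>2)\<^sup>2"
    using taylor[OF sq] unfolding pot diff .
  moreover have "f' ((norm z)\<^sup>2) * (2 * (z \<bullet> h) + (norm h)\<^sup>2) \<le> - (m / norm z powr (\<alpha> + 2)) * (z \<bullet> h)"
  proof -
    have "((norm z)\<^sup>2) powr (- \<alpha> / 2 - 1) = norm z powr (- (\<alpha> + 2))"
      by (simp add: powr_powr algebra_simps flip: powr_numeral)
    then have f'z: "f' ((norm z)\<^sup>2) = - (m / 2) * norm z powr (- (\<alpha> + 2))"
      by (simp add: f'_def)
    have "f' ((norm z)\<^sup>2) * (2 * (z \<bullet> h)) = - (m / norm z powr (\<alpha> + 2)) * (z \<bullet> h)"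
      unfolding f'z powr_minus_divide by simp
    moreover have "f' ((norm z)\<^sup>2) * (norm h)\<^sup>2 \<le> 0"
      unfolding f'z using assms by (simp add: mult_nonpos_nonneg)
    ultimately show ?thesis by (simp add: distrib_left)
  qed
  moreover have "L * (2 * (z \<bullet> h) + (norm h)\<^sup>2)\<^sup>2 \<le> L * ((2 * R + c)\<^sup>2 * (norm h)\<^sup>2)"
  proof (intro mult_left_mono L0)
    have "\<bar>2 * (z \<bullet> h) + (norm h)\<^sup>2\<bar> \<le> 2 * \<bar>z \<bullet> h\<bar> + (norm h)\<^sup>2"
      using abs_triangle_ineq[of "2 * (z \<bullet> h)" "(norm h)\<^sup>2"] by (simp add: abs_mult)
    also have "\<dots> \<le> 2 * (norm z * norm h) + norm h * norm h"
      using Cauchy_Schwarz_ineq2[of z h] by (simp add: power2_eq_square)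
    also have "\<dots> = (2 * norm z + norm h) * norm h" by (simp add: algebra_simps)
    also have "\<dots> \<le> (2 * R + c) * norm h"
      using assms by (intro mult_right_mono) auto
    finally have "\<bar>2 * (z \<bullet> h) + (norm h)\<^sup>2\<bar>\<^sup>2 \<le> ((2 * R + c) * norm h)\<^sup>2"
      by (intro power_mono) auto
    then show "(2 * (z \<bullet> h) + (norm h)\<^sup>2)\<^sup>2 \<le> (2 * R + c)\<^sup>2 * (norm h)\<^sup>2"
      by (simp add: power_mult_distrib)
  qed
  ultimately have "potential \<alpha> m (z + h) \<le> potential \<alpha> m z + - (m / norm z powr (\<alpha> + 2)) * (z \<bullet> h)
      + L * ((2 * R + c)\<^sup>2 * (norm h)\<^sup>2)"
    by linarith
  then show ?thesis by (simp add: L_def mult.assoc)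
qed

lemma quadratic_minorant_imp_zero:
  fixes D C s0 :: real
  assumes "s0 > 0" and "\<And>s. \<bar>s\<bar> \<le> s0 \<Longrightarrow> 0 \<le> s * D + s\<^sup>2 * C"
  shows "D = 0"
proof -
  have "-D \<le> 0 + s * C \<and> D \<le> 0 + s * C" if "0 < s" "s \<le> s0" for s
  proof -
    have "0 \<le> s * (D + s * C)" "0 \<le> s * (- D + s * C)"
      using assms(2)[of s] assms(2)[of "-s"] that by (auto simp: power2_eq_square algebra_simps)
    then show ?thesis using that by (simp add: zero_le_mult_iff)
  qed
  then have *: "\<bar>D\<bar> \<le> s * C" if "0 < s" "s \<le> s0" for s using that by fastforce
  have "((\<lambda>s. s * C) \<longlongrightarrow> 0 * C) (at_right 0)" by (intro tendsto_intros)
  moreover have "\<forall>\<^sub>F s in at_right 0. \<bar>D\<bar> \<le> s * C"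
    using eventually_at_right_real[OF \<open>s0 > 0\<close>] by eventually_elim (auto intro: *)
  ultimately have "\<bar>D\<bar> \<le> 0 * C" by (rule tendsto_lowerbound) simp
  then show ?thesis by simp
qed

text \<open>
  The argument of du Bois-Reymond with a single variation. Let \<open>G\<close> be the primitive of the acceleration
  prescribed by the equation of motion, and subtract from \<open>v - G\<close> its mean to obtain \<open>p\<close>. The primitive \<open>\<eta>\<close>
  of \<open>p\<close> vanishes at both ends, so that \<open>\<gamma> + s * \<eta>\<close> is admissible for small \<open>s\<close>, and the first variation in
  this direction is the square of the norm of \<open>p\<close>. Hence \<open>v\<close> is almost everywhere equal to \<open>G\<close> plus a constant,
  which is a continuously differentiable function.
\<close>

lemma minimizer_solves_kepler:
  assumes "m > 0" "0 < \<alpha>" "T > 0" and \<gamma>: "\<gamma> \<in> Gamma_star \<alpha> m \<phi>m \<phi>p T"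
    and min: "\<And>x. x \<in> Gamma_star \<alpha> m \<phi>m \<phi>p T \<Longrightarrow> action \<alpha> m T \<gamma> \<le> action \<alpha> m T x"
  shows "kepler_solution \<alpha> m T \<gamma>"
proof -
  let ?M = "lebesgue_on {-T..T}"
  define v where "v = H1_deriv T \<gamma>"
  have H: "has_H1_derivative T \<gamma> v"
    using \<gamma> by (auto simp: Gamma_star_def v_def intro: has_H1_derivative_H1_deriv)
  note H' = H[unfolded has_H1_derivative_iff]
  have nz: "\<gamma> t \<noteq> 0" if "t \<in> {-T..T}" for t using \<gamma> that by (simp add: Gamma_star_def)
  note cg = H1_continuous[OF H]
  have "\<exists>t0\<in>{-T..T}. \<forall>t\<in>{-T..T}. norm (\<gamma> t0) \<le> norm (\<gamma> t)"
    using \<open>T > 0\<close> by (intro continuous_attains_inf continuous_intros cg) auto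
  then obtain c2 where c2: "c2 > 0" "\<And>t. t \<in> {-T..T} \<Longrightarrow> c2 \<le> norm (\<gamma> t)"
    using nz by (metis zero_less_norm_iff)
  define c where "c = c2 / 2"
  have c: "c > 0" "\<And>t. t \<in> {-T..T} \<Longrightarrow> 2 * c \<le> norm (\<gamma> t)" using c2 by (auto simp: c_def)
  have "bounded (\<gamma> ` {-T..T})" using cg by (intro compact_imp_bounded compact_continuous_image) auto
  then obtain R where R: "\<And>t. t \<in> {-T..T} \<Longrightarrow> norm (\<gamma> t) \<le> R" by (metis bounded_iff imageI)
  define acc where "acc t = - ((m / norm (\<gamma> t) powr (\<alpha> + 2)) *\<^sub>R \<gamma> t)" for t
  have cacc: "continuous_on {-T..T} acc"
    unfolding acc_def using nz \<open>0 < \<alpha>\<close> by (intro continuous_intros cg) auto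
  define G where "G t = (LINT s|lebesgue_on {-T..t}. acc s)" for t
  have G: "primitive_on (-T) T G acc"
    unfolding G_def by (intro primitive_on_indefinite integrable_continuous_Icc cacc)
  note cG = primitive_on_continuous[OF G]
  define d where "d = (1 / (2 * T)) *\<^sub>R (LINT s|?M. v s - G s)"
  define p where "p t = v t - (G t + d)" for t
  have p: "sq_integrable ?M p"
  proof -
    have "sq_integrable ?M (\<lambda>t. G t + d)"
      by (intro sq_integrable_continuous continuous_intros cG)
    then show ?thesis unfolding p_def using H' by (intro sq_integrable_diff) auto
  qed
  define \<eta> where "\<eta> t = (LINT s|lebesgue_on {-T..t}. p s)" for t
  have \<eta>: "primitive_on (-T) T \<eta> p"
    unfolding \<eta>_def by (intro primitive_on_indefinite sq_integrable_imp_integrable_Icc p)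
  have \<eta>a: "\<eta> (-T) = 0"
    using has_bochner_integral_null[of "{-T..-T}" p] by (auto simp: has_bochner_integral_iff \<eta>_def)
  have intp0: "(LINT s|?M. p s) = 0"
  proof -
    have i: "integrable ?M v" "integrable ?M G"
      using H' primitive_on_integrable integrable_continuous_Icc[OF cG] by auto
    have "(LINT s|?M. p s) = (LINT s|?M. (v s - G s) - d)" by (simp add: p_def algebra_simps)
    also have "\<dots> = (LINT s|?M. v s - G s) - (2 * T) *\<^sub>R d"
      using i \<open>T > 0\<close> by (subst Bochner_Integration.integral_diff)
        (auto simp: measure_restrict_space finite_measure.integrable_const finite_measure_lebesgue_on)
    finally show ?thesis using \<open>T > 0\<close> by (simp add: d_def)
  qed
  have \<eta>b: "\<eta> T = 0" using intp0 by (simp add: \<eta>_def)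
  note c\<eta> = primitive_on_continuous[OF \<eta>]
  have "bounded (\<eta> ` {-T..T})" using c\<eta> by (intro compact_imp_bounded compact_continuous_image) auto
  then obtain E where E: "\<And>t. t \<in> {-T..T} \<Longrightarrow> norm (\<eta> t) \<le> E" by (metis bounded_iff imageI)
  have E0: "0 \<le> E" using order_trans[OF norm_ge_zero E[of T]] \<open>T > 0\<close> by simp
  define s0 where "s0 = c / (E + 1)"
  have s0: "s0 > 0" using c E0 by (simp add: s0_def)
  have small: "norm (s *\<^sub>R \<eta> t) \<le> c" if "\<bar>s\<bar> \<le> s0" "t \<in> {-T..T}" for s t
  proof -
    have "norm (s *\<^sub>R \<eta> t) \<le> s0 * (E + 1)"
      using that E[OF that(2)] s0 by (auto intro!: mult_mono)
    then show ?thesis using E0 by (simp add: s0_def)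
  qed
  define K where "K = m * (\<alpha> / 2 + 1) / 2 * (c\<^sup>2) powr (- \<alpha> / 2 - 2) * (2 * R + c)\<^sup>2"
  have K0: "0 \<le> K" using assms c by (simp add: K_def)
  define D where "D = (LINT t|?M. v t \<bullet> p t) + (LINT t|?M. acc t \<bullet> \<eta> t)"
  define C where "C = (L2_norm ?M p)\<^sup>2 / 2 + (LINT t|?M. K * (norm (\<eta> t))\<^sup>2)"
  have "0 \<le> s * D + s\<^sup>2 * C" if s: "\<bar>s\<bar> \<le> s0" for s
  proof -
    define y where "y t = \<gamma> t + s *\<^sub>R \<eta> t" for t
    have sp: "sq_integrable ?M (\<lambda>t. s *\<^sub>R p t)" by (rule sq_integrable_scaleR[OF p])
    have y: "has_H1_derivative T y (\<lambda>t. v t + s *\<^sub>R p t)"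
      unfolding has_H1_derivative_iff y_def
      using H' by (intro conjI sq_integrable_add sp primitive_on_add primitive_on_scaleR \<eta>) auto
    have "y \<in> Gamma_star \<alpha> m \<phi>m \<phi>p T"
    proof (rule Gamma_star_perturb[OF \<gamma> H1I[OF y] _ _ _ \<open>T > 0\<close>])
      fix t assume t: "t \<in> {-T..T}"
      show "norm (y t - \<gamma> t) < norm (\<gamma> t)"
        using small[OF s t] c(1) c(2)[OF t] by (simp add: y_def)
    qed (simp_all add: y_def \<eta>a \<eta>b)
    note le = min[OF this]
    have nzy: "y t \<noteq> 0" if "t \<in> {-T..T}" for t
      using \<open>y \<in> _\<close> that by (simp add: Gamma_star_def)
    have iU: "integrable ?M (\<lambda>t. potential \<alpha> m (\<gamma> t))" "integrable ?M (\<lambda>t. potential \<alpha> m (y t))"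
      using nz nzy \<open>0 < \<alpha>\<close> by (auto intro!: integrable_continuous_Icc continuous_on_potential cg H1_continuous[OF y])
    have ia: "integrable ?M (\<lambda>t. acc t \<bullet> \<eta> t)" "integrable ?M (\<lambda>t. K * (norm (\<eta> t))\<^sup>2)"
      by (intro integrable_continuous_Icc continuous_intros cacc c\<eta>)+
    have "(LINT t|?M. potential \<alpha> m (y t)) \<le>
        (LINT t|?M. potential \<alpha> m (\<gamma> t) + s * (acc t \<bullet> \<eta> t) + s\<^sup>2 * (K * (norm (\<eta> t))\<^sup>2))"
    proof (rule integral_mono)
      fix t assume "t \<in> space ?M"
      then have t: "t \<in> {-T..T}" by simp
      show "potential \<alpha> m (y t) \<le> potential \<alpha> m (\<gamma> t) + s * (acc t \<bullet> \<eta> t) + s\<^sup>2 * (K * (norm (\<eta> t))\<^sup>2)"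
        using potential_upper_expansion[OF assms(1,2) c(1) c(2)[OF t] R[OF t] small[OF s t]]
        by (simp add: y_def acc_def K_def power_mult_distrib mult_ac)
    qed (use iU ia in auto)
    also have "\<dots> = (LINT t|?M. potential \<alpha> m (\<gamma> t)) + s * (LINT t|?M. acc t \<bullet> \<eta> t) + s\<^sup>2 * (LINT t|?M. K * (norm (\<eta> t))\<^sup>2)"
      using iU ia by simp
    finally have U: "(LINT t|?M. potential \<alpha> m (y t)) \<le> \<dots>" .
    have kin: "(L2_norm ?M (\<lambda>t. v t + s *\<^sub>R p t))\<^sup>2 =
        (L2_norm ?M v)\<^sup>2 + 2 * (s * (LINT t|?M. v t \<bullet> p t)) + s\<^sup>2 * (L2_norm ?M p)\<^sup>2"
      using L2_norm_add_square[of ?M v "\<lambda>t. s *\<^sub>R p t"] H' sp by (simp add: L2_norm_scaleR power_mult_distrib)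
    have U0: "0 \<le> (LINT t|?M. potential \<alpha> m (y t))"
      using potential_nonneg[OF assms(1,2)] by (intro Bochner_Integration.integral_nonneg) auto
    have "(L2_norm ?M v)\<^sup>2 / 2 + (LINT t|?M. potential \<alpha> m (\<gamma> t)) \<le>
        (L2_norm ?M (\<lambda>t. v t + s *\<^sub>R p t))\<^sup>2 / 2 + (LINT t|?M. potential \<alpha> m (y t))"
    proof -
      have "action \<alpha> m T \<gamma> = ennreal ((L2_norm ?M v)\<^sup>2 / 2 + (LINT t|?M. potential \<alpha> m (\<gamma> t)))"
        by (rule action_eq_real[OF assms(1,2) H]) (rule nz)
      moreover have "action \<alpha> m T y = ennreal ((L2_norm ?M (\<lambda>t. v t + s *\<^sub>R p t))\<^sup>2 / 2 + (LINT t|?M. potential \<alpha> m (y t)))"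
        by (rule action_eq_real[OF assms(1,2) y]) (rule nzy)
      ultimately show ?thesis using le U0 by (simp add: ennreal_le_iff del: ennreal_plus)
    qed
    with U show ?thesis
      unfolding kin D_def C_def by (simp add: algebra_simps add_divide_distrib)
  qed
  from quadratic_minorant_imp_zero[OF s0 this] have D0: "D = 0" .
  \<comment> \<open>Integration by parts turns the first variation \<open>D\<close> into the integral of \<open>(v - G) \<bullet> p\<close>. Since \<open>p\<close>
    has mean zero, this is the integral of \<open>p \<bullet> p\<close>.\<close>
  have parts: "(LINT t|?M. acc t \<bullet> \<eta> t + G t \<bullet> p t) = 0"
    using primitive_on_increment[OF primitive_on_product[OF bounded_bilinear_inner G \<eta>], of "-T" T] \<open>T > 0\<close>
    by (simp add: \<eta>a \<eta>b)
  have "(L2_norm ?M p)\<^sup>2 = (LINT t|?M. v t \<bullet> p t - G t \<bullet> p t - d \<bullet> p t)"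
    by (simp add: L2_norm_square power2_norm_eq_inner p_def inner_diff_left inner_add_left algebra_simps)
  also have "\<dots> = (LINT t|?M. v t \<bullet> p t) - (LINT t|?M. G t \<bullet> p t) - d \<bullet> (LINT t|?M. p t)"
  proof -
    have "integrable ?M (\<lambda>t. v t \<bullet> p t)" "integrable ?M (\<lambda>t. G t \<bullet> p t)" "integrable ?M p"
      using H' p integrable_inner_prod[OF sq_integrable_continuous[OF cG] p] sq_integrable_imp_integrable_Icc[OF p]
      by (auto intro: integrable_inner_prod)
    then show ?thesis by simp
  qed
  also have "\<dots> = D - (LINT t|?M. acc t \<bullet> \<eta> t + G t \<bullet> p t)"
  proof -
    have "integrable ?M (\<lambda>t. acc t \<bullet> \<eta> t)" "integrable ?M (\<lambda>t. G t \<bullet> p t)"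
      by (intro integrable_inner_prod sq_integrable_continuous cG cacc c\<eta> p)+
    then show ?thesis by (simp add: D_def intp0)
  qed
  finally have "(L2_norm ?M p)\<^sup>2 = 0" using D0 parts by simp
  then have "(LINT t|?M. (norm (p t))\<^sup>2) = 0" by (simp add: L2_norm_square)
  then have "AE t in ?M. (norm (p t))\<^sup>2 = 0"
    using p by (subst (asm) integral_nonneg_eq_0_iff_AE) (auto simp: sq_integrable_def)
  then have AEp: "AE t in ?M. v t = G t + d" by eventually_elim (simp add: p_def)
  define u where "u t = G t + d" for t
  have cu: "continuous_on {-T..T} u" unfolding u_def by (intro continuous_intros cG)
  have \<gamma>_int: "\<gamma> t = \<gamma> (-T) + integral {-T..t} u" if t: "t \<in> {-T..T}" for t
  proof -
    have iu: "integrable (lebesgue_on {-T..t}) u"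
      using t cu by (intro integrable_continuous_Icc) (auto intro: continuous_on_subset)
    have iv: "integrable (lebesgue_on {-T..t}) v"
      using t by (intro integrable_Icc_mono[OF primitive_on_integrable[OF H'[THEN conjunct2]]]) auto
    have "AE s in lebesgue_on {-T..t}. v s = u s"
      using AEp t by (auto simp: AE_restrict_space_iff u_def elim!: eventually_mono)
    then have "(LINT s|lebesgue_on {-T..t}. v s) = (LINT s|lebesgue_on {-T..t}. u s)"
      using iu iv by (intro integral_cong_AE) auto
    also have "\<dots> = integral {-T..t} u" using iu by (simp add: lebesgue_integral_eq_integral)
    finally show ?thesis
      using primitive_on_increment[OF H'[THEN conjunct2], of "-T" t] t by (simp add: algebra_simps)
  qed
  have der\<gamma>: "(\<gamma> has_vector_derivative u t) (at t within {-T..T})" if t: "t \<in> {-T..T}" for t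
  proof -
    have "((\<lambda>t. \<gamma> (-T) + integral {-T..t} u) has_vector_derivative 0 + u t) (at t within {-T..T})"
      by (intro has_vector_derivative_add has_vector_derivative_const integral_has_vector_derivative cu t)
    then show ?thesis
      unfolding add_0 by (rule has_vector_derivative_transform[OF t, rotated]) (rule \<gamma>_int)
  qed
  have u_int: "u t = d + integral {-T..t} acc" if t: "t \<in> {-T..T}" for t
  proof -
    have "integrable (lebesgue_on {-T..t}) acc"
      using t cacc by (intro integrable_continuous_Icc) (auto intro: continuous_on_subset)
    then show ?thesis by (simp add: u_def G_def lebesgue_integral_eq_integral)
  qed
  have deru: "(u has_vector_derivative acc t) (at t within {-T..T})" if t: "t \<in> {-T..T}" for t
  proof -
    have "((\<lambda>t. d + integral {-T..t} acc) has_vector_derivative 0 + acc t) (at t within {-T..T})"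
      by (intro has_vector_derivative_add has_vector_derivative_const integral_has_vector_derivative cacc t)
    then show ?thesis
      unfolding add_0 by (rule has_vector_derivative_transform[OF t, rotated]) (rule u_int)
  qed
  show ?thesis
    unfolding kepler_solution_def
  proof (intro conjI exI[of _ u] ballI impI)
    have "{t \<in> {-T..T}. \<gamma> t = 0} = {}" using nz by auto
    then show "negligible {t \<in> {-T..T}. \<gamma> t = 0}" by (metis negligible_empty)
  qed (use cg der\<gamma> deru[unfolded acc_def] in blast)+
qed

section \<open>Existence of minimizers without collision\<close>

lemma L2_norm_diff_commute: "L2_norm M (\<lambda>t. f t - g t) = L2_norm M (\<lambda>t. g t - f t)"
  by (simp add: L2_norm_def norm_minus_commute)

lemma L2_norm_reverse_triangle:
  assumes "sq_integrable M f" "sq_integrable M g"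
  shows "\<bar>L2_norm M f - L2_norm M g\<bar> \<le> L2_norm M (\<lambda>t. f t - g t)"
proof -
  have "L2_norm M f \<le> L2_norm M g + L2_norm M (\<lambda>t. f t - g t)"
    using L2_norm_triangle[OF assms(2) sq_integrable_diff[OF assms]] by simp
  moreover have "L2_norm M g \<le> L2_norm M f + L2_norm M (\<lambda>t. f t - g t)"
    using L2_norm_triangle[OF assms(1) sq_integrable_diff[OF assms(2,1)]] L2_norm_diff_commute[of M g f]
    by simp
  ultimately show ?thesis by linarith
qed

lemma L2_parallelogram:
  assumes "sq_integrable M f" "sq_integrable M g"
  shows "(L2_norm M (\<lambda>t. f t + g t))\<^sup>2 + (L2_norm M (\<lambda>t. f t - g t))\<^sup>2 =
    2 * (L2_norm M f)\<^sup>2 + 2 * (L2_norm M g)\<^sup>2"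
proof -
  have "(L2_norm M (\<lambda>t. f t - g t))\<^sup>2 = (L2_norm M f)\<^sup>2 - 2 * (LINT t|M. f t \<bullet> g t) + (L2_norm M g)\<^sup>2"
    using L2_norm_add_square[OF assms(1) sq_integrable_scaleR[OF assms(2), of "-1"]] L2_norm_scaleR[of M "-1" g]
    by simp
  then show ?thesis using L2_norm_add_square[OF assms] by simp
qed

lemma potential_integral_lipschitz:
  assumes "m > 0" "0 < \<alpha>" "0 < e" "T > 0" and x: "continuous_on {-T..T} x" and y: "continuous_on {-T..T} y"
    and xe: "\<And>t. t \<in> {-T..T} \<Longrightarrow> e \<le> norm (x t)" and ye: "\<And>t. t \<in> {-T..T} \<Longrightarrow> e \<le> norm (y t)"
    and \<delta>: "\<And>t. t \<in> {-T..T} \<Longrightarrow> norm (x t - y t) \<le> \<delta>"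
  shows "\<bar>(LINT t|lebesgue_on {-T..T}. potential \<alpha> m (x t)) - (LINT t|lebesgue_on {-T..T}. potential \<alpha> m (y t))\<bar>
    \<le> 2 * T * (m * e powr (- \<alpha> - 1) * \<delta>)"
proof -
  let ?M = "lebesgue_on {-T..T}"
  have nz: "x t \<noteq> 0" "y t \<noteq> 0" if "t \<in> {-T..T}" for t
    using xe[OF that] ye[OF that] \<open>0 < e\<close> by auto
  have i: "integrable ?M (\<lambda>t. potential \<alpha> m (x t))" "integrable ?M (\<lambda>t. potential \<alpha> m (y t))"
    using nz \<open>0 < \<alpha>\<close> by (auto intro!: integrable_continuous_Icc continuous_on_potential x y)
  have "\<bar>(LINT t|?M. potential \<alpha> m (x t)) - (LINT t|?M. potential \<alpha> m (y t))\<bar> =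
      \<bar>LINT t|?M. potential \<alpha> m (x t) - potential \<alpha> m (y t)\<bar>"
    using i by simp
  also have "\<dots> \<le> (LINT t|?M. \<bar>potential \<alpha> m (x t) - potential \<alpha> m (y t)\<bar>)"
    by (rule integral_abs_bound)
  also have "\<dots> \<le> (LINT t|?M. m * e powr (- \<alpha> - 1) * \<delta>)"
  proof (rule integral_mono)
    fix t assume "t \<in> space ?M"
    then have t: "t \<in> {-T..T}" by simp
    have "\<bar>potential \<alpha> m (x t) - potential \<alpha> m (y t)\<bar> \<le> m * e powr (- \<alpha> - 1) * norm (x t - y t)"
      using potential_lipschitz[OF assms(1-3) xe[OF t] ye[OF t]] .
    also have "\<dots> \<le> m * e powr (- \<alpha> - 1) * \<delta>"
      using \<delta>[OF t] assms by (intro mult_left_mono) auto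
    finally show "\<bar>potential \<alpha> m (x t) - potential \<alpha> m (y t)\<bar> \<le> m * e powr (- \<alpha> - 1) * \<delta>" .
  qed (use i in \<open>auto intro!: integrable_continuous_Icc\<close>)
  also have "\<dots> = 2 * T * (m * e powr (- \<alpha> - 1) * \<delta>)"
    using \<open>T > 0\<close> by (simp add: measure_restrict_space)
  finally show ?thesis .
qed

text \<open>
  The mean of two paths that are uniformly close is admissible, and its potential energy is close to
  theirs. By the parallelogram identity its kinetic energy is smaller than the mean of theirs by
  \<open>1/8\<close> of the square of the norm of \<open>v - w\<close>. If both actions are nearly minimal, this leaves no room for
  a large difference.
\<close>

lemma almost_minimizers_close:
  assumes "m > 0" "0 < \<alpha>" "T > 0" "0 < e"
    and x: "x \<in> Gamma_star \<alpha> m \<phi>m \<phi>p T" "has_H1_derivative T x v"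
    and y: "y \<in> Gamma_star \<alpha> m \<phi>m \<phi>p T" "has_H1_derivative T y w"
    and c: "\<And>z. z \<in> Gamma_star \<alpha> m \<phi>m \<phi>p T \<Longrightarrow> ennreal c \<le> action \<alpha> m T z"
    and xe: "\<And>t. t \<in> {-T..T} \<Longrightarrow> e \<le> norm (x t)" and ye: "\<And>t. t \<in> {-T..T} \<Longrightarrow> e \<le> norm (y t)"
    and \<delta>: "\<And>t. t \<in> {-T..T} \<Longrightarrow> norm (x t - y t) \<le> \<delta>" "\<delta> \<le> e"
    and A: "action \<alpha> m T x \<le> ennreal (c + \<delta>)" "action \<alpha> m T y \<le> ennreal (c + \<delta>)" and "0 \<le> c" "0 \<le> \<delta>"
  shows "(L2_norm (lebesgue_on {-T..T}) (\<lambda>t. v t - w t))\<^sup>2 \<le> (8 + 16 * T * (m * (e/2) powr (- \<alpha> - 1))) * \<delta>"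
proof -
  let ?M = "lebesgue_on {-T..T}" and ?L = "m * (e/2) powr (- \<alpha> - 1)"
  let ?U = "\<lambda>x. LINT t|?M. potential \<alpha> m (x t)"
  note x' = x(2)[unfolded has_H1_derivative_iff] and y' = y(2)[unfolded has_H1_derivative_iff]
  define z where "z t = (1/2) *\<^sub>R (x t + y t)" for t
  have vw: "sq_integrable ?M (\<lambda>t. v t + w t)" using x' y' by (intro sq_integrable_add) auto
  have z: "has_H1_derivative T z (\<lambda>t. (1/2) *\<^sub>R (v t + w t))"
    unfolding has_H1_derivative_iff z_def
    using x' y' by (intro conjI sq_integrable_scaleR vw primitive_on_scaleR primitive_on_add) auto
  have zx: "norm (z t - x t) = norm (x t - y t) / 2" and zy: "norm (z t - y t) = norm (x t - y t) / 2" for t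
  proof -
    have "z t - x t = (1/2) *\<^sub>R (y t - x t)" "z t - y t = (1/2) *\<^sub>R (x t - y t)"
      by (simp_all add: z_def complex_eq_iff)
    then show "norm (z t - x t) = norm (x t - y t) / 2" "norm (z t - y t) = norm (x t - y t) / 2"
      by (simp_all add: norm_minus_commute)
  qed
  have ze: "e / 2 \<le> norm (z t)" if "t \<in> {-T..T}" for t
    using norm_triangle_ineq2[of "x t" "x t - z t"] zx[of t] \<delta>(1)[OF that] \<delta>(2) xe[OF that]
    by (simp add: norm_minus_commute)
  have zG: "z \<in> Gamma_star \<alpha> m \<phi>m \<phi>p T"
  proof (rule Gamma_star_perturb[OF x(1) H1I[OF z] _ _ _ \<open>T > 0\<close>])
    have "x (-T) = y (-T)" "x T = y T" using x(1) y(1) by (auto simp: Gamma_star_def)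
    then show "z (-T) = x (-T)" "z T = x T" by (auto simp: z_def complex_eq_iff)
    fix t assume t: "t \<in> {-T..T}"
    show "norm (z t - x t) < norm (x t)"
      using zx[of t] \<delta>(1)[OF t] \<delta>(2) xe[OF t] \<open>0 < e\<close> by simp
  qed
  have real: "action \<alpha> m T q = ennreal ((L2_norm ?M q')\<^sup>2 / 2 + ?U q)"
    if "q \<in> Gamma_star \<alpha> m \<phi>m \<phi>p T" "has_H1_derivative T q q'" for q q'
    using that by (intro action_eq_real assms(1,2)) (auto simp: Gamma_star_def)
  have U0: "0 \<le> ?U q" for q
    using potential_nonneg[OF assms(1,2)] by (intro Bochner_Integration.integral_nonneg) auto
  have Ax: "(L2_norm ?M v)\<^sup>2 / 2 + ?U x \<le> c + \<delta>" and Ay: "(L2_norm ?M w)\<^sup>2 / 2 + ?U y \<le> c + \<delta>"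
    using A \<open>0 \<le> c\<close> \<open>0 \<le> \<delta>\<close> unfolding real[OF x] real[OF y] by (simp_all add: ennreal_le_iff del: ennreal_plus)
  have Az: "c \<le> (L2_norm ?M (\<lambda>t. (1/2) *\<^sub>R (v t + w t)))\<^sup>2 / 2 + ?U z"
    using c[OF zG] U0[of z] unfolding real[OF zG z] by (simp add: ennreal_le_iff del: ennreal_plus)
  have half: "norm (z t - x t) \<le> \<delta>" "norm (z t - y t) \<le> \<delta>" "e / 2 \<le> norm (x t)" "e / 2 \<le> norm (y t)" if "t \<in> {-T..T}" for t
    using \<delta>(1)[OF that] xe[OF that] ye[OF that] zx[of t] zy[of t] \<open>0 < e\<close> \<open>0 \<le> \<delta>\<close> by linarith+
  have Ux: "\<bar>?U z - ?U x\<bar> \<le> 2 * T * (?L * \<delta>)"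
    by (rule potential_integral_lipschitz[OF assms(1,2) _ assms(3) H1_continuous[OF z] H1_continuous[OF x(2)]])
      (use \<open>0 < e\<close> ze half in auto)
  have Uy: "\<bar>?U z - ?U y\<bar> \<le> 2 * T * (?L * \<delta>)"
    by (rule potential_integral_lipschitz[OF assms(1,2) _ assms(3) H1_continuous[OF z] H1_continuous[OF y(2)]])
      (use \<open>0 < e\<close> ze half in auto)
  have "(L2_norm ?M (\<lambda>t. (1/2) *\<^sub>R (v t + w t)))\<^sup>2 = (L2_norm ?M (\<lambda>t. v t + w t))\<^sup>2 / 4"
    by (simp add: L2_norm_scaleR power_divide)
  then have "(L2_norm ?M (\<lambda>t. v t - w t))\<^sup>2 \<le> 8 * \<delta> + 8 * (2 * T * (?L * \<delta>))"
    using Az Ux Uy Ax Ay L2_parallelogram[OF x'[THEN conjunct1] y'[THEN conjunct1]] unfolding abs_le_iff by linarith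
  then show ?thesis by (simp add: algebra_simps)
qed

text \<open>
  Paths of small action stay off the origin by the hypothesis \<open>far\<close>. The theorem of Arzela and Ascoli
  gives a uniformly convergent minimizing sequence; by the preceding lemma its derivatives form a Cauchy
  sequence in \<open>L\<^sup>2\<close>. Both parts of the action therefore converge, and the limit attains the infimum.
\<close>

lemma minimizer_exists:
  assumes "m > 0" "0 < \<alpha>" "T > 0" "0 < e"
    and far: "\<And>x t. x \<in> Gamma_star \<alpha> m \<phi>m \<phi>p T \<Longrightarrow> action \<alpha> m T x \<le> ennreal A1 \<Longrightarrow> t \<in> {-T..T} \<Longrightarrow> e \<le> norm (x t)"
    and x0: "x0 \<in> Gamma_star \<alpha> m \<phi>m \<phi>p T" "action \<alpha> m T x0 < ennreal A1"
  shows "\<exists>\<gamma>\<in>Gamma_star \<alpha> m \<phi>m \<phi>p T. \<forall>x\<in>Gamma_star \<alpha> m \<phi>m \<phi>p T. action \<alpha> m T \<gamma> \<le> action \<alpha> m T x"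
proof -
  let ?G = "Gamma_star \<alpha> m \<phi>m \<phi>p T" and ?M = "lebesgue_on {-T..T}"
  let ?U = "\<lambda>x. LINT t|?M. potential \<alpha> m (x t)"
  define A where "A x = (L2_norm ?M (H1_deriv T x))\<^sup>2 / 2 + ?U x" for x
  have U0: "0 \<le> ?U q" for q
    using potential_nonneg[OF assms(1,2)] by (intro Bochner_Integration.integral_nonneg) auto
  have A0: "0 \<le> A x" for x using U0 by (simp add: A_def)
  have der: "has_H1_derivative T x (H1_deriv T x)" if "x \<in> ?G" for x
    using that by (auto simp: Gamma_star_def intro: has_H1_derivative_H1_deriv)
  have act: "action \<alpha> m T x = ennreal (A x)" if "x \<in> ?G" for x
    unfolding A_def using that by (intro action_eq_real assms(1,2) der) (auto simp: Gamma_star_def)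
  define c where "c = Inf (A ` ?G)"
  have bdd: "bdd_below (A ` ?G)" using A0 by (auto simp: bdd_below_def)
  have cA: "c \<le> A x" if "x \<in> ?G" for x
    unfolding c_def using that by (intro cInf_lower bdd) auto
  have c0: "0 \<le> c"
    unfolding c_def using x0(1) A0 by (intro cInf_greatest) auto
  have "A x0 < A1" using x0 act A0[of x0] by (auto simp: ennreal_less_iff)
  then have cA1: "c < A1" using cA[OF x0(1)] by simp
  have "\<exists>x\<in>?G. A x < min A1 (c + 1 / real (Suc n))" for n
  proof -
    have "Inf (A ` ?G) < min A1 (c + 1 / real (Suc n))"
      using cA1 by (auto simp flip: c_def)
    from cInf_lessD[OF _ this] show ?thesis using x0(1) by blast
  qed
  then obtain X where X: "\<And>n. X n \<in> ?G" "\<And>n. A (X n) < A1" "\<And>n. A (X n) < c + 1 / real (Suc n)"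
    by (metis min_less_iff_conj)
  define V where "V n = H1_deriv T (X n)" for n
  have XV: "has_H1_derivative T (X n) (V n)" for n unfolding V_def by (rule der[OF X(1)])
  have far': "e \<le> norm (X n t)" if "t \<in> {-T..T}" for n t
    using far[OF X(1) _ that] act[OF X(1)] X(2)[of n] by (simp add: ennreal_leI)
  define B where "B = sqrt (2 * A1)"
  have B0: "0 \<le> B" using cA1 c0 by (simp add: B_def)
  have V_norm: "L2_norm ?M (V n) \<le> B" for n
    using X(2)[of n] U0[of "X n"] unfolding B_def A_def V_def by (intro real_le_rsqrt) simp
  have hold: "norm (X n t - X n s) \<le> B * sqrt \<bar>t - s\<bar>" if "s \<in> {-T..T}" "t \<in> {-T..T}" for n s t
  proof -
    have *: "norm (X n t - X n s) \<le> B * sqrt (t - s)" if "-T \<le> s" "s \<le> t" "t \<le> T" for s t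
      using order_trans[OF H1_holder[OF XV that] mult_right_mono[OF V_norm]] that by simp
    show ?thesis
      using *[of s t] *[of t s] that by (cases "s \<le> t") (auto simp: norm_minus_commute)
  qed
  have ends: "X n (-T) = xbar \<alpha> m \<phi>m \<phi>p (-T)" "X n T = xbar \<alpha> m \<phi>m \<phi>p T" for n
    using X(1)[of n] by (auto simp: Gamma_star_def)
  obtain g k where g: "continuous_on {-T..T} g" and k: "strict_mono (k :: nat \<Rightarrow> nat)"
    and unif: "\<And>e. 0 < e \<Longrightarrow> \<exists>N. \<forall>n t. n \<ge> N \<and> t \<in> {-T..T} \<longrightarrow> norm (X (k n) t - g t) < e"
  proof (rule Arzela_Ascoli[of "{-T..T}" X "norm (xbar \<alpha> m \<phi>m \<phi>p (-T)) + B * sqrt (2 * T)"])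
    fix n t assume t: "t \<in> {-T..T}"
    have "norm (X n t - X n (-T)) \<le> B * sqrt \<bar>t - -T\<bar>"
      using hold[of "-T" t n] t by simp
    also have "\<dots> \<le> B * sqrt (2 * T)" using B0 t by (intro mult_left_mono) auto
    finally show "norm (X n t) \<le> norm (xbar \<alpha> m \<phi>m \<phi>p (-T)) + B * sqrt (2 * T)"
      using norm_triangle_ineq2[of "X n t" "X n (-T)"] ends(1)[of n] by simp
  next
    fix s \<epsilon> :: real assume s: "s \<in> {-T..T}" and "0 < \<epsilon>"
    show "\<exists>d. 0 < d \<and> (\<forall>n t. t \<in> {-T..T} \<and> norm (s - t) < d \<longrightarrow> norm (X n s - X n t) < \<epsilon>)"
    proof (intro exI conjI allI impI)
      show "0 < (\<epsilon> / (B + 1))\<^sup>2" using \<open>0 < \<epsilon>\<close> B0 by simp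
      fix n t assume t: "t \<in> {-T..T} \<and> norm (s - t) < (\<epsilon> / (B + 1))\<^sup>2"
      have "norm (X n s - X n t) \<le> B * sqrt \<bar>s - t\<bar>" using hold[of t s n] s t by simp
      also have "\<dots> \<le> B * (\<epsilon> / (B + 1))"
        using t B0 \<open>0 < \<epsilon>\<close> by (intro mult_left_mono real_le_lsqrt) auto
      also have "\<dots> < \<epsilon>" using B0 \<open>0 < \<epsilon>\<close> by (simp add: field_simps)
      finally show "norm (X n s - X n t) < \<epsilon>" .
    qed
  qed auto
  define Y where "Y n = X (k n)" for n
  define W where "W n = V (k n)" for n
  have Y: "Y n \<in> ?G" and YW: "has_H1_derivative T (Y n) (W n)" for n
    by (simp_all add: Y_def W_def X XV)
  have Ye: "e \<le> norm (Y n t)" if "t \<in> {-T..T}" for n t using far'[OF that] by (simp add: Y_def)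
  have W_sq: "sq_integrable ?M (W n)" for n using YW[of n] by (simp add: has_H1_derivative_iff)
  have AY: "A (Y n) = (L2_norm ?M (W n))\<^sup>2 / 2 + ?U (Y n)" for n by (simp add: A_def Y_def W_def V_def)
  have A_lim: "(\<lambda>n. A (Y n)) \<longlonglongrightarrow> c"
  proof (rule tendsto_sandwich[of "\<lambda>_. c" _ _ "\<lambda>n. c + 1 / real (Suc n)"])
    have "A (Y n) \<le> c + 1 / real (Suc n)" for n
    proof -
      have "A (Y n) \<le> c + 1 / real (Suc (k n))" using X(3)[of "k n"] by (simp add: Y_def)
      also have "\<dots> \<le> c + 1 / real (Suc n)"
        using seq_suble[OF k, of n] by (simp add: frac_le)
      finally show ?thesis .
    qed
    then show "\<forall>\<^sub>F n in sequentially. A (Y n) \<le> c + 1 / real (Suc n)" by simp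
    have "(\<lambda>n. c + 1 / real (Suc n)) \<longlonglongrightarrow> c + 0"
      by (intro tendsto_intros LIMSEQ_Suc[OF lim_1_over_n])
    then show "(\<lambda>n. c + 1 / real (Suc n)) \<longlonglongrightarrow> c" by simp
  qed (auto simp: cA Y)
  have ge: "e \<le> norm (g t)" if t: "t \<in> {-T..T}" for t
  proof (rule tendsto_lowerbound)
    show "(\<lambda>n. norm (Y n t)) \<longlonglongrightarrow> norm (g t)"
    proof (intro tendsto_norm LIMSEQ_I)
      fix r :: real assume "0 < r"
      then show "\<exists>N. \<forall>n\<ge>N. norm (Y n t - g t) < r" using unif[of r] t by (auto simp: Y_def)
    qed
  qed (use Ye t in auto)
  define Kc where "Kc = 8 + 16 * T * (m * (e/2) powr (- \<alpha> - 1))"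
  have Kc: "Kc > 0" using assms by (auto simp: Kc_def intro!: add_pos_nonneg)
  have cauchy: "\<exists>N. \<forall>n\<ge>N. \<forall>n'\<ge>N. L2_norm ?M (\<lambda>t. W n t - W n' t) \<le> r" if "0 < r" for r
  proof -
    define \<delta> where "\<delta> = min e (r\<^sup>2 / Kc)"
    have \<delta>: "0 < \<delta>" "\<delta> \<le> e" "Kc * \<delta> \<le> r\<^sup>2"
      using \<open>0 < e\<close> \<open>0 < r\<close> Kc by (auto simp: \<delta>_def min_def field_simps)
    obtain N1 where N1: "\<And>n t. n \<ge> N1 \<Longrightarrow> t \<in> {-T..T} \<Longrightarrow> norm (Y n t - g t) < \<delta> / 2"
      using unif[of "\<delta> / 2"] \<delta>(1) by (auto simp: Y_def)
    have "\<forall>\<^sub>F n in sequentially. A (Y n) < c + \<delta>"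
      using order_tendstoD(2)[OF A_lim] \<delta>(1) by simp
    then obtain N2 where N2: "\<And>n. n \<ge> N2 \<Longrightarrow> A (Y n) < c + \<delta>" by (auto simp: eventually_sequentially)
    have "L2_norm ?M (\<lambda>t. W n t - W n' t) \<le> r" if n: "n \<ge> max N1 N2" "n' \<ge> max N1 N2" for n n'
    proof -
      have "(L2_norm ?M (\<lambda>t. W n t - W n' t))\<^sup>2 \<le> Kc * \<delta>"
        unfolding Kc_def
      proof (rule almost_minimizers_close[OF assms(1-4) Y YW Y YW _ Ye Ye])
        show "ennreal c \<le> action \<alpha> m T z" if "z \<in> ?G" for z
          using act[OF that] cA[OF that] by (simp add: ennreal_leI)
        show "norm (Y n t - Y n' t) \<le> \<delta>" if t: "t \<in> {-T..T}" for t
          using N1[OF _ t, of n] N1[OF _ t, of n'] n norm_triangle_ineq4[of "Y n t - g t" "Y n' t - g t"] by simp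
        show "action \<alpha> m T (Y n) \<le> ennreal (c + \<delta>)" "action \<alpha> m T (Y n') \<le> ennreal (c + \<delta>)"
          using act[OF Y] N2[of n] N2[of n'] n by (auto intro!: ennreal_leI simp del: ennreal_plus)
      qed (use \<delta> c0 in auto)
      also have "\<dots> \<le> r\<^sup>2" by (rule \<delta>(3))
      finally show ?thesis by (rule power2_le_imp_le[OF _ less_imp_le[OF \<open>0 < r\<close>]])
    qed
    then show ?thesis by blast
  qed
  have "\<exists>N. \<forall>n\<ge>N. \<forall>n'\<ge>N. L2_norm ?M (\<lambda>t. W n t - W n' t) \<le> (1/4) ^ j" for j :: nat
    by (rule cauchy) simp
  then obtain N where N: "\<And>j n n'. n \<ge> N j \<Longrightarrow> n' \<ge> N j \<Longrightarrow> L2_norm ?M (\<lambda>t. W n t - W n' t) \<le> (1/4) ^ j"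
    by metis
  \<comment> \<open>A strictly increasing choice of indices with \<open>i j \<ge> N j\<close>, so that consecutive derivatives differ
    by at most \<open>(1/4)^j\<close>.\<close>
  define i where "i j = (\<Sum>l\<le>j. N l) + j" for j
  have i: "N j \<le> i j" "i j < i (Suc j)" for j
  proof -
    show "N j \<le> i j" using member_le_sum[of j "{..j}" N] by (simp add: i_def)
  qed (simp add: i_def)
  have i_mono: "strict_mono i" using i(2) by (simp add: strict_mono_Suc_iff)
  define u where "u j t = W (i (Suc j)) t - W (i j) t" for j t
  have u: "sq_integrable ?M (u j)" for j unfolding u_def by (intro sq_integrable_diff W_sq)
  have u_norm: "L2_norm ?M (u j) \<le> 1 * (1/4) ^ j" for j
    unfolding u_def using N[of j "i (Suc j)" "i j"] i[of j] by simp
  obtain w where w: "sq_integrable ?M w" "\<And>n. L2_norm ?M (\<lambda>t. w t - (\<Sum>j<n. u j t)) \<le> 1 * (4/3) * (1/4) ^ n"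
    by (rule L2_series[of ?M u 1, OF u u_norm]) auto
  define v where "v t = W (i 0) t + w t" for t
  have v_sq: "sq_integrable ?M v" unfolding v_def by (intro sq_integrable_add W_sq w)
  have v_diff: "v t - W (i n) t = w t - (\<Sum>j<n. u j t)" for n t
    using sum_lessThan_telescope[of "\<lambda>j. W (i j) t" n] by (simp add: v_def u_def)
  have v_lim: "(\<lambda>n. L2_norm ?M (\<lambda>t. v t - W (i n) t)) \<longlonglongrightarrow> 0"
  proof (rule tendsto_sandwich[of "\<lambda>_. 0" _ _ "\<lambda>n. 1 * (4/3) * (1/4) ^ n"])
    have "(\<lambda>n. 1 * (4/3) * (1/4) ^ n) \<longlonglongrightarrow> 1 * (4/3) * (0::real)"
      by (intro tendsto_mult tendsto_const LIMSEQ_power_zero) simp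
    then show "(\<lambda>n. 1 * (4/3) * (1/4) ^ n) \<longlonglongrightarrow> (0::real)" by simp
  qed (use w(2) in \<open>simp_all add: v_diff\<close>)
  have Y_lim: "(\<lambda>n. Y (i n) t) \<longlonglongrightarrow> g t" if t: "t \<in> {-T..T}" for t
  proof (rule LIMSEQ_I)
    fix r :: real assume "0 < r"
    then obtain N' where "\<forall>n t. n \<ge> N' \<and> t \<in> {-T..T} \<longrightarrow> norm (Y n t - g t) < r"
      using unif[of r] by (auto simp: Y_def)
    then show "\<exists>N. \<forall>n\<ge>N. norm (Y (i n) t - g t) < r"
      using seq_suble[OF i_mono] t by (meson order_trans)
  qed
  have g_der: "has_H1_derivative T g v"
    unfolding has_H1_derivative_iff
  proof (intro conjI v_sq primitive_onI sq_integrable_imp_integrable_Icc)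
    fix t assume t: "-T \<le> t" "t \<le> T"
    let ?I = "\<lambda>f. LINT s|lebesgue_on {-T..t}. f s"
    have int: "integrable (lebesgue_on {-T..t}) f" if "sq_integrable ?M f" for f :: "real \<Rightarrow> complex"
      using t by (intro integrable_Icc_mono[OF sq_integrable_imp_integrable_Icc[OF that]]) auto
    have inc: "norm (?I v - (Y (i n) t - Y (i n) (-T))) \<le> L2_norm ?M (\<lambda>t. v t - W (i n) t) * sqrt (2 * T)" for n
    proof -
      have d: "sq_integrable ?M (\<lambda>t. v t - W (i n) t)" by (intro sq_integrable_diff v_sq W_sq)
      note pd = primitive_on_indefinite[OF sq_integrable_imp_integrable_Icc[OF d]]
      have "?I v - (Y (i n) t - Y (i n) (-T)) = ?I (\<lambda>s. v s - W (i n) s)"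
        using primitive_on_increment[OF YW[of "i n", unfolded has_H1_derivative_iff, THEN conjunct2], of "-T" t] t
          int[OF v_sq] int[OF W_sq] by simp
      also have "\<dots> = ?I (\<lambda>s. v s - W (i n) s) - (LINT s|lebesgue_on {-T..-T}. v s - W (i n) s)"
        using has_bochner_integral_null[of "{-T..-T}" "\<lambda>s. v s - W (i n) s"] by (auto simp: has_bochner_integral_iff)
      also have "norm \<dots> \<le> L2_norm ?M (\<lambda>t. v t - W (i n) t) * sqrt (t - -T)"
        using d pd t by (intro H1_holder) (auto simp: has_H1_derivative_iff)
      also have "\<dots> \<le> L2_norm ?M (\<lambda>t. v t - W (i n) t) * sqrt (2 * T)"
        using t by (intro mult_left_mono) auto
      finally show ?thesis .
    qed
    have "(\<lambda>n. L2_norm ?M (\<lambda>t. v t - W (i n) t) * sqrt (2 * T)) \<longlonglongrightarrow> 0 * sqrt (2 * T)"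
      by (intro tendsto_intros v_lim)
    then have bound_lim: "(\<lambda>n. L2_norm ?M (\<lambda>t. v t - W (i n) t) * sqrt (2 * T)) \<longlonglongrightarrow> 0" by simp
    have "(\<lambda>n. ?I v - (Y (i n) t - Y (i n) (-T))) \<longlonglongrightarrow> 0"
      by (rule Lim_null_comparison[OF _ bound_lim]) (rule always_eventually, rule allI, rule inc)
    moreover have "(\<lambda>n. ?I v - (Y (i n) t - Y (i n) (-T))) \<longlonglongrightarrow> ?I v - (g t - g (-T))"
      using t \<open>T > 0\<close> by (intro tendsto_diff tendsto_const Y_lim) auto
    ultimately have "?I v - (g t - g (-T)) = 0" by (rule LIMSEQ_unique[rotated])
    then show "g t - g (-T) = ?I v" by simp
  qed
  have g_ends: "g (-T) = xbar \<alpha> m \<phi>m \<phi>p (-T)" "g T = xbar \<alpha> m \<phi>m \<phi>p T"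
    using Y_lim[of "-T"] Y_lim[of T] ends \<open>T > 0\<close> by (auto simp: Y_def LIMSEQ_const_iff)
  have g_in: "g \<in> ?G"
  proof -
    obtain n where n: "\<And>t. t \<in> {-T..T} \<Longrightarrow> norm (Y n t - g t) < e"
      using unif[OF \<open>0 < e\<close>] by (auto simp: Y_def)
    show ?thesis
    proof (rule Gamma_star_perturb[OF Y[of n] H1I[OF g_der] _ _ _ \<open>T > 0\<close>])
      fix t assume t: "t \<in> {-T..T}"
      show "norm (g t - Y n t) < norm (Y n t)"
        using n[OF t] Ye[OF t, of n] by (simp add: norm_minus_commute)
    qed (simp_all add: g_ends Y_def ends)
  qed
  have "(\<lambda>n. A (Y (i n))) \<longlonglongrightarrow> (L2_norm ?M v)\<^sup>2 / 2 + ?U g"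
    unfolding AY
  proof (intro tendsto_intros)
    show "(\<lambda>n. L2_norm ?M (W (i n))) \<longlonglongrightarrow> L2_norm ?M v"
    proof (rule LIM_zero_cancel, rule tendsto_rabs_zero_cancel, rule tendsto_sandwich[OF _ _ tendsto_const v_lim])
      show "\<forall>\<^sub>F n in sequentially. \<bar>L2_norm ?M (W (i n)) - L2_norm ?M v\<bar> \<le> L2_norm ?M (\<lambda>t. v t - W (i n) t)"
        using L2_norm_reverse_triangle[OF v_sq W_sq] by (simp add: abs_minus_commute)
    qed simp
    show "(\<lambda>n. ?U (Y (i n))) \<longlonglongrightarrow> ?U g"
    proof (rule LIMSEQ_I)
      fix r :: real assume "0 < r"
      let ?K = "2 * T * (m * e powr (- \<alpha> - 1))"
      have K: "?K > 0" using assms by simp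
      then obtain N' where N': "\<And>n t. n \<ge> N' \<Longrightarrow> t \<in> {-T..T} \<Longrightarrow> norm (Y n t - g t) < r / (2 * ?K)"
        using unif[of "r / (2 * ?K)"] \<open>0 < r\<close> by (auto simp: Y_def)
      have "norm (?U (Y (i n)) - ?U g) < r" if "n \<ge> N'" for n
      proof -
        have "i n \<ge> N'" using seq_suble[OF i_mono, of n] that by simp
        then have "\<bar>?U (Y (i n)) - ?U g\<bar> \<le> 2 * T * (m * e powr (- \<alpha> - 1) * (r / (2 * ?K)))"
          using N' by (intro potential_integral_lipschitz assms(1-4) H1_continuous[OF YW] g Ye ge) (auto intro: less_imp_le)
        also have "\<dots> = ?K * (r / (2 * ?K))" by simp
        also have "\<dots> = r / 2"
        proof -
          have "\<And>a b :: real. a > 0 \<Longrightarrow> a * (b / (2 * a)) = b / 2" by simp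
          then show ?thesis using K by blast
        qed
        also have "\<dots> < r" using \<open>0 < r\<close> by simp
        finally show ?thesis by simp
      qed
      then show "\<exists>N. \<forall>n\<ge>N. norm (?U (Y (i n)) - ?U g) < r" by blast
    qed
  qed auto
  moreover have "(\<lambda>n. A (Y (i n))) \<longlonglongrightarrow> c"
    using LIMSEQ_subseq_LIMSEQ[OF A_lim i_mono] by (simp add: o_def)
  ultimately have "(L2_norm ?M v)\<^sup>2 / 2 + ?U g = c" by (rule LIMSEQ_unique)
  moreover have "action \<alpha> m T g = ennreal ((L2_norm ?M v)\<^sup>2 / 2 + ?U g)"
    using g_in by (intro action_eq_real assms(1,2) g_der) (auto simp: Gamma_star_def)
  ultimately have "action \<alpha> m T g = ennreal c" by simp
  then have "\<forall>x\<in>?G. action \<alpha> m T g \<le> action \<alpha> m T x"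
    using act cA by (auto intro: ennreal_leI)
  then show ?thesis using g_in by blast
qed

section \<open>The parabolic collision-ejection solution\<close>

lemma abs_powr_integral:
  fixes p T :: real
  assumes "-1 < p" "0 \<le> T"
  shows "integrable (lebesgue_on {-T..T}) (\<lambda>t. \<bar>t\<bar> powr p)"
    "(LINT t|lebesgue_on {-T..T}. \<bar>t\<bar> powr p) = 2 * (T powr (p + 1) / (p + 1))"
proof -
  let ?c = "T powr (p + 1) / (p + 1)"
  have pos: "((\<lambda>t. \<bar>t\<bar> powr p) has_integral ?c) {0..T}"
    using has_integral_powr_from_0[OF assms] by (rule has_integral_eq[rotated]) simp
  have "((\<lambda>t. \<bar>-t\<bar> powr p) has_integral ?c) {-T..-0}"
    using pos by (subst has_integral_reflect_real)
  then have neg: "((\<lambda>t. \<bar>t\<bar> powr p) has_integral ?c) {-T..0}" by simp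
  have all: "((\<lambda>t. \<bar>t\<bar> powr p) has_integral ?c + ?c) {-T..T}"
    by (rule has_integral_combine[OF _ _ neg pos]) (use assms in auto)
  then have "(\<lambda>t. \<bar>t\<bar> powr p) absolutely_integrable_on {-T..T}"
    by (intro nonnegative_absolutely_integrable_1) (auto simp: integrable_on_def)
  then show i: "integrable (lebesgue_on {-T..T}) (\<lambda>t. \<bar>t\<bar> powr p)"
    by (rule absolutely_integrable_imp_integrable) simp
  show "(LINT t|lebesgue_on {-T..T}. \<bar>t\<bar> powr p) = 2 * ?c"
    using i all by (simp add: lebesgue_integral_eq_integral integral_unique)
qed

lemma borel_measurable_lebesgue_on:
  fixes f :: "real \<Rightarrow> 'b::euclidean_space"
  assumes "f \<in> borel_measurable borel"
  shows "f \<in> borel_measurable (lebesgue_on S)"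
proof (rule measurable_restrict_space1)
  have "f \<in> borel_measurable lborel" using assms by simp
  then show "f \<in> borel_measurable lebesgue" by (rule measurable_completion)
qed

lemma AE_nonzero: "AE t in lebesgue_on S. t \<noteq> (0::real)" if "S \<in> sets lebesgue"
proof -
  have "AE t in lebesgue. t \<notin> {0::real}" by (rule AE_not_in) simp
  then show ?thesis using that by (auto simp: AE_restrict_space_iff elim: eventually_mono)
qed

lemma sq_integrable_powr_bound:
  fixes f :: "real \<Rightarrow> 'b::euclidean_space"
  assumes "0 \<le> T" "f \<in> borel_measurable borel" "-1 < 2 * p"
    and bound: "\<And>t. t \<noteq> 0 \<Longrightarrow> norm (f t) \<le> C * \<bar>t\<bar> powr p"
  shows "sq_integrable (lebesgue_on {-T..T}) f"
proof -
  have f: "f \<in> borel_measurable (lebesgue_on {-T..T})" by (rule borel_measurable_lebesgue_on[OF assms(2)])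
  have "integrable (lebesgue_on {-T..T}) (\<lambda>t. (norm (f t))\<^sup>2)"
  proof (rule Bochner_Integration.integrable_bound)
    show "integrable (lebesgue_on {-T..T}) (\<lambda>t. C\<^sup>2 * \<bar>t\<bar> powr (2 * p))"
      using abs_powr_integral(1)[of "2 * p" T] assms by simp
    have "(norm (f t))\<^sup>2 \<le> C\<^sup>2 * \<bar>t\<bar> powr (2 * p)" if "t \<noteq> 0" for t
    proof -
      have "(norm (f t))\<^sup>2 \<le> (C * \<bar>t\<bar> powr p)\<^sup>2"
        using bound[OF that] by (intro power_mono) auto
      also have "\<dots> = C\<^sup>2 * \<bar>t\<bar> powr (2 * p)"
        by (simp add: power_mult_distrib) (simp add: power2_eq_square flip: powr_add)
      finally show ?thesis .
    qed
    then show "AE t in lebesgue_on {-T..T}. norm ((norm (f t))\<^sup>2) \<le> norm (C\<^sup>2 * \<bar>t\<bar> powr (2 * p))"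
      using AE_nonzero[of "{-T..T}"] by (auto elim!: eventually_mono)
  qed (use f in measurable)
  with f show ?thesis by (simp add: sq_integrable_def)
qed

lemma DERIV_abs_powr:
  fixes t p :: real
  assumes "t \<noteq> 0"
  shows "((\<lambda>s. \<bar>s\<bar> powr p) has_real_derivative p * (sgn t * \<bar>t\<bar> powr (p - 1))) (at t)"
proof (cases "t > 0")
  case True
  have "((\<lambda>s. s powr p) has_real_derivative p * t powr (p - 1)) (at t)"
    by (rule has_real_derivative_powr[OF True])
  then have "((\<lambda>s. \<bar>s\<bar> powr p) has_real_derivative p * t powr (p - 1)) (at t)"
    by (rule has_field_derivative_transform_within_open[of _ _ _ "{0<..}"]) (use True in auto)
  then show ?thesis using True by simp
next
  case False
  have "((\<lambda>s. (- s) powr p) has_real_derivative (p * (- t) powr (p - 1)) * (-1)) (at t)"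
    by (rule DERIV_chain2[OF has_real_derivative_powr]) (use False assms in \<open>auto intro!: derivative_eq_intros\<close>)
  then have "((\<lambda>s. \<bar>s\<bar> powr p) has_real_derivative (p * (- t) powr (p - 1)) * (-1)) (at t)"
    by (rule has_field_derivative_transform_within_open[of _ _ _ "{..<0}"]) (use False assms in auto)
  then show ?thesis using False assms by simp
qed

lemma DERIV_sgn_abs_powr:
  fixes t p :: real
  assumes "t \<noteq> 0"
  shows "((\<lambda>s. sgn s * \<bar>s\<bar> powr p) has_real_derivative p * \<bar>t\<bar> powr (p - 1)) (at t)"
proof -
  define S where "S = (if t > 0 then {0<..} else {..<0::real})"
  have S: "open S" "t \<in> S" "\<And>s. s \<in> S \<Longrightarrow> sgn s = sgn t" using assms by (auto simp: S_def split: if_splits)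
  have "((\<lambda>s. sgn t * \<bar>s\<bar> powr p) has_real_derivative sgn t * (p * (sgn t * \<bar>t\<bar> powr (p - 1)))) (at t)"
    by (intro DERIV_cmult DERIV_abs_powr assms)
  then have "((\<lambda>s. sgn s * \<bar>s\<bar> powr p) has_real_derivative sgn t * (p * (sgn t * \<bar>t\<bar> powr (p - 1)))) (at t)"
    by (rule has_field_derivative_transform_within_open[OF _ S(1,2)]) (simp add: S(3))
  moreover have "sgn t * (p * (sgn t * \<bar>t\<bar> powr (p - 1))) = p * \<bar>t\<bar> powr (p - 1)"
    using assms by (simp add: sgn_if)
  ultimately show ?thesis by simp
qed

definition xbar_velocity :: "real \<Rightarrow> real \<Rightarrow> real \<Rightarrow> real \<Rightarrow> real \<Rightarrow> complex" where
  "xbar_velocity \<alpha> m \<phi>m \<phi>p t =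
     of_real (2 / (\<alpha> + 2) * parabolic_mu \<alpha> m powr (2 / (\<alpha> + 2)) * (sgn t * \<bar>t\<bar> powr (2 / (\<alpha> + 2) - 1))) *
     cis (if t \<ge> 0 then \<phi>p else \<phi>m)"

text \<open>
  The collision-ejection solution has modulus \<open>(\<mu> |t|)^a\<close>. The condition \<open>-1 < 2 * (a - 1)\<close>, which makes its
  velocity square integrable at the collision, expresses that \<open>\<alpha> < 2\<close>.
\<close>

context
  fixes \<alpha> m \<mu> a :: real
  assumes params: "m > 0" "0 < \<alpha>" "\<alpha> < 2"
  defines "\<mu> \<equiv> parabolic_mu \<alpha> m" and "a \<equiv> 2 / (\<alpha> + 2)"
begin

lemma parabolic_mu_pos: "\<mu> > 0"
  using params by (simp add: \<mu>_def parabolic_mu_def)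

lemma parabolic_mu_square: "\<mu>\<^sup>2 = (\<alpha> + 2)\<^sup>2 * (m / (2 * \<alpha>))"
  using params by (simp add: \<mu>_def parabolic_mu_def power_mult_distrib)

lemma xbar_exponent_bounds: "0 < a" "a < 1" "-1 < 2 * (a - 1)"
  using params by (auto simp: a_def field_simps)

lemma xbar_eq: "xbar \<alpha> m \<phi>m \<phi>p t = of_real (\<mu> powr a * \<bar>t\<bar> powr a) * cis (if t \<ge> 0 then \<phi>p else \<phi>m)"
  using parabolic_mu_pos by (simp add: xbar_def powr_mult flip: \<mu>_def a_def)

lemma xbar_velocity_eq: "xbar_velocity \<alpha> m \<phi>m \<phi>p t =
    of_real (a * \<mu> powr a * (sgn t * \<bar>t\<bar> powr (a - 1))) * cis (if t \<ge> 0 then \<phi>p else \<phi>m)"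
  by (simp add: xbar_velocity_def flip: \<mu>_def a_def)

lemma norm_xbar: "norm (xbar \<alpha> m \<phi>m \<phi>p t) = \<mu> powr a * \<bar>t\<bar> powr a"
  by (simp add: xbar_eq norm_mult)

lemma norm_xbar_velocity:
  "t \<noteq> 0 \<Longrightarrow> norm (xbar_velocity \<alpha> m \<phi>m \<phi>p t) = a * \<mu> powr a * \<bar>t\<bar> powr (a - 1)"
  using xbar_exponent_bounds by (simp add: xbar_velocity_eq norm_mult abs_mult sgn_if)

lemma xbar_has_vector_derivative:
  assumes "t \<noteq> 0"
  shows "(xbar \<alpha> m \<phi>m \<phi>p has_vector_derivative xbar_velocity \<alpha> m \<phi>m \<phi>p t) (at t)"
    "(xbar_velocity \<alpha> m \<phi>m \<phi>p has_vector_derivative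
      - ((m / norm (xbar \<alpha> m \<phi>m \<phi>p t) powr (\<alpha> + 2)) *\<^sub>R xbar \<alpha> m \<phi>m \<phi>p t)) (at t)"
proof -
  define S where "S = (if t > 0 then {0<..} else {..<0::real})"
  define e where "e = cis (if t \<ge> 0 then \<phi>p else \<phi>m)"
  have S: "open S" "t \<in> S" "\<And>s. s \<in> S \<Longrightarrow> cis (if s \<ge> 0 then \<phi>p else \<phi>m) = e"
    using assms by (auto simp: S_def e_def split: if_splits)
  have vec: "((\<lambda>s. of_real (c * f s) * e) has_vector_derivative of_real (c * f') * e) (at t)"
    if "(f has_real_derivative f') (at t)" for f f' and c :: real
  proof -
    have "((\<lambda>s. c * f s) has_vector_derivative c * f') (at t)"
      using DERIV_cmult[OF that, of c] by (simp add: has_real_derivative_iff_has_vector_derivative)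
    from bounded_linear.has_vector_derivative[OF bounded_linear_scaleR_left this, of e]
    show ?thesis by (simp add: scaleR_conv_of_real)
  qed
  have "((\<lambda>s. of_real (\<mu> powr a * \<bar>s\<bar> powr a) * e) has_vector_derivative
      of_real (\<mu> powr a * (a * (sgn t * \<bar>t\<bar> powr (a - 1)))) * e) (at t)"
    by (intro vec DERIV_abs_powr assms)
  then have "(xbar \<alpha> m \<phi>m \<phi>p has_vector_derivative of_real (\<mu> powr a * (a * (sgn t * \<bar>t\<bar> powr (a - 1)))) * e) (at t)"
    by (rule has_vector_derivative_transform_within_open[OF _ S(1,2)]) (simp add: xbar_eq S(3))
  then show "(xbar \<alpha> m \<phi>m \<phi>p has_vector_derivative xbar_velocity \<alpha> m \<phi>m \<phi>p t) (at t)"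
    by (simp add: xbar_velocity_eq e_def mult_ac)
  have "((\<lambda>s. of_real (a * \<mu> powr a * (sgn s * \<bar>s\<bar> powr (a - 1))) * e) has_vector_derivative
      of_real (a * \<mu> powr a * ((a - 1) * \<bar>t\<bar> powr (a - 1 - 1))) * e) (at t)"
    by (intro vec DERIV_sgn_abs_powr assms)
  then have "(xbar_velocity \<alpha> m \<phi>m \<phi>p has_vector_derivative of_real (a * \<mu> powr a * ((a - 1) * \<bar>t\<bar> powr (a - 1 - 1))) * e) (at t)"
    by (rule has_vector_derivative_transform_within_open[OF _ S(1,2)]) (simp add: xbar_velocity_eq S(3))
  moreover have "of_real (a * \<mu> powr a * ((a - 1) * \<bar>t\<bar> powr (a - 1 - 1))) * e =
      - ((m / norm (xbar \<alpha> m \<phi>m \<phi>p t) powr (\<alpha> + 2)) *\<^sub>R xbar \<alpha> m \<phi>m \<phi>p t)"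
  proof -
    have "\<alpha> + 2 \<noteq> 0" using params by simp
    then have a2: "a * (\<alpha> + 2) = 2"
      using nonzero_eq_divide_eq[of "\<alpha> + 2" a 2] by (simp only: a_def simp_thms)
    have "norm (xbar \<alpha> m \<phi>m \<phi>p t) powr (\<alpha> + 2) = \<mu>\<^sup>2 * t\<^sup>2"
      using parabolic_mu_pos assms by (simp add: norm_xbar powr_mult powr_powr a2 powr_numeral)
    moreover have "a * (1 - a) * \<mu>\<^sup>2 = m"
    proof -
      have "a * (1 - a) = 2 * \<alpha> / (\<alpha> + 2)\<^sup>2"
        using params by (simp add: a_def power2_eq_square field_simps)
      then show ?thesis using params by (simp add: parabolic_mu_square)
    qed
    then have "a * (a - 1) = - (m / \<mu>\<^sup>2)" using parabolic_mu_pos by (simp add: field_simps)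
    moreover have "\<bar>t\<bar> powr (a - 1 - 1) = \<bar>t\<bar> powr a / t\<^sup>2"
      using assms by (simp add: powr_diff power2_eq_square)
    moreover have "a * \<mu> powr a * ((a - 1) * \<bar>t\<bar> powr (a - 1 - 1)) =
        (a * (a - 1)) * (\<mu> powr a * \<bar>t\<bar> powr (a - 1 - 1))"
      by (simp only: mult_ac)
    ultimately have "a * \<mu> powr a * ((a - 1) * \<bar>t\<bar> powr (a - 1 - 1)) =
        - (m / norm (xbar \<alpha> m \<phi>m \<phi>p t) powr (\<alpha> + 2)) * (\<mu> powr a * \<bar>t\<bar> powr a)"
      by simp
    then show ?thesis
      by (simp only: scaleR_conv_of_real xbar_eq e_def of_real_mult of_real_minus mult.assoc mult_minus_left)
  qed
  ultimately show "(xbar_velocity \<alpha> m \<phi>m \<phi>p has_vector_derivative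
      - ((m / norm (xbar \<alpha> m \<phi>m \<phi>p t) powr (\<alpha> + 2)) *\<^sub>R xbar \<alpha> m \<phi>m \<phi>p t)) (at t)" by simp
qed

lemma continuous_on_xbar: "continuous_on S (xbar \<alpha> m \<phi>m \<phi>p)"
proof -
  have "isCont (xbar \<alpha> m \<phi>m \<phi>p) t" for t
  proof (cases "t = 0")
    case True
    have "((\<lambda>t. \<mu> powr a * \<bar>t\<bar> powr a) \<longlongrightarrow> \<mu> powr a * \<bar>0::real\<bar> powr a) (at 0)"
      using xbar_exponent_bounds by (intro tendsto_intros tendsto_powr') auto
    then have "(xbar \<alpha> m \<phi>m \<phi>p \<longlongrightarrow> 0) (at 0)"
      by (intro tendsto_norm_zero_cancel[of "xbar \<alpha> m \<phi>m \<phi>p"]) (simp add: norm_xbar)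
    then show ?thesis using True by (simp add: isCont_def xbar_eq)
  next
    case False
    then show ?thesis using xbar_has_vector_derivative(1) has_vector_derivative_continuous by blast
  qed
  then show ?thesis by (simp add: continuous_at_imp_continuous_on)
qed

lemma xbar_velocity_measurable: "xbar_velocity \<alpha> m \<phi>m \<phi>p \<in> borel_measurable borel"
proof -
  have "(\<lambda>t. of_real (a * \<mu> powr a * (sgn t * \<bar>t\<bar> powr (a - 1))) * (if t \<ge> 0 then cis \<phi>p else cis \<phi>m)) \<in> borel_measurable borel"
    by measurable
  also have "(\<lambda>t. of_real (a * \<mu> powr a * (sgn t * \<bar>t\<bar> powr (a - 1))) * (if t \<ge> 0 then cis \<phi>p else cis \<phi>m)) = xbar_velocity \<alpha> m \<phi>m \<phi>p"
    by (auto simp: xbar_velocity_eq)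
  finally show ?thesis .
qed

lemma xbar_velocity_sq_integrable:
  assumes "T > 0" shows "sq_integrable (lebesgue_on {-T..T}) (xbar_velocity \<alpha> m \<phi>m \<phi>p)"
  by (rule sq_integrable_powr_bound[OF _ xbar_velocity_measurable xbar_exponent_bounds(3), of _ _ _ "a * \<mu> powr a"])
    (use assms in \<open>simp_all add: norm_xbar_velocity\<close>)

lemma xbar_has_H1_derivative:
  assumes "T > 0"
  shows "has_H1_derivative T (xbar \<alpha> m \<phi>m \<phi>p) (xbar_velocity \<alpha> m \<phi>m \<phi>p)"
  unfolding has_H1_derivative_iff
proof
  note sq = xbar_velocity_sq_integrable[OF assms]
  show "sq_integrable (lebesgue_on {-T..T}) (xbar_velocity \<alpha> m \<phi>m \<phi>p)" by (rule sq)
  note int = sq_integrable_imp_integrable_Icc[OF sq]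
  have piece: "primitive_on c d (xbar \<alpha> m \<phi>m \<phi>p) (xbar_velocity \<alpha> m \<phi>m \<phi>p)"
    if "-T \<le> c" "c \<le> d" "d \<le> T" "0 \<notin> {c<..<d}" for c d
  proof (rule primitive_on_FTC[OF \<open>c \<le> d\<close> continuous_on_xbar])
    show "integrable (lebesgue_on {c..d}) (xbar_velocity \<alpha> m \<phi>m \<phi>p)"
      using that by (intro integrable_Icc_mono[OF int]) auto
    fix t assume "c < t" "t < d"
    then show "(xbar \<alpha> m \<phi>m \<phi>p has_vector_derivative xbar_velocity \<alpha> m \<phi>m \<phi>p t) (at t)"
      using that by (intro xbar_has_vector_derivative) auto
  qed
  show "primitive_on (-T) T (xbar \<alpha> m \<phi>m \<phi>p) (xbar_velocity \<alpha> m \<phi>m \<phi>p)"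
  proof (rule primitive_on_combine)
    show "primitive_on (-T) 0 (xbar \<alpha> m \<phi>m \<phi>p) (xbar_velocity \<alpha> m \<phi>m \<phi>p)"
      "primitive_on 0 T (xbar \<alpha> m \<phi>m \<phi>p) (xbar_velocity \<alpha> m \<phi>m \<phi>p)"
      by (rule piece; use assms in simp)+
  qed (use assms in auto)
qed

lemma radial_cost_xbar:
  assumes "T > 0"
  shows "2 * radial_cost \<alpha> m (norm (xbar \<alpha> m \<phi>m \<phi>p T)) =
    2 * m / \<alpha> * \<mu> powr (2 * a - 2) * (2 * (T powr (2 * (a - 1) + 1) / (2 * (a - 1) + 1)))"
proof -
  have e1: "a * (1 - \<alpha> / 2) = 2 * (a - 1) + 1" using params by (simp add: a_def field_simps)
  have e2: "2 * (a - 1) + 1 = (2 - \<alpha>) / (\<alpha> + 2)" using params by (simp add: a_def field_simps)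
  have s: "sqrt (2 * m / \<alpha>) = 2 * sqrt (m / (2 * \<alpha>))"
  proof -
    have "2 * m / \<alpha> = 4 * (m / (2 * \<alpha>))" by simp
    then have "sqrt (2 * m / \<alpha>) = sqrt 4 * sqrt (m / (2 * \<alpha>))" by (simp only: real_sqrt_mult)
    then show ?thesis by simp
  qed
  have sq: "sqrt (m / (2 * \<alpha>)) * sqrt (m / (2 * \<alpha>)) = m / (2 * \<alpha>)" using params by simp
  have mu_a: "\<mu> powr (2 * (a - 1) + 1) = \<mu> powr (2 * a - 2) * ((\<alpha> + 2) * sqrt (m / (2 * \<alpha>)))"
  proof -
    have "\<mu> powr (2 * (a - 1) + 1) = \<mu> powr (2 * a - 2) * \<mu> powr 1"
      by (simp only: powr_add[symmetric]) simp
    then show ?thesis using parabolic_mu_pos by (simp add: \<mu>_def parabolic_mu_def)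
  qed
  have "radial_cost \<alpha> m (norm (xbar \<alpha> m \<phi>m \<phi>p T)) =
      sqrt (2 * m / \<alpha>) / (1 - \<alpha> / 2) * (\<mu> powr (2 * (a - 1) + 1) * T powr (2 * (a - 1) + 1))"
    using assms parabolic_mu_pos by (simp add: radial_cost_def norm_xbar powr_mult powr_powr e1)
  also have "\<dots> = 2 * m / \<alpha> * \<mu> powr (2 * a - 2) * (T powr (2 * (a - 1) + 1) / (2 * (a - 1) + 1))"
  proof -
    have "sqrt (2 * m / \<alpha>) / (1 - \<alpha> / 2) * ((\<alpha> + 2) * sqrt (m / (2 * \<alpha>))) = 2 * m / \<alpha> / (2 * (a - 1) + 1)"
    proof -
      have "sqrt (2 * m / \<alpha>) / (1 - \<alpha> / 2) * ((\<alpha> + 2) * sqrt (m / (2 * \<alpha>))) =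
          2 * (\<alpha> + 2) / (1 - \<alpha> / 2) * (sqrt (m / (2 * \<alpha>)) * sqrt (m / (2 * \<alpha>)))"
      proof -
        have "2 * x / y * (z * x) = 2 * z / y * (x * x)" for x y z :: real by simp
        then show ?thesis unfolding s .
      qed
      also have "\<dots> = 2 * m / \<alpha> / ((2 - \<alpha>) / (\<alpha> + 2))"
        unfolding sq using params by (simp add: field_simps)
      finally show ?thesis by (simp only: e2)
    qed
    then have "sqrt (2 * m / \<alpha>) / (1 - \<alpha> / 2) * ((\<alpha> + 2) * sqrt (m / (2 * \<alpha>))) * (\<mu> powr (2 * a - 2) * T powr (2 * (a - 1) + 1))
        = 2 * m / \<alpha> / (2 * (a - 1) + 1) * (\<mu> powr (2 * a - 2) * T powr (2 * (a - 1) + 1))"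
      by (simp only:)
    then show ?thesis unfolding mu_a by (simp only: times_divide_eq_left times_divide_eq_right mult_ac)
  qed
  finally show ?thesis by simp
qed

text \<open>
  The energy is zero, so that kinetic and potential energy agree: the action is the length in the Jacobi
  metric of energy zero.
\<close>

lemma action_xbar:
  assumes "T > 0"
  shows "action \<alpha> m T (xbar \<alpha> m \<phi>m \<phi>p) = ennreal (2 * radial_cost \<alpha> m (norm (xbar \<alpha> m \<phi>m \<phi>p T)))"
proof -
  let ?M = "lebesgue_on {-T..T}" and ?c = "2 * m / \<alpha> * \<mu> powr (2 * a - 2)"
  have p: "-1 < 2 * (a - 1)" by (rule xbar_exponent_bounds)
  note I = abs_powr_integral[OF p, of T]
  have "action \<alpha> m T (xbar \<alpha> m \<phi>m \<phi>p) = (\<integral>\<^sup>+t. ennreal (?c * \<bar>t\<bar> powr (2 * (a - 1))) \<partial>?M)"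
    unfolding action_eq[OF xbar_has_H1_derivative[OF assms]]
  proof (rule nn_integral_cong_AE)
    have "Lbar \<alpha> m (xbar \<alpha> m \<phi>m \<phi>p t) (xbar_velocity \<alpha> m \<phi>m \<phi>p t) = ennreal (?c * \<bar>t\<bar> powr (2 * (a - 1)))"
      if t: "t \<noteq> 0" for t
    proof -
      have nz: "xbar \<alpha> m \<phi>m \<phi>p t \<noteq> 0"
        using norm_xbar[of \<phi>m \<phi>p t] t parabolic_mu_pos by (metis norm_zero mult_eq_0_iff powr_eq_0_iff abs_eq_0 less_irrefl)
      have "(a * \<mu> powr a * \<bar>t\<bar> powr (a - 1))\<^sup>2 = a\<^sup>2 * \<mu>\<^sup>2 * \<mu> powr (2 * a - 2) * \<bar>t\<bar> powr (2 * (a - 1))"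
      proof -
        have "\<mu>\<^sup>2 * \<mu> powr (2 * a - 2) = \<mu> powr 2 * \<mu> powr (2 * a - 2)"
          using parabolic_mu_pos by (simp add: powr_numeral)
        also have "\<dots> = (\<mu> powr a)\<^sup>2"
          by (simp add: power2_eq_square flip: powr_add)
        finally have "\<mu>\<^sup>2 * \<mu> powr (2 * a - 2) = (\<mu> powr a)\<^sup>2" .
        moreover have "(\<bar>t\<bar> powr (a - 1))\<^sup>2 = \<bar>t\<bar> powr (2 * (a - 1))"
          by (simp add: power2_eq_square flip: powr_add)
        ultimately show ?thesis by (simp add: power_mult_distrib)
      qed
      also have "a\<^sup>2 * \<mu>\<^sup>2 = 2 * (m / \<alpha>)"
        using params by (simp add: parabolic_mu_square a_def power_divide field_simps)
      finally have kin: "(norm (xbar_velocity \<alpha> m \<phi>m \<phi>p t))\<^sup>2 / 2 = m / \<alpha> * \<mu> powr (2 * a - 2) * \<bar>t\<bar> powr (2 * (a - 1))"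
        by (simp add: norm_xbar_velocity[OF t])
      have e: "a * \<alpha> = - (2 * a - 2)" using params by (simp add: a_def field_simps)
      have "norm (xbar \<alpha> m \<phi>m \<phi>p t) powr \<alpha> = \<mu> powr (- (2 * a - 2)) * \<bar>t\<bar> powr (- (2 * a - 2))"
        using parabolic_mu_pos by (simp add: norm_xbar powr_mult powr_powr e)
      then have pot: "m / (\<alpha> * norm (xbar \<alpha> m \<phi>m \<phi>p t) powr \<alpha>) = m / \<alpha> * \<mu> powr (2 * a - 2) * \<bar>t\<bar> powr (2 * (a - 1))"
        by (simp only: powr_minus_divide) (simp add: algebra_simps)
      have "0 \<le> m / \<alpha> * \<mu> powr (2 * a - 2) * \<bar>t\<bar> powr (2 * (a - 1))" using params by simp
      then show ?thesis
        unfolding Lbar_def Vbar_def kin pot using nz by (simp flip: ennreal_plus)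
    qed
    then show "AE t in ?M. Lbar \<alpha> m (xbar \<alpha> m \<phi>m \<phi>p t) (xbar_velocity \<alpha> m \<phi>m \<phi>p t) = ennreal (?c * \<bar>t\<bar> powr (2 * (a - 1)))"
      using AE_nonzero[of "{-T..T}"] by (auto elim!: eventually_mono)
  qed
  also have "\<dots> = ennreal (LINT t|?M. ?c * \<bar>t\<bar> powr (2 * (a - 1)))"
    using I(1) assms params by (intro nn_integral_eq_integral) auto
  also have "(LINT t|?M. ?c * \<bar>t\<bar> powr (2 * (a - 1))) = 2 * radial_cost \<alpha> m (norm (xbar \<alpha> m \<phi>m \<phi>p T))"
    using I(2) assms by (simp only: radial_cost_xbar integral_mult_right_zero)
  finally show ?thesis .
qed

lemma xbar_kepler_solution:
  assumes "T > 0"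
  shows "kepler_solution \<alpha> m T (xbar \<alpha> m \<phi>m \<phi>p)"
proof -
  have z: "xbar \<alpha> m \<phi>m \<phi>p 0 = 0" by (simp add: xbar_eq)
  have "{t \<in> {-T..T}. xbar \<alpha> m \<phi>m \<phi>p t = 0} \<subseteq> {0}"
    using norm_xbar[of \<phi>m \<phi>p] parabolic_mu_pos by (auto simp: xbar_eq)
  then have "negligible {t \<in> {-T..T}. xbar \<alpha> m \<phi>m \<phi>p t = 0}"
    using negligible_subset negligible_sing by blast
  moreover have "t \<noteq> 0" if "xbar \<alpha> m \<phi>m \<phi>p t \<noteq> 0" for t using that z by metis
  ultimately show ?thesis
    unfolding kepler_solution_def
    by (intro conjI exI[of _ "xbar_velocity \<alpha> m \<phi>m \<phi>p"] ballI impI continuous_on_xbar)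
      (auto intro: has_vector_derivative_at_within xbar_has_vector_derivative)
qed

text \<open>
  The collision is replaced by an arc: for \<open>|t| \<le> \<tau>\<close> the path turns with constant speed on the circle of radius
  \<open>(\<mu> \<tau>)^a\<close>. The velocities are bounded by a multiple of \<open>|t|^(a - 1)\<close> uniformly in \<open>\<tau>\<close>, so that dominated
  convergence applies to the scalar product with every \<open>H\<^sup>1\<close> function.
\<close>

lemma xbar_in_Gamma:
  assumes "T > 0"
  shows "xbar \<alpha> m \<phi>m \<phi>p \<in> Gamma \<alpha> m \<phi>m \<phi>p T"
proof -
  let ?M = "lebesgue_on {-T..T}" and ?x = "xbar \<alpha> m \<phi>m \<phi>p" and ?v = "xbar_velocity \<alpha> m \<phi>m \<phi>p"
  define \<tau> where "\<tau> n = T / real (n + 2)" for n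
  have \<tau>: "0 < \<tau> n" "\<tau> n < T" for n using assms by (auto simp: \<tau>_def field_simps add_pos_nonneg)
  have \<tau>_lim: "\<tau> \<longlonglongrightarrow> 0"
    unfolding \<tau>_def by (rule LIMSEQ_ignore_initial_segment[OF lim_const_over_n])
  define \<theta> where "\<theta> n t = \<phi>m + (\<phi>p - \<phi>m) * ((max (- \<tau> n) (min (\<tau> n) t) + \<tau> n) / (2 * \<tau> n))" for n t
  define X where "X n t = of_real (\<mu> powr a * max \<bar>t\<bar> (\<tau> n) powr a) * cis (\<theta> n t)" for n t
  define r where "r n = \<mu> powr a * \<tau> n powr a" for n
  define \<omega> where "\<omega> n = (\<phi>p - \<phi>m) / (2 * \<tau> n)" for n
  define arc where "arc n t = of_real (r n) * cis (\<phi>m + \<omega> n * (t + \<tau> n))" for n t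
  define V where "V n t = (if \<bar>t\<bar> < \<tau> n then \<i> * of_real (\<omega> n) * arc n t else ?v t)" for n t
  have \<theta>_out: "\<theta> n t = (if t \<ge> 0 then \<phi>p else \<phi>m)" if "\<tau> n \<le> \<bar>t\<bar>" for n t
    using that \<tau>[of n] by (auto simp: \<theta>_def max_def min_def abs_if split: if_splits)
  have \<theta>_in: "\<theta> n t = \<phi>m + \<omega> n * (t + \<tau> n)" if "\<bar>t\<bar> \<le> \<tau> n" for n t
    using that by (auto simp: \<theta>_def \<omega>_def max_def min_def abs_le_iff)
  have X_out: "X n t = ?x t" if "\<tau> n \<le> \<bar>t\<bar>" for n t
    using that by (simp add: X_def \<theta>_out xbar_eq max_def)
  have X_in: "X n t = arc n t" if "\<bar>t\<bar> \<le> \<tau> n" for n t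
    using that by (simp add: X_def \<theta>_in arc_def r_def max_def)
  have c\<theta>: "continuous_on S (\<theta> n)" for S n
    unfolding \<theta>_def using \<tau>[of n] by (intro continuous_intros) auto
  have cX: "continuous_on S (X n)" for S n
    unfolding X_def using \<tau>[of n] by (intro continuous_intros c\<theta>) auto
  have norm_X: "norm (X n t) = \<mu> powr a * max \<bar>t\<bar> (\<tau> n) powr a" for n t
    by (simp add: X_def norm_mult)
  have V_meas: "V n \<in> borel_measurable borel" for n
  proof -
    note [measurable] = xbar_velocity_measurable
    have "continuous_on UNIV (arc n)" unfolding arc_def by (intro continuous_intros)
    then have [measurable]: "arc n \<in> borel_measurable borel" by (rule borel_measurable_continuous_onI)
    show ?thesis unfolding V_def by measurable
  qed
  define C where "C = \<mu> powr a * (\<bar>\<phi>p - \<phi>m\<bar> / 2 + a)"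
  have V_bound: "norm (V n t) \<le> C * \<bar>t\<bar> powr (a - 1)" if t: "t \<noteq> 0" for n t
  proof (cases "\<bar>t\<bar> < \<tau> n")
    case True
    have "norm (V n t) = \<bar>\<omega> n\<bar> * \<bar>r n\<bar>"
      using True by (simp add: V_def arc_def norm_mult)
    also have "\<dots> = \<mu> powr a * (\<bar>\<phi>p - \<phi>m\<bar> / 2) * (\<tau> n powr a / \<tau> n)"
      using \<tau>[of n] by (simp add: r_def \<omega>_def abs_mult)
    also have "\<tau> n powr a / \<tau> n = \<tau> n powr (a - 1)" using \<tau>[of n] by (simp add: powr_diff)
    also have "\<mu> powr a * (\<bar>\<phi>p - \<phi>m\<bar> / 2) * \<tau> n powr (a - 1) \<le> C * \<bar>t\<bar> powr (a - 1)"
      unfolding C_def using True t xbar_exponent_bounds parabolic_mu_pos by (intro mult_mono order_refl[of "\<mu> powr a"] powr_mono2') auto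
    finally show ?thesis .
  next
    case False
    have "norm (V n t) = \<mu> powr a * a * \<bar>t\<bar> powr (a - 1)"
      using False t by (simp add: V_def norm_xbar_velocity)
    also have "\<dots> \<le> C * \<bar>t\<bar> powr (a - 1)"
      unfolding C_def by (intro mult_right_mono mult_left_mono) auto
    finally show ?thesis .
  qed
  have V_sq: "sq_integrable ?M (V n)" for n
    using sq_integrable_powr_bound[OF _ V_meas xbar_exponent_bounds(3) V_bound] assms by simp
  have XV: "has_H1_derivative T (X n) (V n)" for n
    unfolding has_H1_derivative_iff
  proof
    note int = sq_integrable_imp_integrable_Icc[OF V_sq]
    have piece: "primitive_on c d (X n) (V n)"
      if "-T \<le> c" "c \<le> d" "d \<le> T" "- \<tau> n \<notin> {c<..<d}" "\<tau> n \<notin> {c<..<d}" for c d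
    proof (rule primitive_on_FTC[OF \<open>c \<le> d\<close> cX])
      show "integrable (lebesgue_on {c..d}) (V n)"
        using that by (intro integrable_Icc_mono[OF int]) auto
      fix t assume t: "c < t" "t < d"
      show "(X n has_vector_derivative V n t) (at t)"
      proof (cases "\<bar>t\<bar> < \<tau> n")
        case True
        have "((\<lambda>s. cis (\<phi>m + \<omega> n * (s + \<tau> n))) has_vector_derivative \<i> * of_real (\<omega> n) * cis (\<phi>m + \<omega> n * (t + \<tau> n))) (at t)"
        proof -
          let ?f = "\<lambda>z. exp (\<i> * (of_real \<phi>m + of_real (\<omega> n) * (z + of_real (\<tau> n))))"
          have "(?f has_field_derivative \<i> * of_real (\<omega> n) * ?f (of_real t)) (at (of_real t))"
            by (auto intro!: derivative_eq_intros)
          from has_vector_derivative_real_field[OF this] show ?thesis by (simp add: cis_conv_exp)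
        qed
        then have "(arc n has_vector_derivative of_real (r n) * (\<i> * of_real (\<omega> n) * cis (\<phi>m + \<omega> n * (t + \<tau> n)))) (at t)"
          unfolding arc_def by (rule has_vector_derivative_mult_right)
        then have "(arc n has_vector_derivative V n t) (at t)"
          using True by (simp add: V_def arc_def mult_ac)
        then show ?thesis
          by (rule has_vector_derivative_transform_within_open[of _ _ _ "{- \<tau> n<..<\<tau> n}"]) (use True X_in in auto)
      next
        case False
        have "t \<noteq> \<tau> n" "t \<noteq> - \<tau> n" using t that by auto
        then have out: "\<tau> n < \<bar>t\<bar>" using False by auto
        define S where "S = (if t > 0 then {\<tau> n<..} else {..<- \<tau> n})"
        have S: "open S" "t \<in> S" "\<And>s. s \<in> S \<Longrightarrow> \<tau> n \<le> \<bar>s\<bar>"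
          using out by (auto simp: S_def split: if_splits)
        have "(?x has_vector_derivative ?v t) (at t)"
          using out \<tau>[of n] by (intro xbar_has_vector_derivative) auto
        then have "(X n has_vector_derivative ?v t) (at t)"
          by (rule has_vector_derivative_transform_within_open[OF _ S(1,2)]) (simp add: X_out S(3))
        then show ?thesis using False by (simp add: V_def)
      qed
    qed
    have "primitive_on (-T) (- \<tau> n) (X n) (V n)" "primitive_on (- \<tau> n) (\<tau> n) (X n) (V n)"
      "primitive_on (\<tau> n) T (X n) (V n)"
      by (rule piece; use \<tau>[of n] in simp)+
    then show "primitive_on (-T) T (X n) (V n)"
      using \<tau>[of n] by (intro primitive_on_combine[of "-T" "- \<tau> n" _ _ T] primitive_on_combine[of "- \<tau> n" "\<tau> n" _ _ T]) auto
  qed (rule V_sq)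
  have X_in_star: "X n \<in> Gamma_star \<alpha> m \<phi>m \<phi>p T" for n
    unfolding Gamma_star_def
  proof (intro CollectI conjI ballI exI[of _ "\<theta> n"])
    show "X n \<in> H1 T" by (rule H1I[OF XV])
    show "X n t \<noteq> 0" for t using norm_X[of n t] parabolic_mu_pos \<tau>[of n] by (auto simp: X_def max_def)
    show "X n (-T) = ?x (-T)" "X n T = ?x T" using \<tau>[of n] assms by (auto intro!: X_out)
    show "X n t = of_real (norm (X n t)) * cis (\<theta> n t)" for t
      unfolding norm_X by (simp add: X_def)
    show "\<theta> n (-T) = \<phi>m" "\<theta> n T = \<phi>p" using \<tau>[of n] assms by (auto simp: \<theta>_out)
  qed (rule c\<theta>)
  note xH = xbar_has_H1_derivative[OF assms, of \<phi>m \<phi>p]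
  have "H1_weakly_converges T X ?x"
    unfolding H1_weakly_converges_def
  proof (intro conjI allI ballI)
    show "X n \<in> H1 T" for n by (rule H1I[OF XV])
    show "?x \<in> H1 T" by (rule H1I[OF xH])
    fix y assume "y \<in> H1 T"
    then obtain u where y: "has_H1_derivative T y u" by (auto simp: H1_def)
    have meas: "z \<in> borel_measurable ?M" "z' \<in> borel_measurable ?M" if "has_H1_derivative T z z'" for z z'
      using that continuous_imp_measurable_on_sets_lebesgue[OF H1_continuous[OF that]]
      by (simp_all add: has_H1_derivative_def)
    note [measurable] = meas[OF y] meas[OF XV] meas[OF xH]
    show "(\<lambda>n. H1_inner T (X n) y) \<longlonglongrightarrow> H1_inner T ?x y"
      unfolding H1_inner_eq[OF XV y] H1_inner_eq[OF xH y]
    proof (rule integral_dominated_convergence)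
      let ?w = "\<lambda>t. \<mu> powr a * T powr a * norm (y t) + norm (C * \<bar>t\<bar> powr (a - 1)) * norm (u t)"
      have "sq_integrable ?M (\<lambda>t. C * \<bar>t\<bar> powr (a - 1))"
        by (rule sq_integrable_powr_bound[OF _ _ xbar_exponent_bounds(3), of _ _ "\<bar>C\<bar>"]) (use assms in \<open>auto simp: abs_mult\<close>)
      then have "integrable ?M (\<lambda>t. norm (C * \<bar>t\<bar> powr (a - 1)) * norm (u t))"
        using y by (intro integrable_norm_prod) (auto simp: has_H1_derivative_iff)
      moreover have "integrable ?M (\<lambda>t. \<mu> powr a * T powr a * norm (y t))"
        by (intro integrable_continuous_Icc continuous_intros H1_continuous[OF y])
      ultimately show "integrable ?M ?w" by simp
      show "AE t in ?M. (\<lambda>n. X n t \<bullet> y t + V n t \<bullet> u t) \<longlonglongrightarrow> ?x t \<bullet> y t + ?v t \<bullet> u t"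
        using AE_nonzero[of "{-T..T}"]
      proof (rule eventually_mono)
        fix t :: real assume "t \<noteq> 0"
        then have "\<forall>\<^sub>F n in sequentially. \<tau> n < \<bar>t\<bar>"
          by (intro order_tendstoD(2)[OF \<tau>_lim]) simp
        then have "\<forall>\<^sub>F n in sequentially. X n t \<bullet> y t + V n t \<bullet> u t = ?x t \<bullet> y t + ?v t \<bullet> u t"
          by eventually_elim (simp add: X_out V_def)
        then show "(\<lambda>n. X n t \<bullet> y t + V n t \<bullet> u t) \<longlonglongrightarrow> ?x t \<bullet> y t + ?v t \<bullet> u t"
          by (rule tendsto_eventually)
      qed simp
      show "AE t in ?M. norm (X n t \<bullet> y t + V n t \<bullet> u t) \<le> ?w t" for n
      proof -
        have "norm (X n t \<bullet> y t + V n t \<bullet> u t) \<le> ?w t" if t: "t \<noteq> 0" "t \<in> {-T..T}" for t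
        proof -
          have "norm (X n t) \<le> \<mu> powr a * T powr a"
            unfolding norm_X using t \<tau>[of n] xbar_exponent_bounds by (intro mult_left_mono powr_mono2) (auto simp: max_def)
          then have "\<bar>X n t \<bullet> y t\<bar> \<le> \<mu> powr a * T powr a * norm (y t)"
            using Cauchy_Schwarz_ineq2[of "X n t" "y t"] by (meson mult_right_mono norm_ge_zero order_trans)
          moreover have "norm (V n t) \<le> norm (C * \<bar>t\<bar> powr (a - 1))"
            using V_bound[OF t(1), of n] by simp
          then have "\<bar>V n t \<bullet> u t\<bar> \<le> norm (C * \<bar>t\<bar> powr (a - 1)) * norm (u t)"
            using Cauchy_Schwarz_ineq2[of "V n t" "u t"] by (meson mult_right_mono norm_ge_zero order_trans)
          ultimately show ?thesis by simp
        qed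
        moreover have "AE t in ?M. t \<in> {-T..T}" by (auto intro: AE_I2)
        ultimately show ?thesis
          using AE_nonzero[of "{-T..T}"] by (auto elim!: eventually_elim2)
      qed
    qed measurable
  qed
  then show ?thesis
    unfolding Gamma_def H1_weak_closure_def using X_in_star by blast
qed

end

section \<open>Cutting the corner at the collision\<close>

text \<open>
  The clock \<open>dt = c g(s) ds\<close>, with \<open>c\<close> such that the parameter interval is traversed in time \<open>2 T\<close>.
\<close>

lemma time_change_exists:
  fixes g :: "real \<Rightarrow> real"
  assumes "P > 0" "T > 0" and g: "continuous_on {-P..P} g" and g_pos: "\<And>s. s \<in> {-P..P} \<Longrightarrow> 0 < g s"
    and J: "integral {-P..P} g > 0"
  obtains \<sigma> where "continuous_on {-T..T} \<sigma>" "\<sigma> (-T) = -P" "\<sigma> T = P"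
    "\<And>t. t \<in> {-T..T} \<Longrightarrow> \<sigma> t \<in> {-P..P}"
    "\<And>t. -T < t \<Longrightarrow> t < T \<Longrightarrow> (\<sigma> has_real_derivative 1 / (2 * T / integral {-P..P} g * g (\<sigma> t))) (at t)"
proof -
  define \<gamma> where "\<gamma> = 2 * T / integral {-P..P} g"
  have \<gamma>: "\<gamma> > 0" using \<open>T > 0\<close> J by (simp add: \<gamma>_def)
  define \<tau> where "\<tau> s = \<gamma> * integral {-P..s} g - T" for s
  have gi: "g integrable_on {-P..P}" using g by (rule integrable_continuous_interval)
  have c\<tau>: "continuous_on {-P..P} \<tau>"
    unfolding \<tau>_def by (intro continuous_intros indefinite_integral_continuous_1 gi)
  have der: "(\<tau> has_real_derivative \<gamma> * g s) (at s)" if s: "s \<in> {-P<..<P}" for s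
  proof -
    have "((\<lambda>s. integral {-P..s} g) has_real_derivative g s) (at s within {-P..P})"
      using s by (intro integral_has_real_derivative g) auto
    moreover have "at s within {-P..P} = at s"
      using s by (intro at_within_interior) (auto simp: interior_atLeastAtMost_real)
    ultimately have "((\<lambda>s. integral {-P..s} g) has_real_derivative g s) (at s)" by simp
    from DERIV_diff[OF DERIV_cmult[OF this, of \<gamma>] DERIV_const[of T]] show ?thesis
      unfolding \<tau>_def by simp
  qed
  have mono: "\<tau> s < \<tau> s'" if "-P \<le> s" "s < s'" "s' \<le> P" for s s'
  proof (rule DERIV_pos_imp_increasing_open[OF \<open>s < s'\<close>])
    show "continuous_on {s..s'} \<tau>" using c\<tau> that by (auto intro: continuous_on_subset)
    fix z assume z: "s < z" "z < s'"
    have "0 < \<gamma> * g z" using \<gamma> g_pos[of z] z that by simp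
    then show "\<exists>y. (\<tau> has_real_derivative y) (at z) \<and> 0 < y" using der[of z] z that by auto
  qed
  have ends: "\<tau> (-P) = -T" "\<tau> P = T" using J by (auto simp: \<tau>_def \<gamma>_def)
  have inj: "inj_on \<tau> {-P..P}"
  proof (rule inj_onI)
    fix s s' assume "s \<in> {-P..P}" "s' \<in> {-P..P}" "\<tau> s = \<tau> s'"
    then show "s = s'" using mono[of s s'] mono[of s' s] by (cases s s' rule: linorder_cases) auto
  qed
  have mono_le: "\<tau> s \<le> \<tau> s'" if "-P \<le> s" "s \<le> s'" "s' \<le> P" for s s'
    using mono[of s s'] that by (cases "s = s'") auto
  have img: "\<tau> ` {-P..P} = {-T..T}"
  proof
    show "\<tau> ` {-P..P} \<subseteq> {-T..T}" using mono_le ends \<open>P > 0\<close> by (force simp flip: ends)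
    show "{-T..T} \<subseteq> \<tau> ` {-P..P}"
    proof
      fix t assume "t \<in> {-T..T}"
      then have "\<exists>s\<ge>-P. s \<le> P \<and> \<tau> s = t" using ends \<open>P > 0\<close> c\<tau> by (intro IVT') auto
      then show "t \<in> \<tau> ` {-P..P}" by auto
    qed
  qed
  define \<sigma> where "\<sigma> = inv_into {-P..P} \<tau>"
  have \<sigma>\<tau>: "\<sigma> (\<tau> s) = s" if "s \<in> {-P..P}" for s using that inj by (simp add: \<sigma>_def)
  have \<tau>\<sigma>: "\<tau> (\<sigma> t) = t" and \<sigma>_in: "\<sigma> t \<in> {-P..P}" if "t \<in> {-T..T}" for t
    using that inv_into_into[of t \<tau> "{-P..P}"] f_inv_into_f[of t \<tau> "{-P..P}"] unfolding \<sigma>_def img by auto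
  have c\<sigma>: "continuous_on {-T..T} \<sigma>"
    using continuous_on_inv[OF c\<tau> compact_Icc, of \<sigma>] \<sigma>\<tau> unfolding img by blast
  show thesis
  proof
    show "\<sigma> (-T) = -P" "\<sigma> T = P" using \<sigma>\<tau>[of "-P"] \<sigma>\<tau>[of P] ends \<open>P > 0\<close> by auto
    fix t assume t: "-T < t" "t < T"
    then have \<sigma>t: "\<sigma> t \<in> {-P..P}" "\<tau> (\<sigma> t) = t" using \<sigma>_in[of t] \<tau>\<sigma>[of t] by auto
    then have \<sigma>t': "\<sigma> t \<in> {-P<..<P}" using ends t by (cases "\<sigma> t = P \<or> \<sigma> t = -P") auto
    have "(\<sigma> has_real_derivative inverse (\<gamma> * g (\<sigma> t))) (at t)"
    proof (rule DERIV_inverse_function[where f = \<tau> and g = \<sigma> and a = "-T" and b = T, OF der[OF \<sigma>t']])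
      show "\<gamma> * g (\<sigma> t) \<noteq> 0" using \<gamma> g_pos[OF \<sigma>t(1)] by simp
      show "isCont \<sigma> t" using continuous_on_interior[OF c\<sigma>, of t] t by (simp add: interior_atLeastAtMost_real)
    qed (use \<tau>\<sigma> t in auto)
    then show "(\<sigma> has_real_derivative 1 / (2 * T / integral {-P..P} g * g (\<sigma> t))) (at t)"
      by (simp add: \<gamma>_def inverse_eq_divide)
  qed (use c\<sigma> \<sigma>_in in auto)
qed

text \<open>
  In the coordinate \<open>x^(1/\<beta>)\<close> the plane becomes a cone with a flat metric proportional to the Jacobi metric,
  and the collision-ejection solution becomes the broken line through the apex with arc length \<open>s\<close> and radius
  \<open>|s|\<close>. The competitor has radius \<open>\<surd>(s\<^sup>2 + \<epsilon>\<^sup>2)\<close> and angle \<open>\<kappa> arctan (s / \<epsilon>)\<close>. For \<open>\<kappa> = 1\<close> this is a straight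
  line at distance \<open>\<epsilon>\<close> from the apex; in general the square of its speed is \<open>(s\<^sup>2 + \<kappa>\<^sup>2 \<epsilon>\<^sup>2) / (s\<^sup>2 + \<epsilon>\<^sup>2)\<close>.
  With the clock \<open>dt = \<gamma> (s\<^sup>2 + \<epsilon>\<^sup>2)^(\<beta> - 1) ds\<close> the potential contributes the
  constant \<open>m * \<gamma> / \<alpha>\<close> and the kinetic energy contributes \<open>\<beta>\<^sup>2 / (2 * \<gamma>)\<close> times the squared speed to the action per unit
  of \<open>s\<close>, so that the action has a closed form.
\<close>

lemma bent_path_exists:
  fixes \<alpha> m T \<phi>m \<phi>p P P0 \<epsilon> \<kappa> :: real
  assumes "m > 0" "0 < \<alpha>" "\<alpha> < 2" "T > 0" "0 < \<epsilon>" "0 < P0" "0 < P"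
    and P: "P0\<^sup>2 + \<epsilon>\<^sup>2 = P\<^sup>2"
  defines "\<beta> \<equiv> 2 / (2 - \<alpha>)"
  defines "\<gamma> \<equiv> 2 * T / integral {-P0..P0} (\<lambda>s. (s\<^sup>2 + \<epsilon>\<^sup>2) powr (\<beta> - 1))"
  assumes R: "norm (xbar \<alpha> m \<phi>m \<phi>p T) = P powr \<beta>"
    and J: "integral {-P0..P0} (\<lambda>s. (s\<^sup>2 + \<epsilon>\<^sup>2) powr (\<beta> - 1)) > 0"
    and \<kappa>: "\<beta> * \<kappa> * arctan (P0 / \<epsilon>) = (\<phi>p - \<phi>m) / 2"
  shows "\<exists>x\<in>Gamma_star \<alpha> m \<phi>m \<phi>p T. action \<alpha> m T x =
    ennreal (P0 * (2 * m * \<gamma> / \<alpha> + \<beta>\<^sup>2 / \<gamma>) - \<beta>\<^sup>2 / \<gamma> * ((1 - \<kappa>\<^sup>2) * \<epsilon> * arctan (P0 / \<epsilon>)))"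
proof -
  define g where "g s = (s\<^sup>2 + \<epsilon>\<^sup>2) powr (\<beta> - 1)" for s
  have q_pos: "0 < s\<^sup>2 + \<epsilon>\<^sup>2" for s using \<open>0 < \<epsilon>\<close> by (intro add_nonneg_pos) auto
  have g_pos: "0 < g s" for s using \<open>0 < \<epsilon>\<close> by (simp add: g_def)
  have cg: "continuous_on S g" for S
    unfolding g_def using \<open>0 < \<epsilon>\<close> by (intro continuous_intros) auto
  have \<gamma>_eq: "\<gamma> = 2 * T / integral {-P0..P0} g" by (simp add: \<gamma>_def g_def[abs_def])
  have J': "integral {-P0..P0} g > 0" using J by (simp add: g_def[abs_def])
  have \<gamma>: "\<gamma> > 0" using J' \<open>T > 0\<close> by (simp add: \<gamma>_eq)
  have \<beta>: "\<beta> > 0" "\<alpha> * \<beta> = 2 * (\<beta> - 1)" using assms by (auto simp: \<beta>_def field_simps)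
  obtain \<sigma> where \<sigma>: "continuous_on {-T..T} \<sigma>" "\<sigma> (-T) = -P0" "\<sigma> T = P0"
    "\<And>t. -T < t \<Longrightarrow> t < T \<Longrightarrow> (\<sigma> has_real_derivative 1 / (\<gamma> * g (\<sigma> t))) (at t)"
    using time_change_exists[OF \<open>0 < P0\<close> \<open>T > 0\<close> cg g_pos J'] unfolding \<gamma>_eq by metis
  define \<phi>0 where "\<phi>0 = (\<phi>p + \<phi>m) / 2"
  define \<theta> where "\<theta> s = \<phi>0 + \<beta> * \<kappa> * arctan (s / \<epsilon>)" for s
  define X where "X s = of_real ((s\<^sup>2 + \<epsilon>\<^sup>2) powr (\<beta> / 2)) * cis (\<theta> s)" for s
  define X' where "X' s = of_real (\<beta> * (s\<^sup>2 + \<epsilon>\<^sup>2) powr (\<beta> / 2 - 1)) * (Complex s (\<kappa> * \<epsilon>) * cis (\<theta> s))" for s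
  have norm_X: "norm (X s) = (s\<^sup>2 + \<epsilon>\<^sup>2) powr (\<beta> / 2)" for s by (simp add: X_def norm_mult)
  have arctan_der: "((\<lambda>s. arctan (s / \<epsilon>)) has_real_derivative \<epsilon> / (s\<^sup>2 + \<epsilon>\<^sup>2)) (at s)" for s
  proof -
    have "((\<lambda>s. arctan (s / \<epsilon>)) has_real_derivative inverse (1 + (s / \<epsilon>)\<^sup>2) * (1 / \<epsilon>)) (at s)"
      by (rule DERIV_chain2[OF DERIV_arctan]) (use \<open>0 < \<epsilon>\<close> in \<open>auto intro!: derivative_eq_intros\<close>)
    moreover have "inverse (1 + (s / \<epsilon>)\<^sup>2) * (1 / \<epsilon>) = \<epsilon> / (s\<^sup>2 + \<epsilon>\<^sup>2)"
    proof -
      have "1 + (s / \<epsilon>)\<^sup>2 = (s\<^sup>2 + \<epsilon>\<^sup>2) / \<epsilon>\<^sup>2" using \<open>0 < \<epsilon>\<close> by (simp add: field_simps)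
      then show ?thesis using \<open>0 < \<epsilon>\<close> by (simp add: power2_eq_square)
    qed
    ultimately show ?thesis by simp
  qed
  have X_der: "(X has_vector_derivative X' s) (at s)" for s
  proof -
    have r: "((\<lambda>s. (s\<^sup>2 + \<epsilon>\<^sup>2) powr (\<beta> / 2)) has_real_derivative \<beta> / 2 * (s\<^sup>2 + \<epsilon>\<^sup>2) powr (\<beta> / 2 - 1) * (2 * s)) (at s)"
      by (rule DERIV_chain2[where f = "\<lambda>z. z powr (\<beta> / 2)" and g = "\<lambda>s. s\<^sup>2 + \<epsilon>\<^sup>2", OF has_real_derivative_powr[OF q_pos]]) (auto intro!: derivative_eq_intros)
    have \<theta>': "(\<theta> has_real_derivative \<beta> * \<kappa> * (\<epsilon> / (s\<^sup>2 + \<epsilon>\<^sup>2))) (at s)"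
      unfolding \<theta>_def using DERIV_add[OF DERIV_const[of \<phi>0] DERIV_cmult[OF arctan_der, of "\<beta> * \<kappa>"]] by simp
    have "((\<lambda>t. cis t) has_vector_derivative \<i> * cis u) (at u)" for u
    proof -
      have "((\<lambda>z. exp (\<i> * z)) has_field_derivative \<i> * exp (\<i> * of_real u)) (at (of_real u))"
        by (auto intro!: derivative_eq_intros)
      from has_vector_derivative_real_field[OF this] show ?thesis by (simp add: cis_conv_exp)
    qed
    from vector_diff_chain_at[OF \<theta>'[unfolded has_real_derivative_iff_has_vector_derivative] this]
    have c: "((\<lambda>s. cis (\<theta> s)) has_vector_derivative (\<beta> * \<kappa> * (\<epsilon> / (s\<^sup>2 + \<epsilon>\<^sup>2))) *\<^sub>R (\<i> * cis (\<theta> s))) (at s)"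
      by (simp add: o_def)
    have "((\<lambda>s. of_real ((s\<^sup>2 + \<epsilon>\<^sup>2) powr (\<beta> / 2)) :: complex) has_vector_derivative of_real (\<beta> / 2 * (s\<^sup>2 + \<epsilon>\<^sup>2) powr (\<beta> / 2 - 1) * (2 * s))) (at s)"
      using r by (rule has_vector_derivative_of_real)
    from has_vector_derivative_mult[OF this c]
    have "(X has_vector_derivative of_real ((s\<^sup>2 + \<epsilon>\<^sup>2) powr (\<beta> / 2)) * ((\<beta> * \<kappa> * (\<epsilon> / (s\<^sup>2 + \<epsilon>\<^sup>2))) *\<^sub>R (\<i> * cis (\<theta> s)))
        + of_real (\<beta> / 2 * (s\<^sup>2 + \<epsilon>\<^sup>2) powr (\<beta> / 2 - 1) * (2 * s)) * cis (\<theta> s)) (at s)"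
      unfolding X_def .
    moreover have "of_real ((s\<^sup>2 + \<epsilon>\<^sup>2) powr (\<beta> / 2)) * ((\<beta> * \<kappa> * (\<epsilon> / (s\<^sup>2 + \<epsilon>\<^sup>2))) *\<^sub>R (\<i> * cis (\<theta> s)))
        + of_real (\<beta> / 2 * (s\<^sup>2 + \<epsilon>\<^sup>2) powr (\<beta> / 2 - 1) * (2 * s)) * cis (\<theta> s) = X' s"
    proof -
      have "(s\<^sup>2 + \<epsilon>\<^sup>2) powr (\<beta> / 2) = (s\<^sup>2 + \<epsilon>\<^sup>2) powr (\<beta> / 2 - 1) * (s\<^sup>2 + \<epsilon>\<^sup>2)"
        using q_pos[of s] by (simp add: powr_diff)
      then have "(s\<^sup>2 + \<epsilon>\<^sup>2) powr (\<beta> / 2) * (\<beta> * \<kappa> * (\<epsilon> / (s\<^sup>2 + \<epsilon>\<^sup>2))) = \<beta> * (s\<^sup>2 + \<epsilon>\<^sup>2) powr (\<beta> / 2 - 1) * (\<kappa> * \<epsilon>)"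
        using q_pos[of s] by simp
      then have "complex_of_real ((s\<^sup>2 + \<epsilon>\<^sup>2) powr (\<beta> / 2)) * ((\<beta> * \<kappa> * (\<epsilon> / (s\<^sup>2 + \<epsilon>\<^sup>2))) *\<^sub>R (\<i> * cis (\<theta> s))) =
          of_real (\<beta> * (s\<^sup>2 + \<epsilon>\<^sup>2) powr (\<beta> / 2 - 1) * (\<kappa> * \<epsilon>)) * (\<i> * cis (\<theta> s))"
        by (simp only: scaleR_conv_of_real mult.assoc[symmetric] of_real_mult[symmetric])
      moreover have "Complex s (\<kappa> * \<epsilon>) = of_real s + of_real (\<kappa> * \<epsilon>) * \<i>" by (simp add: complex_eq_iff)
      ultimately show ?thesis unfolding X'_def by (simp add: algebra_simps)
    qed
    ultimately show ?thesis by simp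
  qed
  define x where "x t = X (\<sigma> t)" for t
  define v where "v t = (1 / (\<gamma> * g (\<sigma> t))) *\<^sub>R X' (\<sigma> t)" for t
  have cX: "continuous_on S X" for S
    using has_vector_derivative_continuous[OF X_der] by (simp add: continuous_at_imp_continuous_on)
  have c\<theta>: "continuous_on S \<theta>" for S unfolding \<theta>_def by (intro continuous_intros) (use \<open>0 < \<epsilon>\<close> in auto)
  have cX': "continuous_on S X'" for S
    unfolding X'_def complex_eq using \<open>0 < \<epsilon>\<close>
    by (intro continuous_intros c\<theta>) auto
  have cx: "continuous_on {-T..T} x" unfolding x_def by (intro continuous_on_compose2[OF cX \<sigma>(1)]) auto
  have cv: "continuous_on {-T..T} v"
    unfolding v_def using \<gamma> g_pos
    by (intro continuous_intros continuous_on_compose2[OF cX' \<sigma>(1)] continuous_on_compose2[OF cg \<sigma>(1)])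
      (auto simp: less_imp_neq[THEN not_sym])
  have xv: "has_H1_derivative T x v"
    unfolding has_H1_derivative_iff
  proof
    show "sq_integrable (lebesgue_on {-T..T}) v" by (rule sq_integrable_continuous[OF cv])
    show "primitive_on (-T) T x v"
    proof (rule primitive_on_FTC[OF _ cx])
      fix t assume t: "-T < t" "t < T"
      from vector_diff_chain_at[OF \<sigma>(4)[OF t, unfolded has_real_derivative_iff_has_vector_derivative] X_der]
      show "(x has_vector_derivative v t) (at t)" by (simp add: o_def x_def[abs_def] v_def)
    qed (use \<open>T > 0\<close> integrable_continuous_Icc[OF cv] in auto)
  qed
  have nz: "x t \<noteq> 0" for t using norm_X[of "\<sigma> t"] q_pos[of "\<sigma> t"] by (auto simp: x_def)
  have polar: "x t = of_real (norm (x t)) * cis (\<theta> (\<sigma> t))" for t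
    unfolding x_def norm_X by (simp add: X_def)
  have \<theta>_ends: "\<theta> (-P0) = \<phi>m" "\<theta> P0 = \<phi>p"
    using \<kappa> by (auto simp: \<theta>_def \<phi>0_def arctan_minus field_simps)
  define r where "r = norm (xbar \<alpha> m \<phi>m \<phi>p T)"
  have RP: "r = (P0\<^sup>2 + \<epsilon>\<^sup>2) powr (\<beta> / 2)"
    using \<open>0 < P\<close> unfolding r_def R P by (simp add: powr_powr flip: powr_numeral)
  have xb: "xbar \<alpha> m \<phi>m \<phi>p T = of_real r * cis \<phi>p" "xbar \<alpha> m \<phi>m \<phi>p (-T) = of_real r * cis \<phi>m"
    using \<open>T > 0\<close> by (auto simp: xbar_def norm_mult r_def)
  have x_in: "x \<in> Gamma_star \<alpha> m \<phi>m \<phi>p T"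
    unfolding Gamma_star_def
  proof (intro CollectI conjI ballI exI[of _ "\<lambda>t. \<theta> (\<sigma> t)"])
    show "continuous_on {-T..T} (\<lambda>t. \<theta> (\<sigma> t))" by (intro continuous_on_compose2[OF c\<theta> \<sigma>(1)]) auto
    show "x (-T) = xbar \<alpha> m \<phi>m \<phi>p (-T)" "x T = xbar \<alpha> m \<phi>m \<phi>p T"
      unfolding xb RP by (simp_all add: x_def X_def \<sigma> \<theta>_ends)
  qed (use nz polar \<theta>_ends \<sigma> H1I[OF xv] in auto)
  define E where "E s = (\<beta>\<^sup>2 / (2 * \<gamma>) + m * \<gamma> / \<alpha>) * s - \<beta>\<^sup>2 / (2 * \<gamma>) * (1 - \<kappa>\<^sup>2) * \<epsilon> * arctan (s / \<epsilon>)" for s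
  define E' where "E' s = (\<beta>\<^sup>2 / (2 * \<gamma>) + m * \<gamma> / \<alpha>) - \<beta>\<^sup>2 / (2 * \<gamma>) * (1 - \<kappa>\<^sup>2) * \<epsilon> * (\<epsilon> / (s\<^sup>2 + \<epsilon>\<^sup>2))" for s
  have E_der: "(E has_real_derivative E' s) (at s)" for s
    unfolding E_def E'_def
    using DERIV_diff[OF DERIV_cmult[OF DERIV_ident, of "\<beta>\<^sup>2 / (2 * \<gamma>) + m * \<gamma> / \<alpha>"]
      DERIV_cmult[OF arctan_der, of "\<beta>\<^sup>2 / (2 * \<gamma>) * (1 - \<kappa>\<^sup>2) * \<epsilon>"]] by simp
  have lag: "(norm (v t))\<^sup>2 / 2 + potential \<alpha> m (x t) = 1 / (\<gamma> * g (\<sigma> t)) * E' (\<sigma> t)" for t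
  proof -
    define s where "s = \<sigma> t"
    define q where "q = s\<^sup>2 + \<epsilon>\<^sup>2"
    have q: "q > 0" using q_pos[of s] by (simp add: q_def)
    have "(q powr (\<beta> / 2 - 1))\<^sup>2 = q powr (\<beta> - 1) / q"
    proof -
      have "(q powr (\<beta> / 2 - 1))\<^sup>2 = q powr ((\<beta> - 1) - 1)" by (simp add: power2_eq_square flip: powr_add)
      also have "\<dots> = q powr (\<beta> - 1) / q powr 1" by (rule powr_diff)
      finally show ?thesis using q by simp
    qed
    then have "(norm (X' s))\<^sup>2 = \<beta>\<^sup>2 * (g s / q) * (s\<^sup>2 + \<kappa>\<^sup>2 * \<epsilon>\<^sup>2)"
      using \<beta>(1) by (simp add: X'_def norm_mult power_mult_distrib cmod_power2 g_def flip: q_def)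
    then have "(norm (v t))\<^sup>2 / 2 = 1 / (\<gamma> * g s)\<^sup>2 * (\<beta>\<^sup>2 * (g s / q) * (s\<^sup>2 + \<kappa>\<^sup>2 * \<epsilon>\<^sup>2)) / 2"
      by (simp add: v_def s_def power_mult_distrib power_divide)
    also have "\<dots> = 1 / (\<gamma> * g s) * (\<beta>\<^sup>2 / (2 * \<gamma>) * ((s\<^sup>2 + \<kappa>\<^sup>2 * \<epsilon>\<^sup>2) / q))"
    proof -
      have "1 / (c * h)\<^sup>2 * (b * (h / q) * r) / 2 = 1 / (c * h) * (b / (2 * c) * (r / q))"
        if "c > 0" "h > 0" for b c h r :: real
        using that q by (simp add: power2_eq_square field_simps)
      then show ?thesis using \<gamma> g_pos[of s] by blast
    qed
    also have "(s\<^sup>2 + \<kappa>\<^sup>2 * \<epsilon>\<^sup>2) / q = 1 - (1 - \<kappa>\<^sup>2) * \<epsilon> * (\<epsilon> / q)"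
      using q by (simp add: field_simps) (simp add: q_def power2_eq_square algebra_simps)
    finally have kin: "(norm (v t))\<^sup>2 / 2 = 1 / (\<gamma> * g s) * (\<beta>\<^sup>2 / (2 * \<gamma>) * (1 - (1 - \<kappa>\<^sup>2) * \<epsilon> * (\<epsilon> / q)))" .
    have "norm (x t) powr \<alpha> = g s"
    proof -
      have "\<beta> / 2 * \<alpha> = \<beta> - 1" using \<beta>(2) by (simp add: mult.commute[of \<beta>])
      moreover have "norm (x t) powr \<alpha> = (s\<^sup>2 + \<epsilon>\<^sup>2) powr (\<beta> / 2 * \<alpha>)"
        by (simp only: x_def s_def[symmetric] norm_X powr_powr)
      ultimately show ?thesis by (simp only: g_def)
    qed
    then have pot: "potential \<alpha> m (x t) = 1 / (\<gamma> * g s) * (m * \<gamma> / \<alpha>)"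
      using \<gamma> by (simp add: potential_def)
    have "c * (b * (1 - k * e * r)) + c * d = c * ((b + d) - b * k * e * r)" for b c d e k r :: real
      by (simp add: algebra_simps)
    then show ?thesis
      unfolding kin pot E'_def s_def[symmetric] q_def[symmetric] by blast
  qed
  have primE: "primitive_on (-T) T (\<lambda>t. E (\<sigma> t)) (\<lambda>t. (norm (v t))\<^sup>2 / 2 + potential \<alpha> m (x t))"
  proof (rule primitive_on_FTC)
    show "continuous_on {-T..T} (\<lambda>t. E (\<sigma> t))"
      by (rule continuous_on_compose2[OF _ \<sigma>(1), of UNIV])
        (auto intro!: continuous_at_imp_continuous_on DERIV_isCont[OF E_der])
    show "integrable (lebesgue_on {-T..T}) (\<lambda>t. (norm (v t))\<^sup>2 / 2 + potential \<alpha> m (x t))"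
      by (intro integrable_continuous_Icc continuous_intros cv continuous_on_potential cx nz \<open>0 < \<alpha>\<close>) auto
    fix t assume t: "-T < t" "t < T"
    show "((\<lambda>t. E (\<sigma> t)) has_vector_derivative (norm (v t))\<^sup>2 / 2 + potential \<alpha> m (x t)) (at t)"
      using DERIV_chain2[OF E_der \<sigma>(4)[OF t]]
      by (simp add: lag mult.commute flip: has_real_derivative_iff_has_vector_derivative)
  qed (use \<open>T > 0\<close> in simp)
  let ?M = "lebesgue_on {-T..T}"
  have "(L2_norm ?M v)\<^sup>2 / 2 + (LINT t|?M. potential \<alpha> m (x t)) = (LINT t|?M. (norm (v t))\<^sup>2 / 2 + potential \<alpha> m (x t))"
  proof -
    have "integrable ?M (\<lambda>t. (norm (v t))\<^sup>2 / 2)" "integrable ?M (\<lambda>t. potential \<alpha> m (x t))"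
      by (intro integrable_continuous_Icc continuous_intros cv continuous_on_potential cx nz \<open>0 < \<alpha>\<close>; simp)+
    then show ?thesis by (simp add: L2_norm_square)
  qed
  also have "\<dots> = E P0 - E (-P0)"
    using primitive_on_increment[OF primE, of "-T" T] \<open>T > 0\<close> \<sigma> by simp
  also have "\<dots> = P0 * (2 * m * \<gamma> / \<alpha> + \<beta>\<^sup>2 / \<gamma>) - \<beta>\<^sup>2 / \<gamma> * ((1 - \<kappa>\<^sup>2) * \<epsilon> * arctan (P0 / \<epsilon>))"
  proof -
    have "E P0 - E (-P0) = 2 * (\<beta>\<^sup>2 / (2 * \<gamma>) + m * \<gamma> / \<alpha>) * P0 - 2 * (\<beta>\<^sup>2 / (2 * \<gamma>) * (1 - \<kappa>\<^sup>2) * \<epsilon> * arctan (P0 / \<epsilon>))"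
    proof -
      have "((b + d) * p - b * k * e * r) - ((b + d) * (- p) - b * k * e * (- r)) = 2 * (b + d) * p - 2 * (b * k * e * r)"
        for b d p k e r :: real by (simp add: algebra_simps)
      then show ?thesis unfolding E_def minus_divide_left[symmetric] arctan_minus .
    qed
    also have "\<dots> = P0 * (2 * (m * \<gamma> / \<alpha>) + 2 * (\<beta>\<^sup>2 / (2 * \<gamma>))) - 2 * (\<beta>\<^sup>2 / (2 * \<gamma>)) * ((1 - \<kappa>\<^sup>2) * \<epsilon> * arctan (P0 / \<epsilon>))"
      by (simp only: distrib_left distrib_right mult_ac add_ac)
    finally show ?thesis by (simp add: mult.assoc)
  qed
  finally have val: "(L2_norm ?M v)\<^sup>2 / 2 + (LINT t|?M. potential \<alpha> m (x t)) =
    P0 * (2 * m * \<gamma> / \<alpha> + \<beta>\<^sup>2 / \<gamma>) - \<beta>\<^sup>2 / \<gamma> * ((1 - \<kappa>\<^sup>2) * \<epsilon> * arctan (P0 / \<epsilon>))" .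
  show ?thesis
  proof (rule bexI[OF _ x_in])
    show "action \<alpha> m T x = ennreal (P0 * (2 * m * \<gamma> / \<alpha> + \<beta>\<^sup>2 / \<gamma>) - \<beta>\<^sup>2 / \<gamma> * ((1 - \<kappa>\<^sup>2) * \<epsilon> * arctan (P0 / \<epsilon>)))"
      unfolding val[symmetric] using nz by (intro action_eq_real assms(1,2) xv)
  qed
qed

text \<open>
  From \<open>|s| \<le> \<surd>(s\<^sup>2 + \<epsilon>\<^sup>2) \<le> |s| + \<epsilon>\<close> and \<open>P - \<epsilon> \<le> P0 \<le> P\<close>. The bounds show that the travel time differs
  from that of the collision-ejection solution by a term of order \<open>\<epsilon>\<close> only.
\<close>

lemma bent_time_bounds:
  fixes P P0 \<epsilon> \<beta> :: real
  assumes "1 \<le> \<beta>" "0 < \<epsilon>" "\<epsilon> < P" "0 < P0" and P: "P0\<^sup>2 + \<epsilon>\<^sup>2 = P\<^sup>2"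
  defines "J \<equiv> integral {-P0..P0} (\<lambda>s. (s\<^sup>2 + \<epsilon>\<^sup>2) powr (\<beta> - 1))"
  shows "2 * (P - \<epsilon>) powr (2 * \<beta> - 1) / (2 * \<beta> - 1) \<le> J"
    "J \<le> 2 * (P + \<epsilon>) powr (2 * \<beta> - 1) / (2 * \<beta> - 1)"
proof -
  define g where "g s = (s\<^sup>2 + \<epsilon>\<^sup>2) powr (\<beta> - 1)" for s
  define H where "H = integral {0..P0} g"
  have q_pos: "0 < s\<^sup>2 + \<epsilon>\<^sup>2" for s using \<open>0 < \<epsilon>\<close> by (intro add_nonneg_pos) auto
  have cg: "continuous_on S g" for S
    unfolding g_def using \<open>0 < \<epsilon>\<close> by (intro continuous_intros) auto
  have gH: "(g has_integral H) {0..P0}"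
    unfolding H_def using integrable_continuous_interval[OF cg] by (rule integrable_integral)
  then have "((\<lambda>s. g (- s)) has_integral H) {-P0..-0}" by (subst has_integral_reflect_real)
  then have "(g has_integral H) {-P0..0}" by (simp add: g_def[abs_def])
  from has_integral_combine[OF _ _ this gH] have JH: "J = 2 * H"
    using \<open>0 < P0\<close> by (simp add: J_def integral_unique g_def[abs_def])
  have P0_le: "P0 \<le> P"
  proof (rule power2_le_imp_le)
    show "P0\<^sup>2 \<le> P\<^sup>2" using P zero_le_power2[of \<epsilon>] by linarith
  qed (use \<open>0 < \<epsilon>\<close> \<open>\<epsilon> < P\<close> in simp)
  have P0_ge: "P - \<epsilon> \<le> P0"
  proof (rule power2_le_imp_le)
    have "(P - \<epsilon>)\<^sup>2 = P\<^sup>2 - \<epsilon>\<^sup>2 - 2 * (\<epsilon> * (P - \<epsilon>))" by (simp add: power2_eq_square algebra_simps)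
    also have "\<dots> \<le> P0\<^sup>2"
    proof -
      have "0 \<le> \<epsilon> * (P - \<epsilon>)" using \<open>0 < \<epsilon>\<close> \<open>\<epsilon> < P\<close> by simp
      then show ?thesis using P by linarith
    qed
    finally show "(P - \<epsilon>)\<^sup>2 \<le> P0\<^sup>2" .
  qed (use \<open>0 < P0\<close> in simp)
  have "P0 powr (2 * \<beta> - 2 + 1) / (2 * \<beta> - 2 + 1) \<le> H"
  proof (rule has_integral_le[OF has_integral_powr_from_0 gH])
    fix s assume s: "s \<in> {0..P0}"
    have "s powr (2 * \<beta> - 2) = (s\<^sup>2) powr (\<beta> - 1)"
      using s by (cases "s = 0") (auto simp: powr_powr algebra_simps simp flip: powr_numeral)
    also have "\<dots> \<le> g s" unfolding g_def using \<open>1 \<le> \<beta>\<close> by (intro powr_mono2) auto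
    finally show "s powr (2 * \<beta> - 2) \<le> g s" .
  qed (use assms in auto)
  moreover have "(P - \<epsilon>) powr (2 * \<beta> - 1) \<le> P0 powr (2 * \<beta> - 1)"
    using P0_ge assms by (intro powr_mono2) auto
  then have "(P - \<epsilon>) powr (2 * \<beta> - 1) / (2 * \<beta> - 1) \<le> P0 powr (2 * \<beta> - 1) / (2 * \<beta> - 1)"
    using assms by (intro divide_right_mono) auto
  ultimately show "2 * (P - \<epsilon>) powr (2 * \<beta> - 1) / (2 * \<beta> - 1) \<le> J"
    unfolding JH by simp
  have "((\<lambda>s. (s + \<epsilon>) powr (2 * \<beta> - 2)) has_integral
      (P0 + \<epsilon>) powr (2 * \<beta> - 1) / (2 * \<beta> - 1) - (0 + \<epsilon>) powr (2 * \<beta> - 1) / (2 * \<beta> - 1)) {0..P0}"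
  proof (rule fundamental_theorem_of_calculus)
    fix s assume s: "s \<in> {0..P0}"
    have "((\<lambda>s. (s + \<epsilon>) powr (2 * \<beta> - 1)) has_real_derivative (2 * \<beta> - 1) * (s + \<epsilon>) powr (2 * \<beta> - 1 - 1) * 1) (at s)"
      by (rule DERIV_chain2[OF has_real_derivative_powr]) (use s \<open>0 < \<epsilon>\<close> in \<open>auto intro!: derivative_eq_intros\<close>)
    from DERIV_cdivide[OF this, of "2 * \<beta> - 1"]
    have "((\<lambda>s. (s + \<epsilon>) powr (2 * \<beta> - 1) / (2 * \<beta> - 1)) has_real_derivative (s + \<epsilon>) powr (2 * \<beta> - 2)) (at s)"
      using \<open>1 \<le> \<beta>\<close> by simp
    then show "((\<lambda>s. (s + \<epsilon>) powr (2 * \<beta> - 1) / (2 * \<beta> - 1)) has_vector_derivative (s + \<epsilon>) powr (2 * \<beta> - 2)) (at s within {0..P0})"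
      by (simp add: has_real_derivative_iff_has_vector_derivative has_vector_derivative_at_within)
  qed (use \<open>0 < P0\<close> in simp)
  note H_upper = has_integral_le[OF gH this]
  have "H \<le> (P0 + \<epsilon>) powr (2 * \<beta> - 1) / (2 * \<beta> - 1) - (0 + \<epsilon>) powr (2 * \<beta> - 1) / (2 * \<beta> - 1)"
  proof -
    have "g s \<le> (s + \<epsilon>) powr (2 * \<beta> - 2)" if s: "s \<in> {0..P0}" for s
    proof -
      have "g s \<le> ((s + \<epsilon>)\<^sup>2) powr (\<beta> - 1)"
        unfolding g_def using \<open>1 \<le> \<beta>\<close> s \<open>0 < \<epsilon>\<close> by (intro powr_mono2) (auto simp: power2_sum)
      also have "\<dots> = (s + \<epsilon>) powr (2 * \<beta> - 2)"
        using s \<open>0 < \<epsilon>\<close> by (simp add: powr_powr algebra_simps flip: powr_numeral)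
      finally show ?thesis .
    qed
    then show ?thesis by (rule H_upper)
  qed
  also have "\<dots> \<le> (P + \<epsilon>) powr (2 * \<beta> - 1) / (2 * \<beta> - 1)"
  proof -
    have "(P0 + \<epsilon>) powr (2 * \<beta> - 1) \<le> (P + \<epsilon>) powr (2 * \<beta> - 1)"
      using P0_le assms by (intro powr_mono2) auto
    then have "(P0 + \<epsilon>) powr (2 * \<beta> - 1) / (2 * \<beta> - 1) \<le> (P + \<epsilon>) powr (2 * \<beta> - 1) / (2 * \<beta> - 1)"
      using \<open>1 \<le> \<beta>\<close> by (intro divide_right_mono) auto
    moreover have "0 \<le> (0 + \<epsilon>) powr (2 * \<beta> - 1) / (2 * \<beta> - 1)" using \<open>1 \<le> \<beta>\<close> by simp
    ultimately show ?thesis by linarith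
  qed
  finally show "J \<le> 2 * (P + \<epsilon>) powr (2 * \<beta> - 1) / (2 * \<beta> - 1)"
    unfolding JH by simp
qed

lemma DERIV_imp_square_quotient_tendsto_0:
  fixes f :: "real \<Rightarrow> real"
  assumes "(f has_real_derivative D) (at 0)"
  shows "((\<lambda>x. (f x - f 0)\<^sup>2 / x) \<longlongrightarrow> 0) (at_right 0)"
proof -
  have "((\<lambda>x. (f (0 + x) - f 0) / x) \<longlongrightarrow> D) (at 0)"
    using assms by (simp only: DERIV_def)
  then have "((\<lambda>x. (f x - f 0) / x) \<longlongrightarrow> D) (at_right 0)"
    by (simp add: filterlim_at_split)
  then have "((\<lambda>x. ((f x - f 0) / x)\<^sup>2 * x) \<longlongrightarrow> D\<^sup>2 * 0) (at_right 0)"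
    by (intro tendsto_intros)
  then have "((\<lambda>x. ((f x - f 0) / x)\<^sup>2 * x) \<longlongrightarrow> 0) (at_right 0)" by simp
  then show ?thesis
  proof (rule Lim_transform_eventually)
    show "\<forall>\<^sub>F x in at_right 0. ((f x - f 0) / x)\<^sup>2 * x = (f x - f 0)\<^sup>2 / x"
      using eventually_at_right_less[of "0::real"]
      by eventually_elim (simp add: power_divide power2_eq_square)
  qed
qed

lemma arctan_quotient_tendsto:
  "((\<lambda>x. arctan (sqrt (1 - x\<^sup>2) / x)) \<longlongrightarrow> pi / 2) (at_right (0::real))"
proof -
  have "((\<lambda>x. sqrt (1 - x\<^sup>2)) \<longlongrightarrow> sqrt (1 - 0\<^sup>2)) (at_right (0::real))" by (intro tendsto_intros)
  then have "filterlim (\<lambda>x. sqrt (1 - x\<^sup>2) * inverse x) at_top (at_right (0::real))"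
    by (rule filterlim_tendsto_pos_mult_at_top[OF _ _ filterlim_inverse_at_top_right]) simp
  then have "filterlim (\<lambda>x. sqrt (1 - x\<^sup>2) / x) at_top (at_right (0::real))"
    by (simp add: divide_inverse)
  from filterlim_compose[OF tendsto_arctan_at_top this] show ?thesis .
qed

text \<open>
  Cutting the corner at distance \<open>\<epsilon>\<close> from the apex shortens the path by a multiple of \<open>\<epsilon>\<close>. The clock has to
  be rescaled by a factor \<open>s = 1 + O(\<epsilon>)\<close> to keep the time \<open>2 T\<close>; since \<open>s + 1/s\<close> is minimal at \<open>s = 1\<close>, this costs
  only \<open>O(\<epsilon>\<^sup>2)\<close>. For small \<open>\<epsilon>\<close> the gain prevails.
\<close>

lemma bent_path_beats_collision:
  assumes "m > 0" "0 < \<alpha>" "\<alpha> < 2" "T > 0" and \<Delta>: "\<bar>\<phi>p - \<phi>m\<bar> < 2 * pi / (2 - \<alpha>)"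
  shows "\<exists>x\<in>Gamma_star \<alpha> m \<phi>m \<phi>p T.
    action \<alpha> m T x < ennreal (2 * radial_cost \<alpha> m (norm (xbar \<alpha> m \<phi>m \<phi>p T)))"
proof -
  define \<beta> where "\<beta> = 2 / (2 - \<alpha>)"
  define q where "q = 2 * \<beta> - 1"
  define \<mu> where "\<mu> = parabolic_mu \<alpha> m"
  define a where "a = 2 / (\<alpha> + 2)"
  define R where "R = norm (xbar \<alpha> m \<phi>m \<phi>p T)"
  define P where "P = R powr (1 / \<beta>)"
  define k where "k = \<beta> * sqrt (2 * m / \<alpha>)"
  define \<gamma>0 where "\<gamma>0 = \<beta> * sqrt (\<alpha> / (2 * m))"
  define \<Delta> where "\<Delta> = \<phi>p - \<phi>m"
  have \<beta>: "\<beta> > 0" "1 \<le> \<beta>" "1 / \<beta> = 1 - \<alpha> / 2" "1 / (1 - \<alpha> / 2) = \<beta>" using assms by (auto simp: \<beta>_def field_simps)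
  have q: "q > 0" "q = (\<alpha> + 2) / (2 - \<alpha>)" using \<beta>(2) assms by (auto simp: q_def \<beta>_def field_simps)
  have \<Delta>_lt: "\<bar>\<Delta>\<bar> < \<beta> * pi" using \<Delta> by (simp add: \<Delta>_def \<beta>_def)
  have \<mu>: "\<mu> > 0" unfolding \<mu>_def by (rule parabolic_mu_pos[OF assms(1-3)])
  have R: "R = (\<mu> * T) powr a"
    using \<open>T > 0\<close> \<mu> norm_xbar[OF assms(1-3), of \<phi>m \<phi>p T] by (simp add: R_def \<mu>_def a_def powr_mult)
  have R_pos: "R > 0" using R \<mu> \<open>T > 0\<close> by simp
  have P_pos: "P > 0" using R_pos by (simp add: P_def)
  have P\<beta>: "P powr \<beta> = R" using R_pos \<beta>(1) by (simp add: P_def powr_powr)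
  have k: "k > 0" using \<beta>(1) assms by (simp add: k_def)
  have \<gamma>0: "\<gamma>0 > 0" using \<beta>(1) assms by (simp add: \<gamma>0_def)
  have cost: "radial_cost \<alpha> m R = k * P"
  proof -
    have "sqrt (2 * m / \<alpha>) / (1 - \<alpha> / 2) = sqrt (2 * m / \<alpha>) * (1 / (1 - \<alpha> / 2))" by simp
    then show ?thesis by (simp only: radial_cost_def k_def P_def \<beta>(3,4)) simp
  qed
  have sqrt_inv: "sqrt (2 * m / \<alpha>) * sqrt (\<alpha> / (2 * m)) = 1"
    using assms by (simp flip: real_sqrt_mult)
  \<comment> \<open>\<open>\<gamma>0\<close> is the clock rate of energy zero: at \<open>\<gamma> = \<gamma>0\<close> the kinetic and the potential part of the
    action are equal.\<close>
  have k1: "2 * m * \<gamma>0 / \<alpha> = k"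
  proof -
    define r where "r = sqrt (2 * m / \<alpha>)"
    define r' where "r' = sqrt (\<alpha> / (2 * m))"
    have "r * r = 2 * m / \<alpha>" using assms by (simp add: r_def)
    then have "2 * m * \<gamma>0 / \<alpha> = r * r * (\<beta> * r')" by (simp add: \<gamma>0_def r'_def)
    also have "\<dots> = \<beta> * r * (r * r')" by (simp only: mult_ac)
    also have "r * r' = 1" using sqrt_inv by (simp only: r_def r'_def)
    finally show ?thesis by (simp add: k_def r_def)
  qed
  have k2: "\<beta>\<^sup>2 / \<gamma>0 = k"
  proof -
    have "k * \<gamma>0 = \<beta>\<^sup>2 * (sqrt (2 * m / \<alpha>) * sqrt (\<alpha> / (2 * m)))"
      by (simp only: k_def \<gamma>0_def power2_eq_square mult_ac)
    then show ?thesis using \<gamma>0 by (simp only: sqrt_inv mult_1_right divide_eq_eq) simp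
  qed
  \<comment> \<open>The collision-ejection solution needs the time \<open>T\<close> from the origin to cone radius \<open>P\<close>.\<close>
  have T\<gamma>0: "T / \<gamma>0 = P powr q / q"
  proof -
    have exponent: "a * (1 / \<beta>) * q = 1"
    proof -
      have "2 / u * (w / 2) * (u / w) = 1" if "u \<noteq> 0" "w \<noteq> 0" for u w :: real using that by simp
      moreover have "1 - \<alpha> / 2 = (2 - \<alpha>) / 2" by simp
      ultimately show ?thesis using assms unfolding a_def \<beta>(3) q(2) by simp
    qed
    have "P powr q = (\<mu> * T) powr (a * (1 / \<beta>) * q)"
      by (simp only: P_def R powr_powr)
    then have "P powr q = \<mu> * T"
      unfolding exponent using \<mu> \<open>T > 0\<close> by simp
    moreover have "\<mu> * \<gamma>0 = q"
    proof -
      have "sqrt (m / (2 * \<alpha>)) * sqrt (\<alpha> / (2 * m)) = 1 / 2"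
      proof -
        have "m / (2 * \<alpha>) * (\<alpha> / (2 * m)) = (1/2)\<^sup>2" using assms by (simp add: power2_eq_square)
        then show ?thesis by (simp only: real_sqrt_mult[symmetric]) simp
      qed
      moreover have "\<mu> * \<gamma>0 = (\<alpha> + 2) * \<beta> * (sqrt (m / (2 * \<alpha>)) * sqrt (\<alpha> / (2 * m)))"
        by (simp only: \<mu>_def parabolic_mu_def \<gamma>0_def mult_ac)
      moreover have "u * (2 / w) * (1 / 2) = u / w" for u w :: real by simp
      ultimately show ?thesis by (simp only: q(2) \<beta>_def)
    qed
    ultimately show ?thesis using \<gamma>0 q(1) \<mu> by (simp add: field_simps)
  qed
  define A where "A x = arctan (sqrt (1 - x\<^sup>2) / x)" for x :: real
  \<comment> \<open>Half of the limit of the relative gain in length as the corner is cut closer and closer to the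
    apex. It is positive because the angle at the apex is less than \<open>pi\<close>.\<close>
  define c where "c = (1 - (\<Delta> / (2 * \<beta> * (pi / 2)))\<^sup>2) * (pi / 2) / 2"
  have c: "c > 0"
  proof -
    have "\<bar>\<Delta> / (2 * \<beta> * (pi / 2))\<bar> < 1" using \<Delta>_lt \<beta>(1) by (simp add: abs_mult)
    then have "(\<Delta> / (2 * \<beta> * (pi / 2)))\<^sup>2 < 1" by (simp only: abs_square_less_1)
    then show ?thesis by (simp add: c_def)
  qed
  have ev1: "\<forall>\<^sub>F x in at_right 0. ((1 - x) powr (- q) - 1)\<^sup>2 / x < c"
  proof -
    have "((\<lambda>x. (1 - x) powr (- q)) has_real_derivative - q * (1 - 0) powr (- q - 1) * (- 1)) (at 0)"
      by (rule DERIV_chain2[where f = "\<lambda>z. z powr (- q)" and g = "\<lambda>x. 1 - x"])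
        (auto intro!: derivative_eq_intros)
    from order_tendstoD(2)[OF DERIV_imp_square_quotient_tendsto_0[OF this] c] show ?thesis by simp
  qed
  have ev2: "\<forall>\<^sub>F x in at_right 0. ((1 + x) powr (- q) - 1)\<^sup>2 / x < c"
  proof -
    have "((\<lambda>x. (1 + x) powr (- q)) has_real_derivative - q * (1 + 0) powr (- q - 1) * 1) (at 0)"
      by (rule DERIV_chain2[where f = "\<lambda>z. z powr (- q)" and g = "\<lambda>x. 1 + x"])
        (auto intro!: derivative_eq_intros)
    from order_tendstoD(2)[OF DERIV_imp_square_quotient_tendsto_0[OF this] c] show ?thesis by simp
  qed
  have ev3: "\<forall>\<^sub>F x in at_right 0. c < (1 - (\<Delta> / (2 * \<beta> * A x))\<^sup>2) * A x"
  proof (rule order_tendstoD(1))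
    show "((\<lambda>x. (1 - (\<Delta> / (2 * \<beta> * A x))\<^sup>2) * A x) \<longlongrightarrow> (1 - (\<Delta> / (2 * \<beta> * (pi / 2)))\<^sup>2) * (pi / 2)) (at_right 0)"
      unfolding A_def using \<beta>(1) by (intro tendsto_intros arctan_quotient_tendsto) auto
    show "c < (1 - (\<Delta> / (2 * \<beta> * (pi / 2)))\<^sup>2) * (pi / 2)"
    proof -
      have "(1 - (\<Delta> / (2 * \<beta> * (pi / 2)))\<^sup>2) * (pi / 2) = 2 * c" by (simp only: c_def)
      then show ?thesis using c by simp
    qed
  qed
  have "\<forall>\<^sub>F x in at_right (0::real). x \<in> {0<..<1}" by (rule eventually_at_right_real) simp
  with ev1 ev2 ev3 have "\<forall>\<^sub>F x in at_right 0. ((1 - x) powr (- q) - 1)\<^sup>2 / x < c \<and>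
      ((1 + x) powr (- q) - 1)\<^sup>2 / x < c \<and> c < (1 - (\<Delta> / (2 * \<beta> * A x))\<^sup>2) * A x \<and> x \<in> {0<..<1}"
    by eventually_elim auto
  then obtain \<eta> where \<eta>: "((1 - \<eta>) powr (- q) - 1)\<^sup>2 / \<eta> < c" "((1 + \<eta>) powr (- q) - 1)\<^sup>2 / \<eta> < c"
      "c < (1 - (\<Delta> / (2 * \<beta> * A \<eta>))\<^sup>2) * A \<eta>" "0 < \<eta>" "\<eta> < 1"
    using eventually_happens'[OF trivial_limit_at_right_real] by force
  \<comment> \<open>The curve ends on the circle of cone radius \<open>P\<close>: \<open>P0\<close> is half of its parameter interval.\<close>
  define \<epsilon> where "\<epsilon> = P * \<eta>"
  define P0 where "P0 = P * sqrt (1 - \<eta>\<^sup>2)"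
  define \<kappa> where "\<kappa> = \<Delta> / (2 * \<beta> * A \<eta>)"
  have \<epsilon>: "0 < \<epsilon>" "\<epsilon> < P" using P_pos \<eta>(4,5) by (auto simp: \<epsilon>_def)
  have \<eta>2: "\<eta>\<^sup>2 < 1" using \<eta>(4,5) by (simp add: power_less_one_iff)
  have P0: "0 < P0" "P0 \<le> P" "P0\<^sup>2 + \<epsilon>\<^sup>2 = P\<^sup>2"
  proof -
    show "0 < P0" using P_pos \<eta>2 by (simp add: P0_def)
    show "P0 \<le> P" using P_pos \<eta>2 by (simp add: P0_def)
    show "P0\<^sup>2 + \<epsilon>\<^sup>2 = P\<^sup>2" using \<eta>2 by (simp add: P0_def \<epsilon>_def power_mult_distrib algebra_simps)
  qed
  have A_eq: "arctan (P0 / \<epsilon>) = A \<eta>" using P_pos by (simp add: A_def P0_def \<epsilon>_def)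
  have A_pos: "0 < A \<eta>" using P0(1) \<epsilon>(1) by (simp flip: A_eq)
  define J where "J = integral {-P0..P0} (\<lambda>s. (s\<^sup>2 + \<epsilon>\<^sup>2) powr (\<beta> - 1))"
  define \<gamma> where "\<gamma> = 2 * T / J"
  define s where "s = \<gamma> / \<gamma>0"
  have J_bounds: "2 * (P - \<epsilon>) powr q / q \<le> J" "J \<le> 2 * (P + \<epsilon>) powr q / q"
    unfolding J_def q_def by (rule bent_time_bounds[OF \<beta>(2) \<epsilon> P0(1,3)])+
  have J_pos: "J > 0"
    using J_bounds(1) \<epsilon>(2) q(1) by (intro less_le_trans[OF _ J_bounds(1)]) simp
  have \<gamma>_pos: "\<gamma> > 0" and s_pos: "s > 0" using J_pos \<open>T > 0\<close> \<gamma>0 by (auto simp: \<gamma>_def s_def)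
  have \<gamma>_eq: "\<gamma> = \<gamma>0 * s" using \<gamma>0 by (simp add: s_def)
  \<comment> \<open>The factor \<open>s\<close> by which the clock has to be rescaled is the ratio of the travel times.\<close>
  have sJ: "s * J = 2 * P powr q / q"
  proof -
    have "s * J = 2 * (T / \<gamma>0)" using J_pos by (simp add: s_def \<gamma>_def)
    then show ?thesis by (simp add: T\<gamma>0)
  qed
  have s_up: "s \<le> (1 - \<eta>) powr (- q)"
  proof -
    have "P - \<epsilon> = P * (1 - \<eta>)" by (simp add: \<epsilon>_def algebra_simps)
    then have "s * (2 * (P powr q * (1 - \<eta>) powr q) / q) \<le> s * J"
      using J_bounds(1) s_pos P_pos \<eta>(5) by (intro mult_left_mono) (simp_all add: powr_mult)
    then have "s * (1 - \<eta>) powr q * (2 * P powr q / q) \<le> 1 * (2 * P powr q / q)"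
      unfolding sJ by (simp add: mult_ac)
    then have "s * (1 - \<eta>) powr q \<le> 1"
      using P_pos q(1) by (subst (asm) mult_le_cancel_right_pos) auto
    then show ?thesis using \<eta>(5) by (simp add: powr_minus_divide pos_le_divide_eq)
  qed
  have s_low: "(1 + \<eta>) powr (- q) \<le> s"
  proof -
    have "P + \<epsilon> = P * (1 + \<eta>)" by (simp add: \<epsilon>_def algebra_simps)
    then have "s * J \<le> s * (2 * (P powr q * (1 + \<eta>) powr q) / q)"
      using J_bounds(2) s_pos P_pos \<eta>(4) by (intro mult_left_mono) (simp_all add: powr_mult)
    then have "1 * (2 * P powr q / q) \<le> s * (1 + \<eta>) powr q * (2 * P powr q / q)"
      unfolding sJ by (simp add: mult_ac)
    then have "1 \<le> s * (1 + \<eta>) powr q"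
      using P_pos q(1) by (subst (asm) mult_le_cancel_right_pos) auto
    then show ?thesis using \<eta>(4) by (simp add: powr_minus_divide pos_divide_le_eq)
  qed
  have s_close: "(s - 1)\<^sup>2 < c * \<eta>"
  proof (cases "1 \<le> s")
    case True
    then have "(s - 1)\<^sup>2 \<le> ((1 - \<eta>) powr (- q) - 1)\<^sup>2" using s_up by (intro power_mono) auto
    also have "\<dots> < c * \<eta>" using \<eta>(1,4) by (simp add: pos_divide_less_eq)
    finally show ?thesis .
  next
    case False
    then have "(1 - s)\<^sup>2 \<le> (1 - (1 + \<eta>) powr (- q))\<^sup>2" using s_low by (intro power_mono) auto
    also have "\<dots> < c * \<eta>" using \<eta>(2,4) by (simp add: pos_divide_less_eq power2_commute)
    finally show ?thesis by (simp add: power2_commute)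
  qed
  define Q where "Q = (1 - \<kappa>\<^sup>2) * \<epsilon> * arctan (P0 / \<epsilon>)"
  have Q: "P * (s - 1)\<^sup>2 < Q"
  proof -
    have "P * (s - 1)\<^sup>2 < P * (c * \<eta>)" using s_close P_pos by simp
    also have "\<dots> = \<epsilon> * c" by (simp add: \<epsilon>_def)
    also have "\<dots> < \<epsilon> * ((1 - \<kappa>\<^sup>2) * A \<eta>)" using \<eta>(3) \<epsilon>(1) by (simp add: \<kappa>_def)
    finally show ?thesis by (simp add: Q_def A_eq mult_ac)
  qed
  define f where "f = P0 * (2 * m * \<gamma> / \<alpha> + \<beta>\<^sup>2 / \<gamma>) - \<beta>\<^sup>2 / \<gamma> * Q"
  have "f < 2 * (k * P)"
  proof -
    have e1: "2 * m * \<gamma> / \<alpha> = k * s" unfolding k1[symmetric] \<gamma>_eq by simp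
    have e2: "\<beta>\<^sup>2 / \<gamma> = k / s" unfolding k2[symmetric] \<gamma>_eq by simp
    have "f * s = k * (P0 * (s\<^sup>2 + 1) - Q)"
      unfolding f_def e1 e2 using s_pos by (simp add: power2_eq_square field_simps)
    also have "\<dots> \<le> k * (P * (s\<^sup>2 + 1) - Q)"
      using k P0(2) by (intro mult_left_mono diff_right_mono mult_right_mono) auto
    also have "\<dots> < k * (2 * P * s)"
    proof -
      have "P * (s\<^sup>2 + 1) - 2 * P * s = P * (s - 1)\<^sup>2" by (simp add: power2_eq_square algebra_simps)
      then show ?thesis using Q k by simp
    qed
    also have "\<dots> = 2 * (k * P) * s" by simp
    finally show ?thesis using s_pos by (simp only: mult_less_cancel_right_pos)
  qed
  moreover have "\<exists>x\<in>Gamma_star \<alpha> m \<phi>m \<phi>p T. action \<alpha> m T x = ennreal f"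
    unfolding f_def Q_def \<gamma>_def J_def \<beta>_def
  proof (rule bent_path_exists[OF assms(1-4) \<epsilon>(1) P0(1) P_pos P0(3)])
    show "norm (xbar \<alpha> m \<phi>m \<phi>p T) = P powr (2 / (2 - \<alpha>))" using P\<beta> by (simp add: R_def \<beta>_def)
    show "0 < integral {-P0..P0} (\<lambda>s. (s\<^sup>2 + \<epsilon>\<^sup>2) powr (2 / (2 - \<alpha>) - 1))"
      using J_pos by (simp add: J_def \<beta>_def)
    have "\<beta> * \<kappa> * arctan (P0 / \<epsilon>) = (\<phi>p - \<phi>m) / 2"
      unfolding A_eq \<kappa>_def \<Delta>_def using A_pos \<beta>(1) by simp
    then show "2 / (2 - \<alpha>) * \<kappa> * arctan (P0 / \<epsilon>) = (\<phi>p - \<phi>m) / 2" by (simp add: \<beta>_def)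
  qed
  moreover have "0 < 2 * (k * P)" using k P_pos by simp
  ultimately show ?thesis
    unfolding R_def[symmetric] cost by (metis ennreal_lessI)
qed

section \<open>Minimizers in the closure\<close>

lemma Gamma_star_subset_Gamma: "Gamma_star \<alpha> m \<phi>m \<phi>p T \<subseteq> Gamma \<alpha> m \<phi>m \<phi>p T"
proof
  fix x assume x: "x \<in> Gamma_star \<alpha> m \<phi>m \<phi>p T"
  then have "H1_weakly_converges T (\<lambda>_. x) x"
    by (auto simp: H1_weakly_converges_def Gamma_star_def)
  then show "x \<in> Gamma \<alpha> m \<phi>m \<phi>p T"
    using x unfolding Gamma_def H1_weak_closure_def by (intro CollectI exI[of _ "\<lambda>_. x"]) simp
qed

lemma norm_xbar_ends:
  assumes "m > 0" "0 < \<alpha>" "\<alpha> < 2"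
  shows "norm (xbar \<alpha> m \<phi>m \<phi>p (-T)) = norm (xbar \<alpha> m \<phi>m \<phi>p T)"
  by (simp add: norm_xbar[OF assms])

lemma collision_action_ge_xbar:
  assumes "m > 0" "0 < \<alpha>" "\<alpha> < 2" "T > 0" and x: "x \<in> Gamma \<alpha> m \<phi>m \<phi>p T" "s \<in> {-T..T}" "x s = 0"
  shows "action \<alpha> m T (xbar \<alpha> m \<phi>m \<phi>p) \<le> action \<alpha> m T x"
proof -
  note G = Gamma_cases[OF \<open>T > 0\<close> x(1)]
  have "ennreal (radial_cost \<alpha> m (norm (x (-T))) + radial_cost \<alpha> m (norm (x T))) \<le> action \<alpha> m T x"
    by (rule action_ge_collision[OF assms(1-3) has_H1_derivative_H1_deriv[OF G(1)] x(2,3)])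
  then show ?thesis
    by (simp add: action_xbar[OF assms(1-4)] G(2,3) norm_xbar_ends[OF assms(1-3)] mult_2[symmetric] del: ennreal_plus)
qed

text \<open>
  The radius \<open>e\<close> is chosen such that entering the disc of radius \<open>e\<close> costs more than a bound \<open>A1\<close> which the
  bent path respects.
\<close>

lemma noncollision_minimizer_exists:
  assumes "m > 0" "0 < \<alpha>" "\<alpha> < 2" "T > 0" and \<Delta>: "\<bar>\<phi>p - \<phi>m\<bar> < 2 * pi / (2 - \<alpha>)"
  shows "\<exists>\<gamma>\<in>Gamma_star \<alpha> m \<phi>m \<phi>p T. (\<forall>x\<in>Gamma_star \<alpha> m \<phi>m \<phi>p T. action \<alpha> m T \<gamma> \<le> action \<alpha> m T x) \<and>
    action \<alpha> m T \<gamma> < action \<alpha> m T (xbar \<alpha> m \<phi>m \<phi>p)"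
proof -
  define W where "W = radial_cost \<alpha> m (norm (xbar \<alpha> m \<phi>m \<phi>p T))"
  obtain x0 where x0: "x0 \<in> Gamma_star \<alpha> m \<phi>m \<phi>p T" "action \<alpha> m T x0 < ennreal (2 * W)"
    using bent_path_beats_collision[OF assms] by (auto simp: W_def)
  obtain A1 where A1: "action \<alpha> m T x0 < ennreal A1" "0 \<le> A1" "A1 < 2 * W"
  proof -
    obtain z where z: "action \<alpha> m T x0 < z" "z < ennreal (2 * W)" using dense[OF x0(2)] by blast
    then obtain r where "z = ennreal r" "0 \<le> r" by (cases z) auto
    then show thesis using z by (intro that[of r]) (auto simp: ennreal_less_iff)
  qed
  have "\<forall>\<^sub>F e in at_right 0. radial_cost \<alpha> m e < (2 * W - A1) / 2"
    using A1(3) by (intro order_tendstoD(2)[OF radial_cost_tendsto_0[OF assms(1-3)]]) simp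
  then have "\<forall>\<^sub>F e in at_right 0. radial_cost \<alpha> m e < (2 * W - A1) / 2 \<and> 0 < e"
    using eventually_at_right_less[of "0::real"] by eventually_elim simp
  then obtain e where e: "radial_cost \<alpha> m e < (2 * W - A1) / 2" "0 < e"
    using eventually_happens'[OF trivial_limit_at_right_real] by blast
  have far: "e \<le> norm (x t)" if x: "x \<in> Gamma_star \<alpha> m \<phi>m \<phi>p T" "action \<alpha> m T x \<le> ennreal A1" and t: "t \<in> {-T..T}" for x t
  proof (rule ccontr)
    assume "\<not> e \<le> norm (x t)"
    then have le: "norm (x t) \<le> e" by simp
    have x': "x \<in> H1 T" "x (-T) = xbar \<alpha> m \<phi>m \<phi>p (-T)" "x T = xbar \<alpha> m \<phi>m \<phi>p T"
      using x(1) by (auto simp: Gamma_star_def)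
    have "ennreal (W + W - 2 * radial_cost \<alpha> m e) \<le> action \<alpha> m T x"
      using action_ge_near_collision[OF assms(1-3) has_H1_derivative_H1_deriv[OF x'(1)] t le e(2)]
      by (simp only: x' norm_xbar_ends[OF assms(1-3)] W_def)
    also have "\<dots> \<le> ennreal A1" by (rule x(2))
    finally have "W + W - 2 * radial_cost \<alpha> m e \<le> A1" using A1(2) by (simp only: ennreal_le_iff)
    then show False using e(1) by simp
  qed
  have "\<exists>\<gamma>\<in>Gamma_star \<alpha> m \<phi>m \<phi>p T. \<forall>x\<in>Gamma_star \<alpha> m \<phi>m \<phi>p T. action \<alpha> m T \<gamma> \<le> action \<alpha> m T x"
    by (rule minimizer_exists[OF assms(1,2,4) e(2) _ x0(1) A1(1)]) (rule far)
  then obtain \<gamma> where \<gamma>: "\<gamma> \<in> Gamma_star \<alpha> m \<phi>m \<phi>p T"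
      "\<And>x. x \<in> Gamma_star \<alpha> m \<phi>m \<phi>p T \<Longrightarrow> action \<alpha> m T \<gamma> \<le> action \<alpha> m T x"
    by blast
  have "action \<alpha> m T \<gamma> < action \<alpha> m T (xbar \<alpha> m \<phi>m \<phi>p)"
    using order_le_less_trans[OF \<gamma>(2)[OF x0(1)] x0(2)] by (simp add: action_xbar[OF assms(1-4)] W_def)
  then show ?thesis using \<gamma> by blast
qed

lemma xbar_minimal_full_turn:
  assumes "m > 0" "T > 0" and \<Delta>: "\<bar>\<phi>p - \<phi>m\<bar> = 2 * pi" and x: "x \<in> Gamma 1 m \<phi>m \<phi>p T"
  shows "action 1 m T (xbar 1 m \<phi>m \<phi>p) \<le> action 1 m T x"
proof (cases "\<exists>s\<in>{-T..T}. x s = 0")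
  case True
  then obtain s where "s \<in> {-T..T}" "x s = 0" by blast
  then show ?thesis using assms by (intro collision_action_ge_xbar[OF _ _ _ _ x]) auto
next
  case False
  then have "x \<in> Gamma_star 1 m \<phi>m \<phi>p T" using Gamma_cases(4)[OF \<open>T > 0\<close> x] by blast
  then obtain \<theta> where \<theta>: "continuous_on {-T..T} \<theta>" "\<And>t. t \<in> {-T..T} \<Longrightarrow> x t = of_real (norm (x t)) * cis (\<theta> t)"
      "\<theta> (-T) = \<phi>m" "\<theta> T = \<phi>p" and xH: "x \<in> H1 T" and nz: "\<And>t. t \<in> {-T..T} \<Longrightarrow> x t \<noteq> 0"
      and ends: "x (-T) = xbar 1 m \<phi>m \<phi>p (-T)" "x T = xbar 1 m \<phi>m \<phi>p T"
    by (auto simp: Gamma_star_def)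
  have "ennreal (2 * radial_cost 1 m (norm (xbar 1 m \<phi>m \<phi>p T))) \<le> action 1 m T x"
  proof (rule action_ge_full_turn[OF assms(1,2) has_H1_derivative_H1_deriv[OF xH] nz \<theta>(1)])
    show "norm (x (-T)) = norm (xbar 1 m \<phi>m \<phi>p T)" using assms(1) by (simp add: ends norm_xbar_ends)
  qed (use \<theta> \<Delta> ends in auto)
  then show ?thesis using assms by (simp add: action_xbar)
qed

theorem theorem1p3:
  fixes \<alpha> m\<^sub>1 \<phi>m \<phi>p T :: real
  assumes "m\<^sub>1 > 0" and "1 \<le> \<alpha>" and "\<alpha> < 2" and "T > 0" and "\<bar>\<phi>p - \<phi>m\<bar> \<le> 2 * pi"
  shows "\<exists>\<gamma>\<in>Gamma \<alpha> m\<^sub>1 \<phi>m \<phi>p T.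
    action \<alpha> m\<^sub>1 T \<gamma> = cbar \<alpha> m\<^sub>1 \<phi>m \<phi>p T \<and>
    (1 < \<alpha> \<longrightarrow>
       \<gamma> \<in> Gamma_star \<alpha> m\<^sub>1 \<phi>m \<phi>p T \<and>
       action \<alpha> m\<^sub>1 T \<gamma> < action \<alpha> m\<^sub>1 T (xbar \<alpha> m\<^sub>1 \<phi>m \<phi>p)) \<and>
    (\<alpha> = 1 \<and> \<bar>\<phi>p - \<phi>m\<bar> < 2 * pi \<longrightarrow>
       \<gamma> \<in> Gamma_star \<alpha> m\<^sub>1 \<phi>m \<phi>p T \<and>
       action \<alpha> m\<^sub>1 T \<gamma> < action \<alpha> m\<^sub>1 T (xbar \<alpha> m\<^sub>1 \<phi>m \<phi>p)) \<and>
    (\<phi>p \<noteq> \<phi>m \<longrightarrow> kepler_solution \<alpha> m\<^sub>1 T \<gamma>)"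
proof -
  have \<alpha>: "0 < \<alpha>" using assms by simp
  have cbar_eq: "action \<alpha> m\<^sub>1 T \<gamma> = cbar \<alpha> m\<^sub>1 \<phi>m \<phi>p T"
    if "\<gamma> \<in> Gamma \<alpha> m\<^sub>1 \<phi>m \<phi>p T" "\<And>x. x \<in> Gamma \<alpha> m\<^sub>1 \<phi>m \<phi>p T \<Longrightarrow> action \<alpha> m\<^sub>1 T \<gamma> \<le> action \<alpha> m\<^sub>1 T x" for \<gamma>
    unfolding cbar_def using that by (intro antisym INF_greatest INF_lower)
  show ?thesis
  proof (cases "\<alpha> = 1 \<and> \<bar>\<phi>p - \<phi>m\<bar> = 2 * pi")
    case True
    \<comment> \<open>The angle at the apex of the cone is \<open>pi\<close>: the collision-ejection solution is itself a minimizer.\<close>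
    then have "xbar \<alpha> m\<^sub>1 \<phi>m \<phi>p \<in> Gamma \<alpha> m\<^sub>1 \<phi>m \<phi>p T" "kepler_solution \<alpha> m\<^sub>1 T (xbar \<alpha> m\<^sub>1 \<phi>m \<phi>p)"
      "\<And>x. x \<in> Gamma \<alpha> m\<^sub>1 \<phi>m \<phi>p T \<Longrightarrow> action \<alpha> m\<^sub>1 T (xbar \<alpha> m\<^sub>1 \<phi>m \<phi>p) \<le> action \<alpha> m\<^sub>1 T x"
      using xbar_in_Gamma[OF assms(1) \<alpha> assms(3,4)] xbar_kepler_solution[OF assms(1) \<alpha> assms(3,4)]
        xbar_minimal_full_turn[OF assms(1,4)] by auto
    then show ?thesis using True cbar_eq by (intro bexI[of _ "xbar \<alpha> m\<^sub>1 \<phi>m \<phi>p"]) auto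
  next
    case False
    \<comment> \<open>The angle at the apex of the cone is \<open>(2 - \<alpha>) / 2 * \<bar>\<phi>p - \<phi>m\<bar>\<close>; it is less than \<open>pi\<close>.\<close>
    have \<Delta>: "\<bar>\<phi>p - \<phi>m\<bar> < 2 * pi / (2 - \<alpha>)"
    proof (cases "\<alpha> = 1")
      case True
      then show ?thesis using False assms by simp
    next
      case False
      have "2 * pi * (2 - \<alpha>) < 2 * pi * 1" using False assms by (intro mult_strict_left_mono) auto
      then have "2 * pi < 2 * pi / (2 - \<alpha>)" using assms by (simp add: pos_less_divide_eq)
      then show ?thesis using assms(5) by linarith
    qed
    obtain \<gamma> where \<gamma>: "\<gamma> \<in> Gamma_star \<alpha> m\<^sub>1 \<phi>m \<phi>p T"
        "\<And>x. x \<in> Gamma_star \<alpha> m\<^sub>1 \<phi>m \<phi>p T \<Longrightarrow> action \<alpha> m\<^sub>1 T \<gamma> \<le> action \<alpha> m\<^sub>1 T x"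
        "action \<alpha> m\<^sub>1 T \<gamma> < action \<alpha> m\<^sub>1 T (xbar \<alpha> m\<^sub>1 \<phi>m \<phi>p)"
      using noncollision_minimizer_exists[OF assms(1) \<alpha> assms(3,4) \<Delta>] by blast
    have \<gamma>_in: "\<gamma> \<in> Gamma \<alpha> m\<^sub>1 \<phi>m \<phi>p T" using \<gamma>(1) Gamma_star_subset_Gamma by blast
    have "action \<alpha> m\<^sub>1 T \<gamma> \<le> action \<alpha> m\<^sub>1 T x" if x: "x \<in> Gamma \<alpha> m\<^sub>1 \<phi>m \<phi>p T" for x
      using Gamma_cases(4)[OF assms(4) x] \<gamma>(2) collision_action_ge_xbar[OF assms(1) \<alpha> assms(3,4) x] \<gamma>(3)
      by (meson less_imp_le order_trans)
    from cbar_eq[OF \<gamma>_in this] have "action \<alpha> m\<^sub>1 T \<gamma> = cbar \<alpha> m\<^sub>1 \<phi>m \<phi>p T" .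
    moreover have "kepler_solution \<alpha> m\<^sub>1 T \<gamma>"
      by (rule minimizer_solves_kepler[OF assms(1) \<alpha> assms(4) \<gamma>(1,2)])
    ultimately show ?thesis using \<gamma>_in \<gamma>(1,3) by blast
  qed
qed

end
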